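(* For a matching market with a set $\mathcal M$ of $m$ goods, a set $\mathcal B$ of $m$ unit-demand buyers and non-negative valuation matrix $\mathbf V=(v_{i,j})_{i\in\mathcal B,\,j\in\mathcal M}$, the skewed-set aided descending price auction has a strongly polynomial run time of $O(m^4)$ when the coloring-update procedure (Procedure U, described in full in the context) is used to search for the maximally skewed set.
   Context: Market. Each buyer $i\in\mathcal B$ wants at most one good and values good $j\in\mathcal M$ at $v_{i,j}\ge 0$; $|\mathcal B|=|\mathcal M|=m$. For a price vector $\mathbf P=(P_j)_{j\in\mathcal M}$, put $U_i^*=\max\{0,\max_{j\in\mathcal M}(v_{i,j}-P_j)\}$ and $L_i=\{j\in\mathcal M: v_{i,j}-P_j=U_i^*\}$ (possibly empty). The preference graph at $\mathbf P$ is the bipartite graph between $\mathcal M$ and $\mathcal B$ in which $j\in\mathcal M$ and $i\in\mathcal B$ are adjacent iff $j\in L_i$. $N(\cdot)$ denotes the set of neighbors in the preference graph. A set $S\subseteq\mathcal M$ is a constricted good set if $|S|>|N(S)|$. The skewness of a non-empty $S\subseteq\mathcal M$ is $f(S)=|S|-|N(S)|+\frac1{|S|}$. When the preference graph has no perfect matching there is a unique set of goods maximizing $f$, called the maximally skewed set. Skewed-set aided descending price auction. Initialize $P_j=\max_{i\in\mathcal B}v_{i,j}$ for every good $j$ and construct the preference graph. While there exists a constricted good set: find the maximally skewed set $S$; for all $j\in S$ reduce $P_j$ by $$\min_{i\in\mathcal B\setminus N(S),\ l\in S}\Big\{\max_{k\in\mathcal M\setminus S}(v_{i,k}-P_k)-(v_{i,l}-P_l)\Big\};$$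 construct the preference graph again. Finally return $\mathbf P$. Colored preference graph. Every vertex is colored red, green or blue, and every edge red or blue. $\mathcal M_r,\mathcal M_g,\mathcal M_b$ (resp. $\mathcal B_r,\mathcal B_g,\mathcal B_b$) are the sets of red, green, blue goods (resp. buyers). $E^{gb}_{gb}$ is the set of edges between $\mathcal M_g\cup\mathcal M_b$ and $\mathcal B_g\cup\mathcal B_b$, and $E^{gb}_{g}$ the set of edges between $\mathcal M_g\cup\mathcal M_b$ and $\mathcal B_g$. $G(X,Y,F)$ denotes the graph with good set $X$, buyer set $Y$ and edge set $F$. Intended meaning: red edges are the edges of a maximum matching, all other edges are blue; blue goods are the unmatched goods (they lie in the maximally skewed set), green goods are the other goods of the maximally skewed set, red goods are all other goods; green buyers are the neighbors of the maximally skewed set, red buyers are the other matched buyers, blue buyers are the remaining buyers. The maximally skewed set is read off as $\mathcal M_g\cup\mathcal M_b$. An rb-search (DFS or BFS) uses only red edges from goods to buyers and only blue edges from buyers to goods; a br-search (DFS or BFS) uses only blue edges from goods to buyers and only red edges from buyers to goods. $Rch(\cdot)$ denotes the set of vertices reached from the given start. Initial coloring. Find a maximum matching by the Hopcroft–Karp algorithm; color its edges red and all other edges blue; color every matched vertex red and every other vertex blue. Run the br-BFS from $\mathcal M_b$ and color $Rch(\mathcal M_b)\setminus\mathcal M_b$ green. Procedure U. Input: a preference graph (colored, except in the first round), and the set $A$ of buyers to be added to the neighbor set of the previous maximally skewed set. Output: an updated colored preference graph. 1. If the input graph is not colored, run the initial coloring and stop. Otherwise do steps 2–5. 2. Remove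 all edges connecting red goods and green buyers, and add the corresponding blue edges connecting goods and buyers in $A$. 3. While $A\cap\mathcal B_b\ne\emptyset$: pick $a\in A\cap\mathcal B_b$ and do the first applicable of (a), (b), (c), then remove $a$ from $A$. (a) If $|N(a)\cap\mathcal M_b|>1$: pick an arbitrary $x\in N(a)\cap\mathcal M_b$, color the edge $(a,x)$ red and color $a,x$ green. (b) If $|N(a)\cap\mathcal M_b|=1$: let $x$ be its unique element, color the edge $(a,x)$ red and color $a,x$ green. If $N(a)\cap\mathcal M_g\ne\emptyset$, run the rb-DFS from $x$ in $G(\mathcal M_g\cup\mathcal M_b,\mathcal B_g,E^{gb}_{gb})$ to get $Rch(x)$, and color the vertices of $Rch(x)$ red if $Rch(x)\cap\mathcal M_b=\{x\}$; otherwise run the br-DFS from $a$ in the same graph to get $Rch(a)$, and color the vertices of $Rch(a)$ red if $Rch(a)\cap\mathcal M_b=\{x\}$. (c) If $N(a)\cap\mathcal M_g\ne\emptyset$: run the rb-DFS from $a$ in $G(\mathcal M_g\cup\mathcal M_b,\mathcal B_g,E^{gb}_{gb})$ until the first $x\in\mathcal M_b$ is found; color $a,x$ green and switch the color of every edge used in a path from $a$ to $x$; run a br-BFS from $\mathcal M_b$ in $G(\mathcal M_g\cup\mathcal M_b,\mathcal B_g,E^{gb}_{g})$ to get $Rch(\mathcal M_b)$; color every vertex of $(\mathcal M_g\cup\mathcal B_g)\setminus Rch(\mathcal M_b)$ red. 4. Run the br-BFS from $\mathcal M_g$ in $G(\mathcal M,\mathcal B,E)$ ($E$ the set of all edges)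 to get a reachable set $R^*$. 5. If $R^*\cap\mathcal B_b=\emptyset$, color all vertices of $R^*\setminus\mathcal M_b$ green. Otherwise: – while $R^*\cap\mathcal B_b\ne\emptyset$: pick $a\in R^*\cap\mathcal B_b$ and run the rb-DFS from $a$ to get $Rch(a)$; if there is $x\in Rch(a)\cap\mathcal M_b$, color $a,x$ green, switch the color of every edge used in a path from $a$ to $x$, run a br-BFS from $\mathcal M_b$ in $G(\mathcal M_g\cup\mathcal M_b,\mathcal B_g,E^{gb}_{g})$ to get $Rch(\mathcal M_b)$, and color every vertex of $(\mathcal M_g\cup\mathcal B_g)\setminus Rch(\mathcal M_b)$ red; – then run the br-BFS from $\mathcal M_b$ in $G(\mathcal M,\mathcal B_g,E)$ to get $Rch(\mathcal M_b)$, and color all vertices of $(\mathcal M_g\cup\mathcal B_g)\setminus Rch(\mathcal M_b)$ red. Complexity model. Basic mathematical operations take unit time; strongly polynomial means that the number of operations and the space used are bounded by a polynomial in the number of input parameters and do not depend on the size of the parameters.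
   Formalization: The price cut's maximum includes utility 0 (else the auction may never end); step 5 drops buyers reaching no blue good; 3(b) tests use colors before x turns green; the loop runs while the set found by U, which may not be the maximally skewed one, is constricted. *)

theory Defs
  imports "HOL-Library.Landau_Symbols" "HOL-Library.Monad_Syntax"
begin

section \<open>The market\<close>

text \<open>
  Goods and buyers are numbered \<^term>\<open>0\<close>, ..., \<^term>\<open>m - 1\<close>; \<^term>\<open>v i j\<close> is the value of good
  \<^term>\<open>j\<close> for buyer \<^term>\<open>i\<close>.  An edge of a preference graph is a pair (good, buyer).
\<close>

type_synonym valuation = "nat \<Rightarrow> nat \<Rightarrow> real"
type_synonym prices = "nat \<Rightarrow> real"
type_synonym graph = "(nat \<times> nat) set"

definition best_utility :: "nat \<Rightarrow> valuation \<Rightarrow> prices \<Rightarrow> nat \<Rightarrow> real" where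
  "best_utility m v P i = Max (insert 0 ((\<lambda>j. v i j - P j) ` {..<m}))"

definition preferred :: "nat \<Rightarrow> valuation \<Rightarrow> prices \<Rightarrow> nat \<Rightarrow> nat set" where
  "preferred m v P i = {j. j < m \<and> v i j - P j = best_utility m v P i}"

definition preference_graph :: "nat \<Rightarrow> valuation \<Rightarrow> prices \<Rightarrow> graph" where
  "preference_graph m v P = {(j, i). i < m \<and> j \<in> preferred m v P i}"

definition neighbors :: "graph \<Rightarrow> nat set \<Rightarrow> nat set" where
  "neighbors E S = {i. \<exists>j\<in>S. (j, i) \<in> E}"

definition constricted :: "nat \<Rightarrow> graph \<Rightarrow> nat set \<Rightarrow> bool" where
  "constricted m E S \<longleftrightarrow> S \<subseteq> {..<m} \<and> card S > card (neighbors E S)"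

definition skewness :: "graph \<Rightarrow> nat set \<Rightarrow> real" where
  "skewness E S = real (card S) - real (card (neighbors E S)) + 1 / real (card S)"

definition maximally_skewed :: "nat \<Rightarrow> graph \<Rightarrow> nat set \<Rightarrow> bool" where
  "maximally_skewed m E S \<longleftrightarrow> is_arg_max (skewness E) (\<lambda>T. T \<subseteq> {..<m} \<and> T \<noteq> {}) S"

text \<open>
  The amount by which the prices of the goods in \<^term>\<open>S\<close> fall.  As in \<^const>\<open>best_utility\<close>, the
  maximum over the goods outside \<^term>\<open>S\<close> includes the outside option of utility 0.  Without it the
  maximum is over the empty set when \<^term>\<open>S\<close> consists of all goods, and the loop of the auction can
  run for ever on reductions by 0.
\<close>

definition price_cut :: "nat \<Rightarrow> valuation \<Rightarrow> prices \<Rightarrow> graph \<Rightarrow> nat set \<Rightarrow> real" where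
  "price_cut m v P E S =
     Min {Max (insert 0 ((\<lambda>k. v i k - P k) ` ({..<m} - S))) - (v i l - P l) | i l.
            i \<in> {..<m} - neighbors E S \<and> l \<in> S}"


section \<open>Programs with costs\<close>

text \<open>
  An outcome \<^term>\<open>(x, t, s)\<close> says that the program can finish with result \<^term>\<open>x\<close> after exactly
  \<^term>\<open>t\<close> basic operations, with at most \<^term>\<open>s\<close> memory cells in use at the same time.  Several
  outcomes stand for choices that the algorithm leaves open.  Arithmetic on reals, comparisons,
  array accesses and pointer operations cost one unit each, whatever the size of the numbers.
  Sets and functions that occur as data stand for arrays indexed by vertices or pairs of vertices.
\<close>

datatype 'a prog = Prog (outcomes: "('a \<times> nat \<times> nat) set")

definition ret :: "'a \<Rightarrow> 'a prog" where
  "ret x = Prog {(x, 0, 0)}"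

definition bind_prog :: "'a prog \<Rightarrow> ('a \<Rightarrow> 'b prog) \<Rightarrow> 'b prog" where
  "bind_prog p f = Prog {(y, t + t', max s s') | x t s y t' s'.
     (x, t, s) \<in> outcomes p \<and> (y, t', s') \<in> outcomes (f x)}"

adhoc_overloading Monad_Syntax.bind \<rightleftharpoons> bind_prog

lemma bind_prog_cong [fundef_cong]:
  assumes "p = p'" and "\<And>x t s. (x, t, s) \<in> outcomes p' \<Longrightarrow> f x = f' x"
  shows "bind_prog p f = bind_prog p' f'"
  using assms unfolding bind_prog_def by (auto; metis)

definition tick :: "nat \<Rightarrow> unit prog" where
  "tick n = Prog {((), n, 0)}"

definition pick :: "'a set \<Rightarrow> 'a prog" where
  "pick X = Prog ((\<lambda>x. (x, 1, 0)) ` X)"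

definition with_cells :: "nat \<Rightarrow> 'a prog \<Rightarrow> 'a prog" where
  "with_cells n p = Prog ((\<lambda>(x, t, s). (x, t, s + n)) ` outcomes p)"

primrec for_each :: "'a list \<Rightarrow> ('a \<Rightarrow> 's \<Rightarrow> 's prog) \<Rightarrow> 's \<Rightarrow> 's prog" where
  "for_each [] f s = ret s"
| "for_each (x # xs) f s = do { tick 1; s' \<leftarrow> f x s; for_each xs f s' }"

text \<open>
  The elements of a list that pass a test.  All tests below look at no more than three array entries;
  8 operations cover them together with the loop overhead and the extension of the result.
\<close>

primrec select :: "('a \<Rightarrow> bool) \<Rightarrow> 'a list \<Rightarrow> 'a list prog" where
  "select Q [] = ret []"
| "select Q (x # xs) =
     do { tick 8; ys \<leftarrow> select Q xs; ret (if Q x then x # ys else ys) }"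

text \<open>``While the set is non-empty: pick an element, process it, remove it.''\<close>

function pick_each :: "'a set \<Rightarrow> ('a \<Rightarrow> 's \<Rightarrow> 's prog) \<Rightarrow> 's \<Rightarrow> 's prog" where
  "pick_each X f s =
     (if finite X \<and> X \<noteq> {}
      then do { x \<leftarrow> pick X; s' \<leftarrow> f x s; pick_each (X - {x}) f s' }
      else ret s)"
  by pat_completeness auto
termination
  by (relation "measure (\<lambda>(X, _, _). card X)") (auto simp: pick_def intro: psubset_card_mono)

declare pick_each.simps [simp del]


section \<open>Colored graphs\<close>

datatype color = Red | Green | Blue

datatype vertex = Good nat | Buyer nat

text \<open>\<^term>\<open>edge_color K j i = None\<close> means that good \<^term>\<open>j\<close> and buyer \<^term>\<open>i\<close> are not adjacent.\<close>

record cgraph =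
  good_color :: "nat \<Rightarrow> color"
  buyer_color :: "nat \<Rightarrow> color"
  edge_color :: "nat \<Rightarrow> nat \<Rightarrow> color option"

definition vertices :: "nat \<Rightarrow> vertex list" where
  "vertices m = map Good [0..<m] @ map Buyer [0..<m]"

definition goods :: "nat \<Rightarrow> cgraph \<Rightarrow> color set \<Rightarrow> nat set" where
  "goods m K C = {j. j < m \<and> good_color K j \<in> C}"

definition buyers :: "nat \<Rightarrow> cgraph \<Rightarrow> color set \<Rightarrow> nat set" where
  "buyers m K C = {i. i < m \<and> buyer_color K i \<in> C}"

definition edges :: "nat \<Rightarrow> cgraph \<Rightarrow> graph" where
  "edges m K = {(j, i). j < m \<and> i < m \<and> edge_color K j i \<noteq> None}"

fun vertex_color :: "cgraph \<Rightarrow> vertex \<Rightarrow> color" where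
  "vertex_color K (Good j) = good_color K j"
| "vertex_color K (Buyer i) = buyer_color K i"

fun recolor :: "vertex \<Rightarrow> color \<Rightarrow> cgraph \<Rightarrow> cgraph" where
  "recolor (Good j) c K = K\<lparr>good_color := (good_color K)(j := c)\<rparr>"
| "recolor (Buyer i) c K = K\<lparr>buyer_color := (buyer_color K)(i := c)\<rparr>"

definition set_edge :: "nat \<Rightarrow> nat \<Rightarrow> color option \<Rightarrow> cgraph \<Rightarrow> cgraph" where
  "set_edge j i c K = K\<lparr>edge_color := (edge_color K)(j := (edge_color K j)(i := c))\<rparr>"

fun switch :: "color \<Rightarrow> color" where
  "switch Red = Blue"
| "switch Blue = Red"
| "switch Green = Green"

fun switch_edge :: "vertex \<Rightarrow> vertex \<Rightarrow> cgraph \<Rightarrow> cgraph" where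
  "switch_edge (Good j) (Buyer i) K = set_edge j i (map_option switch (edge_color K j i)) K"
| "switch_edge (Buyer i) (Good j) K = set_edge j i (map_option switch (edge_color K j i)) K"
| "switch_edge _ _ K = K"

definition paint :: "nat \<Rightarrow> (vertex \<Rightarrow> bool) \<Rightarrow> color \<Rightarrow> cgraph \<Rightarrow> cgraph prog" where
  "paint m Q c K =
     for_each (vertices m) (\<lambda>u K'. do { tick 8; ret (if Q u then recolor u c K' else K') }) K"


section \<open>Searches\<close>

fun rb :: "cgraph \<Rightarrow> vertex \<Rightarrow> vertex \<Rightarrow> bool" where
  "rb K (Good j) (Buyer i) \<longleftrightarrow> edge_color K j i = Some Red"
| "rb K (Buyer i) (Good j) \<longleftrightarrow> edge_color K j i = Some Blue"
| "rb K _ _ \<longleftrightarrow> False"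

fun br :: "cgraph \<Rightarrow> vertex \<Rightarrow> vertex \<Rightarrow> bool" where
  "br K (Good j) (Buyer i) \<longleftrightarrow> edge_color K j i = Some Blue"
| "br K (Buyer i) (Good j) \<longleftrightarrow> edge_color K j i = Some Red"
| "br K _ _ \<longleftrightarrow> False"

text \<open>
  The restriction to the subgraph with goods \<^term>\<open>X\<close>, buyers \<^term>\<open>Y\<close> and edges \<^term>\<open>F\<close>.  Only the
  vertex that an arc enters has to belong to the subgraph, because some searches start at a buyer
  outside \<^term>\<open>Y\<close>.
\<close>

fun in_subgraph :: "nat set \<Rightarrow> nat set \<Rightarrow> graph \<Rightarrow> (vertex \<Rightarrow> vertex \<Rightarrow> bool) \<Rightarrow> vertex \<Rightarrow> vertex \<Rightarrow> bool" where
  "in_subgraph X Y F arc (Good j) (Buyer i) \<longleftrightarrow> arc (Good j) (Buyer i) \<and> i \<in> Y \<and> (j, i) \<in> F"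
| "in_subgraph X Y F arc (Buyer i) (Good j) \<longleftrightarrow> arc (Buyer i) (Good j) \<and> j \<in> X \<and> (j, i) \<in> F"
| "in_subgraph X Y F arc _ _ \<longleftrightarrow> False"

fun opposite :: "vertex \<Rightarrow> nat \<Rightarrow> vertex" where
  "opposite (Good _) i = Buyer i"
| "opposite (Buyer _) j = Good j"

datatype search_order = BFS | DFS

text \<open>
  The frontier lists the vertices whose scan is not finished, each with the set of indices on the other
  side that it has already looked at; the first entry is the active one.  One step looks at one more
  index, in arbitrary order.  The trail holds the pairs (new vertex, vertex it was found from), latest
  first.  The search stops at the first vertex in \<^term>\<open>target\<close> that it finds.
\<close>

type_synonym search_trail = "(vertex \<times> vertex) list"

function search_loop ::
  "search_order \<Rightarrow> nat \<Rightarrow> (vertex \<Rightarrow> vertex \<Rightarrow> bool) \<Rightarrow> vertex set \<Rightarrow>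
   (vertex \<times> nat set) list \<Rightarrow> vertex set \<Rightarrow> search_trail \<Rightarrow>
   (vertex set \<times> search_trail \<times> vertex option) prog" where
  "search_loop ord m arc target [] visited trail = ret (visited, trail, None)"
| "search_loop ord m arc target ((u, D) # rest) visited trail =
     (if {..<m} \<subseteq> D
      then do { tick 2; search_loop ord m arc target rest visited trail }
      else do {
        c \<leftarrow> pick ({..<m} - D);
        tick 12;
        let w = opposite u c;
        if arc u w \<and> w \<notin> visited
        then if w \<in> target
          then ret (insert w visited, (w, u) # trail, Some w)
          else search_loop ord m arc target
            (case ord of
               BFS \<Rightarrow> (u, insert c D) # rest @ [(w, {})]
             | DFS \<Rightarrow> (w, {}) # (u, insert c D) # rest)
            (insert w visited) ((w, u) # trail)
        else search_loop ord m arc target ((u, insert c D) # rest) visited trail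
      })"
  by pat_completeness auto

termination
proof -
  define \<mu> :: "nat \<Rightarrow> (vertex \<times> nat set) list \<Rightarrow> vertex set \<Rightarrow> nat" where
    "\<mu> = (\<lambda>m fr vis. (m + 2) * card (set (vertices m) - vis) + (\<Sum>(u, D)\<leftarrow>fr. card ({..<m} - D) + 1))"
  have new: "card (set (vertices m) - insert (opposite u c) vis) < card (set (vertices m) - vis)"
    if "c < m" "opposite u c \<notin> vis" for m u c and vis :: "vertex set"
    using that by (intro psubset_card_mono) (cases u; auto simp: vertices_def)+
  have scan: "card ({..<m} - insert c D) < card ({..<m} - D)" if "c < m" "c \<notin> D" for m c and D :: "nat set"
    using that by (intro psubset_card_mono) auto
  have dec: "\<mu> m fr' (insert (opposite u c) vis) < \<mu> m ((u, D) # rest) vis"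
    if "c < m" "c \<notin> D" "opposite u c \<notin> vis"
      "fr' = (u, insert c D) # rest @ [(opposite u c, {})] \<or> fr' = (opposite u c, {}) # (u, insert c D) # rest"
    for m u c D rest vis and fr' :: "(vertex \<times> nat set) list"
  proof -
    have "(m + 2) * card (set (vertices m) - insert (opposite u c) vis) + (m + 2)
        \<le> (m + 2) * card (set (vertices m) - vis)"
      using mult_le_mono2[OF Suc_leI[OF new[OF that(1,3)]], of "m + 2"] by simp
    moreover note scan[OF that(1,2)]
    ultimately show ?thesis using that(4) unfolding \<mu>_def by auto
  qed
  show ?thesis
    apply (relation "measure (\<lambda>(ord, m, arc, target, fr, vis, trail). \<mu> m fr vis)")
        apply (simp_all add: pick_def del: opposite.simps)
      apply (simp add: \<mu>_def)
     apply (auto intro!: dec split: search_order.splits)[1]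
    apply (auto simp: \<mu>_def dest: scan)
    done
qed

definition search ::
  "search_order \<Rightarrow> nat \<Rightarrow> (vertex \<Rightarrow> vertex \<Rightarrow> bool) \<Rightarrow> vertex set \<Rightarrow> vertex set \<Rightarrow> vertex list \<Rightarrow>
   (vertex set \<times> search_trail \<times> vertex option) prog" where
  "search ord m arc target visited starts = with_cells (2 * m * m + 10 * m + 10) (do {
     tick (2 * m + length starts);
     search_loop ord m arc target (map (\<lambda>u. (u, {})) starts) (visited \<union> set starts) []
   })"

text \<open>Follows the trail back from a vertex to the start of the search, switching the colors on the way.\<close>

primrec switch_path :: "search_trail \<Rightarrow> vertex \<Rightarrow> cgraph \<Rightarrow> cgraph prog" where
  "switch_path [] w K = ret K"
| "switch_path (e # trail) w K = do {
     tick 4;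
     if fst e = w then switch_path trail (snd e) (switch_edge (snd e) w K) else switch_path trail w K
   }"


section \<open>Initial coloring\<close>

text \<open>
  During the Hopcroft-Karp algorithm the red edges form the current matching, and the matched vertices
  are red, the unmatched ones blue.  A phase finds by a BFS from the unmatched goods the length
  \<^term>\<open>D\<close> of a shortest augmenting path, and then augments along a maximal set of vertex-disjoint
  augmenting paths of this length, which are found by DFS in the layered graph.
\<close>

definition layered_augment ::
  "nat \<Rightarrow> vertex set \<Rightarrow> (vertex \<Rightarrow> nat) \<Rightarrow> nat \<Rightarrow> nat \<Rightarrow> cgraph \<times> vertex set \<Rightarrow> (cgraph \<times> vertex set) prog" where
  "layered_augment m R depth D g = (\<lambda>(K, visited). do {
     (visited', trail, end) \<leftarrow> search DFS m
       (\<lambda>u w. br K u w \<and> w \<in> R \<and> depth w = Suc (depth u) \<and> depth w \<le> D)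
       (Buyer ` buyers m K {Blue}) visited [Good g];
     case end of
       None \<Rightarrow> ret (K, visited')
     | Some w \<Rightarrow> do {
         K' \<leftarrow> switch_path trail w K;
         tick 2;
         ret (recolor w Red (recolor (Good g) Red K'), visited')
       }
   })"

definition hk_phase :: "nat \<Rightarrow> cgraph \<Rightarrow> (bool \<times> cgraph) prog" where
  "hk_phase m K = do {
     free \<leftarrow> select (\<lambda>j. good_color K j = Blue) [0..<m];
     (R, trail, _) \<leftarrow> search BFS m (br K) {} {} (map Good free);
     ends \<leftarrow> select (\<lambda>i. buyer_color K i = Blue \<and> Buyer i \<in> R) [0..<m];
     if ends = [] then ret (False, K)
     else do {
       tick (2 * m + length trail);
       depth \<leftarrow> for_each (rev trail) (\<lambda>(w, u) d. do { tick 3; ret (d(w := Suc (d u))) }) (\<lambda>_. 0);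
       D \<leftarrow> for_each ends (\<lambda>i D. do { tick 2; ret (min D (depth (Buyer i))) }) (depth (Buyer (hd ends)));
       (K', _) \<leftarrow> for_each free (layered_augment m R depth D) (K, {});
       ret (True, K')
     }
   }"

primrec hk_phases :: "nat \<Rightarrow> nat \<Rightarrow> cgraph \<Rightarrow> cgraph prog" where
  "hk_phases 0 m K = ret K"
| "hk_phases (Suc n) m K = do {
     (augmented, K') \<leftarrow> hk_phase m K;
     if augmented then hk_phases n m K' else ret K'
   }"

text \<open>At most \<^term>\<open>m\<close> phases augment the matching, so the phase after them is the last.\<close>

definition hopcroft_karp :: "nat \<Rightarrow> cgraph \<Rightarrow> cgraph prog" where
  "hopcroft_karp m K = hk_phases (Suc m) m K"

definition initial_coloring :: "nat \<Rightarrow> graph \<Rightarrow> cgraph prog" where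
  "initial_coloring m E = do {
     tick (m * m + 2 * m);
     K \<leftarrow> hopcroft_karp m \<lparr>good_color = (\<lambda>_. Blue), buyer_color = (\<lambda>_. Blue),
            edge_color = (\<lambda>j i. if j < m \<and> i < m \<and> (j, i) \<in> E then Some Blue else None)\<rparr>;
     Mb \<leftarrow> select (\<lambda>j. good_color K j = Blue) [0..<m];
     (R, _, _) \<leftarrow> search BFS m (br K) {} {} (map Good Mb);
     paint m (\<lambda>u. u \<in> R \<and> u \<notin> Good ` set Mb) Green K
   }"


section \<open>Updating the coloring\<close>

text \<open>
  The argument \<^term>\<open>A\<close> holds the buyers that become neighbors of the previous maximally skewed set, and
  that set consists of the goods that are not red; the edges to add are those between the two.
\<close>

definition update_edges :: "nat \<Rightarrow> graph \<Rightarrow> nat set \<Rightarrow> cgraph \<Rightarrow> cgraph prog" where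
  "update_edges m E A K =
     for_each (List.product [0..<m] [0..<m]) (\<lambda>(j, i) K'. do {
       tick 12;
       ret (if good_color K j = Red \<and> buyer_color K i = Green then set_edge j i None K'
            else if good_color K j \<noteq> Red \<and> i \<in> A \<and> (j, i) \<in> E \<and> edge_color K j i = None
              then set_edge j i (Some Blue) K'
            else K')
     }) K"

text \<open>
  Runs the br-BFS from the blue goods in the subgraph with goods \<^term>\<open>X\<close>, the green buyers, and edges
  \<^term>\<open>F\<close>, and colors the green vertices that it does not reach red.
\<close>

definition retract_green :: "nat \<Rightarrow> nat set \<Rightarrow> graph \<Rightarrow> cgraph \<Rightarrow> cgraph prog" where
  "retract_green m X F K = do {
     Mb \<leftarrow> select (\<lambda>j. good_color K j = Blue) [0..<m];
     (R, _, _) \<leftarrow> search BFS m (in_subgraph X (buyers m K {Green}) F (br K)) {} {} (map Good Mb);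
     paint m (\<lambda>u. vertex_color K u = Green \<and> u \<notin> R) Red K
   }"

definition retract_green_gb :: "nat \<Rightarrow> cgraph \<Rightarrow> cgraph prog" where
  "retract_green_gb m K = retract_green m (goods m K {Green, Blue})
     (edges m K \<inter> goods m K {Green, Blue} \<times> buyers m K {Green}) K"

definition in_gb_subgraph :: "nat \<Rightarrow> cgraph \<Rightarrow> (vertex \<Rightarrow> vertex \<Rightarrow> bool) \<Rightarrow> vertex \<Rightarrow> vertex \<Rightarrow> bool" where
  "in_gb_subgraph m K = in_subgraph (goods m K {Green, Blue}) (buyers m K {Green})
     (edges m K \<inter> goods m K {Green, Blue} \<times> buyers m K {Green, Blue})"

definition match_green :: "nat \<Rightarrow> nat \<Rightarrow> cgraph \<Rightarrow> cgraph" where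
  "match_green a x K = recolor (Buyer a) Green (recolor (Good x) Green (set_edge x a (Some Red) K))"

text \<open>
  Processing of one blue buyer that has become a neighbor of the previous maximally skewed set.
  In the case of a unique blue neighbor \<^term>\<open>x\<close>, the tests ``a has a green neighbor'' and ``x is the
  only blue good reached'' refer to the colors before \<^term>\<open>x\<close> became green (afterwards the first would
  always be true and the second always false), while the searches run in the updated graph.
\<close>

definition process_new_buyer :: "nat \<Rightarrow> nat \<Rightarrow> cgraph \<Rightarrow> cgraph prog" where
  "process_new_buyer m a K = do {
     Nb \<leftarrow> select (\<lambda>j. edge_color K j a \<noteq> None \<and> good_color K j = Blue) [0..<m];
     Ng \<leftarrow> select (\<lambda>j. edge_color K j a \<noteq> None \<and> good_color K j = Green) [0..<m];
     tick (length Nb + 4);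
     if length Nb > 1 then do {
       x \<leftarrow> pick (set Nb);
       tick 3;
       ret (match_green a x K)
     }
     else if length Nb = 1 then do {
       let x = hd Nb;
       let K1 = match_green a x K;
       tick 3;
       if Ng \<noteq> [] then do {
         (R, _, _) \<leftarrow> search DFS m (in_gb_subgraph m K1 (rb K1)) {} {} [Good x];
         X \<leftarrow> select (\<lambda>j. Good j \<in> R \<and> good_color K j = Blue) [0..<m];
         if X = [x] then paint m (\<lambda>u. u \<in> R) Red K1
         else do {
           (R', _, _) \<leftarrow> search DFS m (in_gb_subgraph m K1 (br K1)) {} {} [Buyer a];
           X' \<leftarrow> select (\<lambda>j. Good j \<in> R' \<and> good_color K j = Blue) [0..<m];
           if X' = [x] then paint m (\<lambda>u. u \<in> R') Red K1 else ret K1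
         }
       }
       else ret K1
     }
     else if Ng \<noteq> [] then do {
       (_, trail, end) \<leftarrow> search DFS m (in_gb_subgraph m K (rb K)) (Good ` goods m K {Blue}) {} [Buyer a];
       case end of
         None \<Rightarrow> ret K
       | Some x \<Rightarrow> do {
           K1 \<leftarrow> switch_path trail x K;
           tick 2;
           retract_green_gb m (recolor (Buyer a) Green (recolor x Green K1))
         }
     }
     else ret K
   }"

definition process_reached_buyer :: "nat \<Rightarrow> nat \<Rightarrow> cgraph \<Rightarrow> cgraph prog" where
  "process_reached_buyer m a K = do {
     (R, trail, _) \<leftarrow> search DFS m (rb K) {} {} [Buyer a];
     X \<leftarrow> select (\<lambda>j. Good j \<in> R \<and> good_color K j = Blue) [0..<m];
     if X = [] then ret K
     else do {
       x \<leftarrow> pick (set X);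
       K1 \<leftarrow> switch_path trail (Good x) K;
       tick 2;
       retract_green_gb m (recolor (Buyer a) Green (recolor (Good x) Green K1))
     }
   }"

text \<open>
  A picked buyer that reaches no blue good is dropped from the loop of the last step: its search would
  have the same result for ever.
\<close>

definition update_coloring :: "nat \<Rightarrow> graph \<Rightarrow> nat set \<Rightarrow> cgraph \<Rightarrow> cgraph prog" where
  "update_coloring m E A K0 = do {
     K1 \<leftarrow> update_edges m E A K0;
     New \<leftarrow> select (\<lambda>i. i \<in> A \<and> buyer_color K1 i = Blue) [0..<m];
     K2 \<leftarrow> pick_each (set New) (process_new_buyer m) K1;
     Mg \<leftarrow> select (\<lambda>j. good_color K2 j = Green) [0..<m];
     (R, _, _) \<leftarrow> search BFS m (br K2) {} {} (map Good Mg);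
     Bb \<leftarrow> select (\<lambda>i. Buyer i \<in> R \<and> buyer_color K2 i = Blue) [0..<m];
     if Bb = [] then paint m (\<lambda>u. u \<in> R \<and> u \<notin> Good ` goods m K2 {Blue}) Green K2
     else do {
       K3 \<leftarrow> pick_each (set Bb) (process_reached_buyer m) K2;
       retract_green m {..<m} (edges m K3) K3
     }
   }"

definition procedure_U :: "nat \<Rightarrow> graph \<Rightarrow> nat set \<Rightarrow> cgraph option \<Rightarrow> cgraph prog" where
  "procedure_U m E A K =
     (case K of None \<Rightarrow> initial_coloring m E | Some K0 \<Rightarrow> update_coloring m E A K0)"


section \<open>The auction\<close>

definition initial_prices :: "nat \<Rightarrow> valuation \<Rightarrow> prices prog" where
  "initial_prices m v =
     for_each [0..<m] (\<lambda>j P. do {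
       p \<leftarrow> for_each [0..<m] (\<lambda>i p. do { tick 2; ret (max p (v i j)) }) (v 0 j);
       tick 1;
       ret (P(j := p))
     }) (\<lambda>_. 0)"

definition construct_graph :: "nat \<Rightarrow> valuation \<Rightarrow> prices \<Rightarrow> graph prog" where
  "construct_graph m v P =
     for_each [0..<m] (\<lambda>i E. do {
       u \<leftarrow> for_each [0..<m] (\<lambda>j u. do { tick 3; ret (max u (v i j - P j)) }) 0;
       for_each [0..<m] (\<lambda>j E. do {
         tick 3;
         ret (if v i j - P j = u then insert (j, i) E else E)
       }) E
     }) {}"

definition find_neighbors :: "nat \<Rightarrow> graph \<Rightarrow> nat set \<Rightarrow> nat set prog" where
  "find_neighbors m E S =
     for_each [0..<m] (\<lambda>i N. do {
       b \<leftarrow> for_each [0..<m] (\<lambda>j b. do { tick 4; ret (b \<or> (j \<in> S \<and> (j, i) \<in> E)) }) False;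
       tick 2;
       ret (if b then insert i N else N)
     }) {}"

text \<open>The result is \<^const>\<open>None\<close> only if the minimum is over the empty set.\<close>

definition find_price_cut :: "nat \<Rightarrow> valuation \<Rightarrow> prices \<Rightarrow> nat set \<Rightarrow> nat set \<Rightarrow> real option prog" where
  "find_price_cut m v P N S =
     for_each [0..<m] (\<lambda>i d. do {
       tick 1;
       if i \<in> N then ret d
       else do {
         b \<leftarrow> for_each [0..<m] (\<lambda>k b. do {
           tick 4;
           ret (if k \<in> S then b else max b (v i k - P k))
         }) 0;
         for_each [0..<m] (\<lambda>l d. do {
           tick 6;
           ret (if l \<in> S
                then (case d of None \<Rightarrow> Some (b - (v i l - P l))
                      | Some e \<Rightarrow> Some (min e (b - (v i l - P l))))
                else d)
         }) d
       }
     }) None"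

definition reduce_prices :: "nat \<Rightarrow> valuation \<Rightarrow> prices \<Rightarrow> nat set \<Rightarrow> nat set \<Rightarrow> prices prog" where
  "reduce_prices m v P N S = do {
     d \<leftarrow> find_price_cut m v P N S;
     case d of
       None \<Rightarrow> ret P
     | Some e \<Rightarrow> for_each [0..<m] (\<lambda>j P'. do {
         tick 4;
         ret (if j \<in> S then P'(j := P j - e) else P')
       }) P
   }"

datatype config =
  Running prices graph cgraph
| Returned prices

text \<open>The cells for the valuations, the prices, the two graphs and the lists of vertices.\<close>

definition main_cells :: "nat \<Rightarrow> nat" where
  "main_cells m = 3 * m * m + 20 * m + 20"

definition auction_start :: "nat \<Rightarrow> valuation \<Rightarrow> config prog" where
  "auction_start m v = with_cells (main_cells m) (do {
     P \<leftarrow> initial_prices m v;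
     E \<leftarrow> construct_graph m v P;
     K \<leftarrow> procedure_U m E {} None;
     ret (Running P E K)
   })"

text \<open>
  One test of the loop condition, followed by one pass through the loop if the test succeeds.  The set
  \<^term>\<open>S\<close> of the goods that are green or blue is what the coloring offers as the maximally skewed set.
  If there is a constricted set at all, then the maximally skewed set is constricted, so the test is
  whether \<^term>\<open>S\<close> is.
\<close>

definition auction_round :: "nat \<Rightarrow> valuation \<Rightarrow> prices \<Rightarrow> graph \<Rightarrow> cgraph \<Rightarrow> config prog" where
  "auction_round m v P E K = with_cells (main_cells m) (do {
     Sl \<leftarrow> select (\<lambda>j. good_color K j \<in> {Green, Blue}) [0..<m];
     let S = set Sl;
     N \<leftarrow> find_neighbors m E S;
     Nl \<leftarrow> select (\<lambda>i. i \<in> N) [0..<m];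
     tick 1;
     if length Sl > length Nl then do {
       P' \<leftarrow> reduce_prices m v P N S;
       E' \<leftarrow> construct_graph m v P';
       N' \<leftarrow> find_neighbors m E' S;
       A \<leftarrow> select (\<lambda>i. i \<in> N' \<and> i \<notin> N) [0..<m];
       K' \<leftarrow> procedure_U m E' (set A) (Some K);
       ret (Running P' E' K')
     }
     else ret (Returned P)
   })"

text \<open>
  \<^term>\<open>auction m v c t s\<close>: the auction can get to \<^term>\<open>c\<close> with \<^term>\<open>t\<close> operations in total and at most
  \<^term>\<open>s\<close> cells.
\<close>

inductive auction :: "nat \<Rightarrow> valuation \<Rightarrow> config \<Rightarrow> nat \<Rightarrow> nat \<Rightarrow> bool" for m v where
  start: "(c, t, s) \<in> outcomes (auction_start m v) \<Longrightarrow> auction m v c t s"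
| round: "auction m v (Running P E K) t s \<Longrightarrow> (c, t', s') \<in> outcomes (auction_round m v P E K) \<Longrightarrow>
    auction m v c (t + t') (max s s')"

definition next_config :: "nat \<Rightarrow> valuation \<Rightarrow> config \<Rightarrow> config \<Rightarrow> bool" where
  "next_config m v c c' \<longleftrightarrow>
     (\<exists>P E K t s. c = Running P E K \<and> (c', t, s) \<in> outcomes (auction_round m v P E K))"

text \<open>Every run of the auction gets to a return statement, whatever choices are made.\<close>

definition always_returns :: "nat \<Rightarrow> valuation \<Rightarrow> bool" where
  "always_returns m v \<longleftrightarrow>
     outcomes (auction_start m v) \<noteq> {} \<and>
     (\<forall>P E K t s. auction m v (Running P E K) t s \<longrightarrow> (\<exists>c. next_config m v (Running P E K) c)) \<and>
     \<not> (\<exists>f t s. auction m v (f 0) t s \<and> (\<forall>n. next_config m v (f n) (f (Suc n))))"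

section \<open>The auction code against the definitions of the market\<close>

lemma outcomes_simps [simp]:
  "outcomes (ret x) = {(x, 0, 0)}"
  "outcomes (tick n) = {((), n, 0)}"
  "outcomes (bind_prog p f) = {(y, t + t', max s s') | x t s y t' s'.
     (x, t, s) \<in> outcomes p \<and> (y, t', s') \<in> outcomes (f x)}"
  "outcomes (with_cells n p) = (\<lambda>(x, t, s). (x, t, s + n)) ` outcomes p"
  by (simp_all add: ret_def tick_def bind_prog_def with_cells_def)

lemma for_each_result:
  assumes "(y, t, s) \<in> outcomes (for_each xs f a)"
    and "\<And>x b y t s. x \<in> set xs \<Longrightarrow> (y, t, s) \<in> outcomes (f x b) \<Longrightarrow> y = g x b"
  shows "y = fold g xs a"
  using assms
proof (induction xs arbitrary: a y t s)
  case (Cons x xs)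
  from Cons.prems(1) obtain b t1 s1 t2 s2 where "(b, t1, s1) \<in> outcomes (f x a)"
    "(y, t2, s2) \<in> outcomes (for_each xs f b)" by auto
  then show ?case using Cons.IH Cons.prems(2) by (metis fold_simps(2) list.set_intros)
qed simp

lemma select_result: "(ys, t, s) \<in> outcomes (select Q xs) \<Longrightarrow> ys = filter Q xs"
proof (induction xs arbitrary: ys t s)
  case (Cons x xs)
  then show ?case by (fastforce split: if_splits)
qed simp

lemma fold_max_if:
  "fold (\<lambda>x b. if x \<in> X then b else max b (h x)) xs (a :: real) = Max (insert a (h ` (set xs - X)))"
proof (induction xs arbitrary: a)
  case (Cons x xs)
  show ?case
  proof (cases "x \<in> X")
    case False
    then have "h ` (set (x # xs) - X) = insert (h x) (h ` (set xs - X))" by auto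
    moreover have "Max (insert (max a (h x)) B) = Max (insert a (insert (h x) B))" if "finite B" for B
      using that by (cases "B = {}") (auto simp: max.assoc)
    ultimately show ?thesis using Cons[of "max a (h x)"] False by simp
  qed (use Cons in \<open>simp add: insert_Diff_if\<close>)
qed simp

lemma fold_insert_if: "fold (\<lambda>x N. if Q x then insert (h x) N else N) xs A = A \<union> h ` {x \<in> set xs. Q x}"
  by (induction xs arbitrary: A) auto

lemma initial_prices_result:
  assumes "(P, t, s) \<in> outcomes (initial_prices m v)" and "j < m"
  shows "P j = Max ((\<lambda>i. v i j) ` {..<m})"
proof -
  define p where "p = (\<lambda>j. Max (insert (v 0 j) ((\<lambda>i. v i j) ` {..<m})))"
  have "P = fold (\<lambda>j P. P(j := p j)) [0..<m] (\<lambda>_. 0)"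
    using assms(1) unfolding initial_prices_def
  proof (rule for_each_result)
    fix j P P' t s
    assume "(P', t, s) \<in> outcomes (do {
       p \<leftarrow> for_each [0..<m] (\<lambda>i p. do { tick 2; ret (max p (v i j)) }) (v 0 j);
       tick 1;
       ret (P(j := p)) })"
    then obtain x t s where "(x, t, s) \<in> outcomes (for_each [0..<m] (\<lambda>i p. do { tick 2; ret (max p (v i j)) }) (v 0 j))"
      and P': "P' = P(j := x)" by auto
    then have "x = fold (\<lambda>i p. max p (v i j)) [0..<m] (v 0 j)"
      by (rule_tac for_each_result) auto
    then show "P' = P(j := p j)"
      using P' fold_max_if[of "{}" "\<lambda>i. v i j" "[0..<m]" "v 0 j"] by (simp add: p_def atLeast0LessThan)
  qed
  moreover have "fold (\<lambda>j P. P(j := p j)) xs Q j = (if j \<in> set xs then p j else Q j)" for xs Q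
    by (induction xs arbitrary: Q) auto
  ultimately have "P j = p j" using assms(2) by simp
  moreover have "v 0 j \<in> (\<lambda>i. v i j) ` {..<m}" using assms(2) by auto
  ultimately show ?thesis by (simp add: p_def insert_absorb)
qed

lemma construct_graph_result:
  assumes "(E, t, s) \<in> outcomes (construct_graph m v P)"
  shows "E = preference_graph m v P"
proof -
  have "E = fold (\<lambda>i E. E \<union> (\<lambda>j. (j, i)) ` {j \<in> set [0..<m]. v i j - P j = best_utility m v P i}) [0..<m] {}"
    using assms unfolding construct_graph_def
  proof (rule for_each_result)
    fix i E E' t s
    assume "(E', t, s) \<in> outcomes (do {
        u \<leftarrow> for_each [0..<m] (\<lambda>j u. do { tick 3; ret (max u (v i j - P j)) }) 0;
        for_each [0..<m] (\<lambda>j E. do {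
          tick 3;
          ret (if v i j - P j = u then insert (j, i) E else E)
        }) E })"
    then obtain u t1 s1 t2 s2 where
      u: "(u, t1, s1) \<in> outcomes (for_each [0..<m] (\<lambda>j u. do { tick 3; ret (max u (v i j - P j)) }) 0)" and
      E': "(E', t2, s2) \<in> outcomes (for_each [0..<m] (\<lambda>j E. do {
          tick 3;
          ret (if v i j - P j = u then insert (j, i) E else E)
        }) E)" by auto
    have "u = fold (\<lambda>j u. max u (v i j - P j)) [0..<m] 0"
      using u by (rule for_each_result) auto
    then have "u = best_utility m v P i"
      using fold_max_if[of "{}" "\<lambda>j. v i j - P j" "[0..<m]" 0]
      by (simp add: best_utility_def atLeast0LessThan)
    moreover have "E' = fold (\<lambda>j E. if v i j - P j = u then insert (j, i) E else E) [0..<m] E"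
      using E' by (rule for_each_result) auto
    ultimately show "E' = E \<union> (\<lambda>j. (j, i)) ` {j \<in> set [0..<m]. v i j - P j = best_utility m v P i}"
      by (simp add: fold_insert_if)
  qed
  moreover have "fold (\<lambda>i E. E \<union> F i) xs A = A \<union> (\<Union>i\<in>set xs. F i)" for F :: "nat \<Rightarrow> graph" and xs A
    by (induction xs arbitrary: A) auto
  ultimately show ?thesis by (auto simp: preference_graph_def preferred_def)
qed

lemma find_neighbors_result:
  assumes "(N, t, s) \<in> outcomes (find_neighbors m E S)" and "E \<subseteq> {..<m} \<times> {..<m}"
  shows "N = neighbors E S"
proof -
  have "N = fold (\<lambda>i N. if \<exists>j\<in>set [0..<m]. j \<in> S \<and> (j, i) \<in> E then insert (id i) N else N) [0..<m] {}"
    using assms(1) unfolding find_neighbors_def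
  proof (rule for_each_result)
    fix i N N' t s
    assume "(N', t, s) \<in> outcomes (do {
       b \<leftarrow> for_each [0..<m] (\<lambda>j b. do { tick 4; ret (b \<or> (j \<in> S \<and> (j, i) \<in> E)) }) False;
       tick 2;
       ret (if b then insert i N else N) })"
    then obtain b t1 s1 where
      b: "(b, t1, s1) \<in> outcomes (for_each [0..<m] (\<lambda>j b. do { tick 4; ret (b \<or> (j \<in> S \<and> (j, i) \<in> E)) }) False)"
      and N': "N' = (if b then insert i N else N)" by auto
    have "b = fold (\<lambda>j b. b \<or> (j \<in> S \<and> (j, i) \<in> E)) [0..<m] False"
      using b by (rule for_each_result) auto
    moreover have "fold (\<lambda>j b. b \<or> Q j) xs a \<longleftrightarrow> a \<or> (\<exists>j\<in>set xs. Q j)" for Q :: "nat \<Rightarrow> bool" and xs a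
      by (induction xs arbitrary: a) auto
    ultimately have "b \<longleftrightarrow> (\<exists>j\<in>set [0..<m]. j \<in> S \<and> (j, i) \<in> E)" by simp
    then show "N' = (if \<exists>j\<in>set [0..<m]. j \<in> S \<and> (j, i) \<in> E then insert (id i) N else N)"
      unfolding N' by (simp only: id_apply)
  qed
  then have "N = {i. i < m \<and> (\<exists>j<m. j \<in> S \<and> (j, i) \<in> E)}" by (auto simp: fold_insert_if)
  moreover have "j < m \<and> i < m" if "(j, i) \<in> E" for j i using assms(2) that by auto
  ultimately show ?thesis unfolding neighbors_def by blast
qed

lemma fold_min_option:
  fixes h :: "'a \<Rightarrow> real"
  assumes fin: "finite B"
  defines "add \<equiv> \<lambda>x d. case d of None \<Rightarrow> Some (h x) | Some e \<Rightarrow> Some (min e (h x))"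
  shows "fold (\<lambda>x d. if x \<in> S then add x d else d) xs (if B = {} then None else Some (Min B)) =
    (let C = B \<union> h ` (set xs \<inter> S) in if C = {} then None else Some (Min C))"
  using fin
proof (induction xs arbitrary: B)
  case (Cons x xs)
  show ?case
  proof (cases "x \<in> S")
    case True
    have "add x (if B = {} then None else Some (Min B)) =
        (if insert (h x) B = {} then None else Some (Min (insert (h x) B)))"
      using Cons.prems by (simp add: add_def min.commute)
    then show ?thesis using Cons.IH[of "insert (h x) B"] Cons.prems True
      by (simp add: Int_insert_left)
  qed (use Cons in simp)
qed simp

lemma find_price_cut_result:
  assumes "(d, t, s) \<in> outcomes (find_price_cut m v P N S)" and "S \<subseteq> {..<m}"
  shows "d = (let C = {Max (insert 0 ((\<lambda>k. v i k - P k) ` ({..<m} - S))) - (v i l - P l) | i l.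
       i \<in> {..<m} - N \<and> l \<in> S} in if C = {} then None else Some (Min C))"
proof -
  define b where "b = (\<lambda>i. Max (insert 0 ((\<lambda>k. v i k - P k) ` ({..<m} - S))))"
  define g where "g = (\<lambda>i d. if i \<in> N then d else
    fold (\<lambda>l d. if l \<in> S then (case d of None \<Rightarrow> Some (b i - (v i l - P l))
                      | Some e \<Rightarrow> Some (min e (b i - (v i l - P l)))) else d) [0..<m] d)"
  have d: "d = fold g [0..<m] None"
    using assms(1) unfolding find_price_cut_def
  proof (rule for_each_result)
    fix i d d' t s
    assume *: "(d', t, s) \<in> outcomes (do {
       tick 1;
       if i \<in> N then ret d
       else do {
         b \<leftarrow> for_each [0..<m] (\<lambda>k b. do {
           tick 4;
           ret (if k \<in> S then b else max b (v i k - P k))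
         }) 0;
         for_each [0..<m] (\<lambda>l d. do {
           tick 6;
           ret (if l \<in> S
                then (case d of None \<Rightarrow> Some (b - (v i l - P l))
                      | Some e \<Rightarrow> Some (min e (b - (v i l - P l))))
                else d)
         }) d
       } })"
    show "d' = g i d"
    proof (cases "i \<in> N")
      case False
      with * obtain b' t1 s1 t2 s2 where
        b': "(b', t1, s1) \<in> outcomes (for_each [0..<m] (\<lambda>k b. do {
           tick 4; ret (if k \<in> S then b else max b (v i k - P k)) }) 0)" and
        d': "(d', t2, s2) \<in> outcomes (for_each [0..<m] (\<lambda>l d. do {
           tick 6;
           ret (if l \<in> S
                then (case d of None \<Rightarrow> Some (b' - (v i l - P l))
                      | Some e \<Rightarrow> Some (min e (b' - (v i l - P l))))
                else d)
         }) d)" by auto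
      have "b' = fold (\<lambda>k b. if k \<in> S then b else max b (v i k - P k)) [0..<m] 0"
        using b' by (rule for_each_result) auto
      then have "b' = b i" by (simp add: fold_max_if b_def atLeast0LessThan)
      with d' False show ?thesis unfolding g_def by (auto intro: for_each_result)
    qed (use * in \<open>simp add: g_def\<close>)
  qed
  have "fold g xs (if B = {} then None else Some (Min B)) =
      (let C = B \<union> {b i - (v i l - P l) | i l. i \<in> set xs - N \<and> l \<in> S} in if C = {} then None else Some (Min C))"
    if "finite B" for xs and B :: "real set"
    using that
  proof (induction xs arbitrary: B)
    case (Cons i xs)
    show ?case
    proof (cases "i \<in> N")
      case False
      let ?B = "B \<union> (\<lambda>l. b i - (v i l - P l)) ` S"
      have S: "set [0..<m] \<inter> S = S" "finite S" using assms(2) finite_subset by auto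
      have "g i (if B = {} then None else Some (Min B)) = (if ?B = {} then None else Some (Min ?B))"
        using False fold_min_option[OF Cons.prems, of S "\<lambda>l. b i - (v i l - P l)" "[0..<m]"] S(1)
        by (simp add: g_def Let_def)
      moreover have "B \<union> {b k - (v k l - P l) | k l. k \<in> set (i # xs) - N \<and> l \<in> S} =
          ?B \<union> {b k - (v k l - P l) | k l. k \<in> set xs - N \<and> l \<in> S}"
        using False by auto
      ultimately show ?thesis using Cons.IH[of ?B] Cons.prems S(2) by simp
    next
      case True
      then have "set (i # xs) - N = set xs - N" by auto
      then show ?thesis using Cons True by (simp add: g_def)
    qed
  qed simp
  from this[of "{}" "[0..<m]"] show ?thesis using d by (simp add: b_def atLeast0LessThan)
qed

lemma reduce_prices_result:
  assumes "(P', t, s) \<in> outcomes (reduce_prices m v P (neighbors E S) S)"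
    and "S \<subseteq> {..<m}" "S \<noteq> {}" "{..<m} - neighbors E S \<noteq> {}"
  shows "P' = (\<lambda>j. if j \<in> S then P j - price_cut m v P E S else P j)"
proof -
  from assms(1) obtain d t1 s1 t2 s2 where
    d: "(d, t1, s1) \<in> outcomes (find_price_cut m v P (neighbors E S) S)" and
    P': "(P', t2, s2) \<in> outcomes (case d of
       None \<Rightarrow> ret P
     | Some e \<Rightarrow> for_each [0..<m] (\<lambda>j P'. do { tick 4; ret (if j \<in> S then P'(j := P j - e) else P') }) P)"
    unfolding reduce_prices_def by auto
  have "d = Some (price_cut m v P E S)"
    using find_price_cut_result[OF d assms(2)] assms(3,4) unfolding price_cut_def Let_def by auto
  with P' have "(P', t2, s2) \<in> outcomes (for_each [0..<m] (\<lambda>j P'. do {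
      tick 4; ret (if j \<in> S then P'(j := P j - price_cut m v P E S) else P') }) P)" by simp
  then have "P' = fold (\<lambda>j P'. if j \<in> S then P'(j := P j - price_cut m v P E S) else P') [0..<m] P"
    by (rule for_each_result) auto
  moreover have "fold (\<lambda>j P'. if j \<in> S then P'(j := e j) else P') xs Q =
      (\<lambda>j. if j \<in> S \<inter> set xs then e j else Q j)" for e :: "nat \<Rightarrow> real" and xs Q
    by (induction xs arbitrary: Q) auto
  ultimately show ?thesis using assms(2) by (auto simp: fun_eq_iff)
qed

lemma constricted_maximally_skewed:
  assumes "maximally_skewed m E S" and "constricted m E T"
  shows "constricted m E S"
proof -
  have S: "S \<subseteq> {..<m}" "S \<noteq> {}" and T: "T \<subseteq> {..<m}" "card (neighbors E T) < card T"
    using assms by (auto simp: maximally_skewed_def is_arg_max_linorder constricted_def)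
  then have "T \<noteq> {}" by auto
  then have "skewness E T \<le> skewness E S"
    using assms(1) T(1) by (simp add: maximally_skewed_def is_arg_max_linorder)
  moreover have "1 < skewness E T"
  proof -
    have "real (card (neighbors E T)) + 1 \<le> real (card T)" using T(2) by linarith
    moreover have "1 / real (card T) > 0" using T(2) by simp
    ultimately show ?thesis unfolding skewness_def by linarith
  qed
  moreover have "1 / real (card S) \<le> 1" using S finite_subset[OF S(1)] by (simp add: Suc_leI card_gt_0_iff)
  ultimately have "card (neighbors E S) < card S" unfolding skewness_def by linarith
  then show ?thesis using S(1) by (simp add: constricted_def)
qed

text \<open>
  If the coloring offers the maximally skewed set whenever there is a constricted set, a round of the
  code is a round of the auction as defined through \<^const>\<open>maximally_skewed\<close> and \<^const>\<open>price_cut\<close>.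
\<close>

theorem auction_round_result:
  assumes "(c, t, s) \<in> outcomes (auction_round m v P E K)"
    and E: "E = preference_graph m v P" and S: "S = goods m K {Green, Blue}"
    and found: "\<exists>T. constricted m E T \<Longrightarrow> maximally_skewed m E S"
  shows "if \<exists>T. constricted m E T
    then \<exists>P' K' t' s'. c = Running P' (preference_graph m v P') K' \<and>
      P' = (\<lambda>j. if j \<in> S then P j - price_cut m v P E S else P j) \<and>
      (K', t', s') \<in> outcomes (procedure_U m (preference_graph m v P')
        (neighbors (preference_graph m v P') S - neighbors E S) (Some K))
    else c = Returned P"
proof -
  have sub: "preference_graph m v Q \<subseteq> {..<m} \<times> {..<m}" for Q
    by (auto simp: preference_graph_def preferred_def)
  have nb: "neighbors (preference_graph m v Q) S \<subseteq> {..<m}" for Q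
    using sub[of Q] by (auto simp: neighbors_def)
  obtain Sl N Nl t1 s1 t2 s2 t3 s3 t4 s4 where
    Sl: "(Sl, t1, s1) \<in> outcomes (select (\<lambda>j. good_color K j \<in> {Green, Blue}) [0..<m])" and
    N: "(N, t2, s2) \<in> outcomes (find_neighbors m E (set Sl))" and
    Nl: "(Nl, t3, s3) \<in> outcomes (select (\<lambda>i. i \<in> N) [0..<m])" and
    c: "(c, t4, s4) \<in> outcomes (if length Sl > length Nl then do {
       P' \<leftarrow> reduce_prices m v P N (set Sl);
       E' \<leftarrow> construct_graph m v P';
       N' \<leftarrow> find_neighbors m E' (set Sl);
       A \<leftarrow> select (\<lambda>i. i \<in> N' \<and> i \<notin> N) [0..<m];
       K' \<leftarrow> procedure_U m E' (set A) (Some K);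
       ret (Running P' E' K')
     }
     else ret (Returned P))"
    using assms(1) unfolding auction_round_def Let_def outcomes_simps by (auto simp del: select.simps)
  have Sl': "set Sl = S" "card S = length Sl"
    using select_result[OF Sl] unfolding S goods_def by (auto simp: distinct_card[symmetric] intro!: arg_cong[where f = card])
  have N': "N = neighbors E S" using find_neighbors_result[OF N] sub E Sl' by simp
  have Nl': "set Nl = N" "card N = length Nl"
  proof -
    show "set Nl = N" using select_result[OF Nl] nb[of P] N' E by auto
    then show "card N = length Nl" using select_result[OF Nl] distinct_card[of Nl] by simp
  qed
  have Sm: "S \<subseteq> {..<m}" unfolding S goods_def by auto
  have guard: "length Sl > length Nl \<longleftrightarrow> (\<exists>T. constricted m E T)"
    using Sl' Nl' N' Sm found constricted_maximally_skewed unfolding constricted_def by metis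
  show ?thesis
  proof (cases "\<exists>T. constricted m E T")
    case True
    with guard c obtain P' E' N2 A K' t5 s5 t6 s6 t7 s7 t8 s8 t9 s9 where
      P': "(P', t5, s5) \<in> outcomes (reduce_prices m v P N (set Sl))" and
      E': "(E', t6, s6) \<in> outcomes (construct_graph m v P')" and
      N2: "(N2, t7, s7) \<in> outcomes (find_neighbors m E' (set Sl))" and
      A: "(A, t8, s8) \<in> outcomes (select (\<lambda>i. i \<in> N2 \<and> i \<notin> N) [0..<m])" and
      K': "(K', t9, s9) \<in> outcomes (procedure_U m E' (set A) (Some K))" and
      c': "c = Running P' E' K'"
      by (auto simp del: select.simps)
    have E'': "E' = preference_graph m v P'" by (rule construct_graph_result[OF E'])
    have "N2 = neighbors E' S" using find_neighbors_result[OF N2] sub E'' Sl' by simp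
    then have "set A = neighbors E' S - neighbors E S"
      using select_result[OF A] nb[of P'] N' E'' by auto
    with K' E'' have K'': "(K', t9, s9) \<in> outcomes (procedure_U m (preference_graph m v P')
        (neighbors (preference_graph m v P') S - neighbors E S) (Some K))" by simp
    have lt: "card (neighbors E S) < card S" using True guard Sl' Nl' N' by simp
    then have "S \<noteq> {}" by auto
    moreover have "{..<m} - neighbors E S \<noteq> {}"
    proof
      assume "{..<m} - neighbors E S = {}"
      then have "card {..<m} \<le> card (neighbors E S)"
        using finite_subset[OF nb[of P]] E by (intro card_mono) auto
      with lt card_mono[OF _ Sm] show False by simp
    qed
    ultimately have "P' = (\<lambda>j. if j \<in> S then P j - price_cut m v P E S else P j)"
      using P' Sl'(1) N' Sm by (intro reduce_prices_result[of P' t5 s5]) auto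
    with True c' K'' E'' show ?thesis by auto
  next
    case False
    with guard c show ?thesis by simp
  qed
qed

end

(*
  The bound does not depend on whether the coloring really offers the maximally skewed set.  A price
  cut for a non-empty set S of goods with a buyer outside N(S) is positive and strictly enlarges N(S).
  So at most m rounds in a row turn no green or blue good red, and these cost O(m^2) each.

  Turning goods red requires a search from a blue buyer.  If one of these searches succeeds, a blue
  buyer loses its color for ever, which happens at most m times.  If all of them fail, the final
  retraction anchors the coloring: every green good is then reached from a blue good through green
  buyers.  Anchoring survives the rounds without a success, and in an anchored coloring the first
  search succeeds, because a br-path to the buyer is an rb-path back.  Hence at most 2 m + 1 rounds run
  such searches, at a cost of O(m^3) each, and they separate phases of at most m rounds of cost O(m^2).
*)

theory Submission
  imports Defs
begin

section \<open>Cost specifications\<close>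

text \<open>The accounting rests on two local invariants rather than on the intended meaning of the
  colors. \<open>coherent\<close>, kept in every round, says that a buyer with a red edge is not
  blue. A path found by an rb-search from a blue buyer then meets no other blue buyer, and
  recoloring its start restores the invariant. \<open>anchored\<close> is measured among non-red
  goods and green buyers, because the edge update leaves existing edges at non-red goods alone. The
  obstacle is that the input of a round does not show whether the round is cheap, so time and result
  have to be specified together. A success may destroy the anchoring; this is why a blue buyer has
  weight 2 in \<open>level\<close>, and it is where 2 m + 1 comes from. Cheapness itself needs an
  argument: a new blue buyer that is not served has a green neighbor, so the BFS from the green
  goods meets it. If that BFS meets no blue buyer and none was served, the first loop had no buyer
  to process.\<close>

definition spec :: "'a prog \<Rightarrow> nat \<Rightarrow> ('a \<Rightarrow> nat \<Rightarrow> bool) \<Rightarrow> bool" where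
  "spec p n Q \<longleftrightarrow> outcomes p \<noteq> {} \<and> (\<forall>x t s. (x, t, s) \<in> outcomes p \<longrightarrow> s \<le> n \<and> Q x t)"

text \<open>In \<open>spec\<close> the time bound may depend on the result; \<open>runs\<close> is
  the case of one bound for all results. Both demand an outcome: \<open>pick\<close> from an empty
  set has none, and a program without outcomes would meet every bound while the auction is
  stuck.\<close>

definition runs :: "'a prog \<Rightarrow> nat \<Rightarrow> nat \<Rightarrow> ('a \<Rightarrow> bool) \<Rightarrow> bool" where
  "runs p n T R \<longleftrightarrow> spec p n (\<lambda>x t. R x \<and> t \<le> T)"

lemma spec_mono:
  assumes "spec p n Q" and "n \<le> n'" and "\<And>x t. Q x t \<Longrightarrow> Q' x t"
  shows "spec p n' Q'"
  using assms unfolding spec_def by (meson le_trans)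

lemma runs_mono:
  assumes "runs p n T R" and "n \<le> n'" and "T \<le> T'" and "\<And>x. R x \<Longrightarrow> R' x"
  shows "runs p n' T' R'"
  using assms unfolding runs_def by (auto elim!: spec_mono)

text \<open>Joins a cost bound with a separately proved description of the result.\<close>

lemma runs_conj_result:
  assumes "runs p n T Q" and "\<And>x t s. (x, t, s) \<in> outcomes p \<Longrightarrow> R x"
  shows "runs p n T (\<lambda>x. Q x \<and> R x)"
  using assms unfolding runs_def spec_def by blast

lemma runs_conj:
  assumes "runs p n T Q" and "runs p n T' R"
  shows "runs p n T (\<lambda>x. Q x \<and> R x)"
  using assms unfolding runs_def spec_def by blast

section \<open>Proof rules for the program constructs\<close>

lemma spec_ret: "Q x 0 \<Longrightarrow> spec (ret x) n Q"
  by (simp add: spec_def)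

lemma runs_ret: "R x \<Longrightarrow> runs (ret x) n T R"
  by (simp add: runs_def spec_def)

text \<open>One memory bound serves both programs, since sequential composition takes the maximum of
  the cells while the times add up.\<close>

lemma spec_bind:
  assumes "spec p n (\<lambda>x t. spec (f x) n (\<lambda>y t'. Q y (t + t')))"
  shows "spec (bind_prog p f) n Q"
proof -
  from assms obtain x t s where "(x, t, s) \<in> outcomes p" "outcomes (f x) \<noteq> {}"
    unfolding spec_def by fastforce
  then have "outcomes (bind_prog p f) \<noteq> {}" by fastforce
  with assms show ?thesis unfolding spec_def by fastforce
qed

text \<open>\<open>runs\<close> bounds the first time only from above and \<open>Q\<close> need not
  be monotone in the time, so the continuation must satisfy \<open>Q\<close> for every time up to
  \<open>T\<close>.\<close>

lemma spec_bind_runs: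
  assumes "runs p n T R"
    and "\<And>x. R x \<Longrightarrow> spec (f x) n (\<lambda>y t. \<forall>t'\<le>T. Q y (t' + t))"
  shows "spec (bind_prog p f) n Q"
proof (rule spec_bind, rule spec_mono)
  show "spec p n (\<lambda>x t. R x \<and> t \<le> T)" using assms(1) by (simp add: runs_def)
  show "spec (f x) n (\<lambda>y t'. Q y (t + t'))" if "R x \<and> t \<le> T" for x t
    using assms(2)[of x] that by (auto elim: spec_mono)
qed simp

lemma runs_bind:
  assumes "runs p n T R" and "\<And>x. R x \<Longrightarrow> runs (f x) n T' Q" and "T + T' \<le> T''"
  shows "runs (bind_prog p f) n T'' Q"
  unfolding runs_def using assms(1)
proof (rule spec_bind_runs)
  show "spec (f x) n (\<lambda>y t. \<forall>t'\<le>T. Q y \<and> t' + t \<le> T'')" if "R x" for x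
    using assms(2)[OF that] assms(3) unfolding runs_def by (auto elim!: spec_mono)
qed

lemma spec_tick: "spec p n (\<lambda>y t. Q y (k + t)) \<Longrightarrow> spec (bind_prog (tick k) (\<lambda>_. p)) n Q"
  by (rule spec_bind) (simp add: spec_def[of "tick k"])

lemma runs_tick: "runs p n T R \<Longrightarrow> k + T \<le> T' \<Longrightarrow> runs (bind_prog (tick k) (\<lambda>_. p)) n T' R"
  unfolding runs_def by (intro spec_tick) (auto elim!: spec_mono)

lemma spec_pick:
  assumes "X \<noteq> {}" and "\<And>x. x \<in> X \<Longrightarrow> spec (f x) n (\<lambda>y t. Q y (1 + t))"
  shows "spec (bind_prog (pick X) f) n Q"
proof (rule spec_bind)
  show "spec (pick X) n (\<lambda>x t. spec (f x) n (\<lambda>y t'. Q y (t + t')))"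
    using assms unfolding spec_def[of "pick X"] by (auto simp: pick_def)
qed

lemma runs_pick:
  assumes "X \<noteq> {}" and "\<And>x. x \<in> X \<Longrightarrow> runs (f x) n T R" and "1 + T \<le> T'"
  shows "runs (bind_prog (pick X) f) n T' R"
  unfolding runs_def using assms(1)
proof (rule spec_pick)
  show "spec (f x) n (\<lambda>y t. R y \<and> 1 + t \<le> T')" if "x \<in> X" for x
    using assms(2)[OF that] assms(3) unfolding runs_def by (auto elim!: spec_mono)
qed

lemma spec_with_cells: "spec p n Q \<Longrightarrow> spec (with_cells k p) (n + k) Q"
  unfolding spec_def by fastforce

lemma runs_with_cells: "runs p n T R \<Longrightarrow> runs (with_cells k p) (n + k) T R"
  unfolding runs_def by (rule spec_with_cells)

text \<open>The invariant sees the prefix already processed, so that array updates can be described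
  pointwise by membership in it. The 1 is the loop overhead per element.\<close>

lemma runs_for_each:
  assumes "I [] a"
    and "\<And>ys x b. set (ys @ [x]) \<subseteq> set xs \<Longrightarrow> I ys b \<Longrightarrow> runs (f x b) n T (I (ys @ [x]))"
    and "length xs * (T + 1) \<le> T'"
  shows "runs (for_each xs f a) n T' (I xs)"
proof -
  have "runs (for_each zs f b) n (length zs * (T + 1)) (I (ys @ zs))"
    if "set (ys @ zs) \<subseteq> set xs" "I ys b" for ys zs b
    using that
  proof (induction zs arbitrary: ys b)
    case Nil
    then show ?case by (simp add: runs_ret)
  next
    case (Cons z zs)
    have "runs (f z b) n T (I (ys @ [z]))"
      using Cons.prems by (intro assms(2)) auto
    then have "runs (do { s' \<leftarrow> f z b; for_each zs f s' }) n (T + length zs * (T + 1)) (I (ys @ z # zs))"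
    proof (rule runs_bind)
      show "runs (for_each zs f b') n (length zs * (T + 1)) (I (ys @ z # zs))" if "I (ys @ [z]) b'" for b'
        using Cons.IH[of "ys @ [z]" b'] Cons.prems(1) that by simp
    qed simp
    then show ?case by (auto intro!: runs_tick)
  qed
  from this[of "[]" xs a] assms(1,3) show ?thesis by (auto elim!: runs_mono)
qed

lemma runs_for_each_time:
  assumes "\<And>x b. x \<in> set xs \<Longrightarrow> runs (f x b) n T (\<lambda>_. True)" and "length xs * (T + 1) \<le> T'"
  shows "runs (for_each xs f a) n T' (\<lambda>_. True)"
  by (rule runs_for_each[of "\<lambda>_ _. True"]) (use assms in auto)

lemma runs_select: "8 * length xs \<le> T \<Longrightarrow> runs (select P xs) n T (\<lambda>ys. ys = filter P xs)"
proof (induction xs arbitrary: T)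
  case (Cons x xs)
  have "runs (select P xs) n (8 * length xs) (\<lambda>ys. ys = filter P xs)" by (rule Cons.IH) simp
  then have "runs (do { ys \<leftarrow> select P xs; ret (if P x then x # ys else ys) }) n (8 * length xs)
      (\<lambda>ys. ys = filter P (x # xs))"
    by (rule runs_bind[where T' = 0]) (auto intro!: runs_ret)
  then show ?case using Cons.prems by (auto intro!: runs_tick)
qed (simp add: runs_ret)

text \<open>The order of the picks is arbitrary, so the invariant is indexed by the set of elements
  still to be picked.\<close>

lemma runs_pick_each:
  assumes "finite X" "I X a"
    and "\<And>Y x b. Y \<subseteq> X \<Longrightarrow> x \<in> Y \<Longrightarrow> I Y b \<Longrightarrow> runs (f x b) n T (I (Y - {x}))"
    and "card X * (T + 1) \<le> T'"
  shows "runs (pick_each X f a) n T' (I {})"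
  using assms
proof (induction "card X" arbitrary: X a T')
  case 0
  then show ?case by (simp add: pick_each.simps runs_ret)
next
  case (Suc k)
  have "X \<noteq> {}" using Suc.hyps(2) by auto
  have IH: "runs (pick_each (X - {x}) f b) n (k * (T + 1)) (I {})" if "x \<in> X" "I (X - {x}) b" for x b
  proof (rule Suc.hyps(1))
    show k: "k = card (X - {x})" using Suc.hyps(2) Suc.prems(1) that by simp
    show "card (X - {x}) * (T + 1) \<le> k * (T + 1)" using k by simp
    show "runs (f y b) n T (I (Y - {y}))" if "Y \<subseteq> X - {x}" "y \<in> Y" "I Y b" for Y y b
      using that by (intro Suc.prems(3)) auto
  qed (use Suc.prems that in auto)
  have "runs (do { x \<leftarrow> pick X; s' \<leftarrow> f x a; pick_each (X - {x}) f s' }) n T' (I {})"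
    using \<open>X \<noteq> {}\<close>
  proof (rule runs_pick)
    show "runs (do { s' \<leftarrow> f x a; pick_each (X - {x}) f s' }) n (T + k * (T + 1)) (I {})" if "x \<in> X" for x
      using Suc.prems that by (auto intro!: runs_bind IH)
    show "1 + (T + k * (T + 1)) \<le> T'" using Suc.prems(4) Suc.hyps(2)[symmetric] by simp
  qed
  then show ?case using \<open>X \<noteq> {}\<close> Suc.prems(1) by (subst pick_each.simps) simp
qed

section \<open>Searches\<close>

lemma card_vertices: "card (set (vertices m)) \<le> 2 * m" "length (vertices m) = 2 * m"
  using card_length[of "vertices m"] by (simp_all add: vertices_def)

lemma in_vertices [simp]: "Good j \<in> set (vertices m) \<longleftrightarrow> j < m" "Buyer i \<in> set (vertices m) \<longleftrightarrow> i < m"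
  by (auto simp: vertices_def)

lemma opposite_in_vertices [simp]: "opposite u c \<in> set (vertices m) \<longleftrightarrow> c < m"
  by (cases u) auto

section \<open>Amortized running time of a search\<close>

text \<open>The cost still to come: an unseen index costs 13 (the pick and 12 operations), closing a
  frontier entry costs 2, and each unvisited vertex holds a reserve for one full scan.\<close>

definition search_time :: "nat \<Rightarrow> (vertex \<times> nat set) list \<Rightarrow> vertex set \<Rightarrow> nat" where
  "search_time m fr visited =
     (13 * m + 2) * card (set (vertices m) - visited) + (\<Sum>(u, D)\<leftarrow>fr. 13 * card ({..<m} - D) + 2)"

lemma search_time_skip:
  assumes "c < m" "c \<notin> D"
  shows "13 + search_time m ((u, insert c D) # rest) visited \<le> search_time m ((u, D) # rest) visited"
proof -
  have "card ({..<m} - insert c D) < card ({..<m} - D)"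
    using assms by (intro psubset_card_mono) auto
  then show ?thesis by (simp add: search_time_def)
qed

lemma card_vertices_visit:
  assumes "w \<in> set (vertices m)" "w \<notin> visited"
  shows "card (set (vertices m) - insert w visited) < card (set (vertices m) - visited)"
  using assms by (intro psubset_card_mono) auto

text \<open>The reserve of the new vertex pays exactly for its own frontier entry; the 13 units of
  the step come from the index that was looked at.\<close>

lemma search_time_new:
  assumes "c < m" "c \<notin> D" "w \<in> set (vertices m)" "w \<notin> visited"
    and "fr = (u, insert c D) # rest @ [(w, {})] \<or> fr = (w, {}) # (u, insert c D) # rest"
  shows "13 + search_time m fr (insert w visited) \<le> search_time m ((u, D) # rest) visited"
proof -
  have "card ({..<m} - insert c D) < card ({..<m} - D)"
    using assms by (intro psubset_card_mono) auto
  moreover from card_vertices_visit[OF assms(3,4)] have "(13 * m + 2) * card (set (vertices m) - insert w visited) + (13 * m + 2)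
      \<le> (13 * m + 2) * card (set (vertices m) - visited)"
    using mult_le_mono2[OF Suc_leI, of _ "card (set (vertices m) - visited)" "13 * m + 2"] by fastforce
  ultimately show ?thesis using assms(5) by (auto simp: search_time_def)
qed

text \<open>Admitting every frontier with the right set of entries covers the queue of a BFS and the
  stack of a DFS at once.\<close>

definition search_invariant ::
  "nat \<Rightarrow> (vertex \<Rightarrow> vertex \<Rightarrow> bool) \<Rightarrow> ((vertex \<times> nat set) list \<Rightarrow> vertex set \<Rightarrow> search_trail \<Rightarrow> bool) \<Rightarrow> bool" where
  "search_invariant m arc I \<longleftrightarrow> (\<forall>u D rest visited trail. I ((u, D) # rest) visited trail \<longrightarrow>
     ({..<m} \<subseteq> D \<longrightarrow> I rest visited trail) \<and>
     (\<forall>c<m. let w = opposite u c in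
        if arc u w \<and> w \<notin> visited
        then \<forall>fr. set fr = insert (w, {}) (insert (u, insert c D) (set rest)) \<longrightarrow>
          I fr (insert w visited) ((w, u) # trail)
        else I ((u, insert c D) # rest) visited trail))"

lemma runs_search_loop:
  assumes "search_invariant m arc I" and "I fr visited trail"
  shows "runs (search_loop ord m arc target fr visited trail) n (search_time m fr visited)
    (\<lambda>(visited', trail', end). \<exists>fr'. I fr' visited' trail' \<and>
      (case end of None \<Rightarrow> fr' = [] | Some w \<Rightarrow> w \<in> target))"
  using assms
proof (induction ord m arc target fr visited trail rule: search_loop.induct)
  case (1 ord m arc target visited trail)
  then show ?case by (auto intro!: runs_ret)
next
  case (2 ord m arc target u D rest visited trail)
  note inv = "2.prems"(1)[unfolded search_invariant_def, rule_format, OF "2.prems"(2)]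
  let ?R = "\<lambda>(visited', trail', end). \<exists>fr'. I fr' visited' trail' \<and>
      (case end of None \<Rightarrow> fr' = [] | Some w \<Rightarrow> w \<in> target)"
  show ?case
  proof (cases "{..<m} \<subseteq> D")
    case True
    have "runs (search_loop ord m arc target rest visited trail) n (search_time m rest visited) ?R"
      by (rule "2.IH"(1)[OF True, of "()" 2 0]) (use True inv "2.prems"(1) in auto)
    then have "runs (do { tick 2; search_loop ord m arc target rest visited trail }) n
        (search_time m ((u, D) # rest) visited) ?R"
      by (rule runs_tick) (simp add: search_time_def)
    with True show ?thesis by simp
  next
    case False
    \<comment> \<open>The natural subtraction is exact: some index is still unseen and carries 13
      units.\<close>
    let ?T = "search_time m ((u, D) # rest) visited - 13"
    have big: "13 \<le> search_time m ((u, D) # rest) visited"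
      using False search_time_skip[of _ m D] by (meson add_leD1 lessThan_iff subsetI)
    have "runs (do {
        tick 12;
        let w = opposite u c;
        if arc u w \<and> w \<notin> visited
        then if w \<in> target
          then ret (insert w visited, (w, u) # trail, Some w)
          else search_loop ord m arc target
            (case ord of
               BFS \<Rightarrow> (u, insert c D) # rest @ [(w, {})]
             | DFS \<Rightarrow> (w, {}) # (u, insert c D) # rest)
            (insert w visited) ((w, u) # trail)
        else search_loop ord m arc target ((u, insert c D) # rest) visited trail
      }) n (12 + ?T) ?R" if "c \<in> {..<m} - D" for c
    proof -
      from that have c: "c < m" "c \<notin> D" by auto
      have pick: "(c, 1, 0) \<in> outcomes (pick ({..<m} - D))" using that by (simp add: pick_def)
      let ?w = "opposite u c"
      let ?fr = "case ord of BFS \<Rightarrow> (u, insert c D) # rest @ [(?w, {})]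
             | DFS \<Rightarrow> (?w, {}) # (u, insert c D) # rest"
      have fr: "set ?fr = insert (?w, {}) (insert (u, insert c D) (set rest))"
        "?fr = (u, insert c D) # rest @ [(?w, {})] \<or> ?fr = (?w, {}) # (u, insert c D) # rest"
        by (cases ord; auto)+
      have inv': "if arc u ?w \<and> ?w \<notin> visited then I ?fr (insert ?w visited) ((?w, u) # trail)
          else I ((u, insert c D) # rest) visited trail"
        using inv c(1) fr(1) unfolding Let_def by (metis (no_types, lifting))
      consider "\<not> (arc u ?w \<and> ?w \<notin> visited)" | "arc u ?w" "?w \<notin> visited" "?w \<in> target"
        | "arc u ?w" "?w \<notin> visited" "?w \<notin> target" by blast
      then show ?thesis
      proof cases
        case 1
        have "runs (search_loop ord m arc target ((u, insert c D) # rest) visited trail) n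
            (search_time m ((u, insert c D) # rest) visited) ?R"
          by (rule "2.IH"(3)[OF False pick _ refl 1 "2.prems"(1), of "()" 12 0]) (use inv' 1 in auto)
        moreover have "search_time m ((u, insert c D) # rest) visited \<le> ?T"
          using search_time_skip[OF c, of u rest visited] by simp
        ultimately show ?thesis using 1 by (auto intro!: runs_tick elim!: runs_mono)
      next
        case 2
        with inv' show ?thesis by (auto simp: Let_def intro!: runs_tick[OF _ order_refl] runs_ret)
      next
        case 3
        have "runs (search_loop ord m arc target ?fr (insert ?w visited) ((?w, u) # trail)) n
            (search_time m ?fr (insert ?w visited)) ?R"
          by (rule "2.IH"(2)[OF False pick _ refl _ _ "2.prems"(1), of "()" 12 0]) (use inv' 3 in auto)
        moreover have "search_time m ?fr (insert ?w visited) \<le> ?T"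
          using search_time_new[OF c _ 3(2) fr(2)] c by simp
        ultimately show ?thesis using 3 by (auto simp: Let_def intro!: runs_tick elim!: runs_mono)
      qed
    qed
    then show ?thesis using False big
      by (subst search_loop.simps(2), subst if_not_P) (auto intro!: runs_pick[where T = "12 + ?T"] simp del: One_nat_def)
  qed
qed

section \<open>Reachability and the results of a search\<close>

text \<open>Both ends of an arc must have an index below \<open>m\<close>, because a search looks
  only at such indices whereas edge colors are total functions.\<close>

definition reach :: "nat \<Rightarrow> (vertex \<Rightarrow> vertex \<Rightarrow> bool) \<Rightarrow> vertex \<Rightarrow> vertex \<Rightarrow> bool" where
  "reach m arc = (\<lambda>u w. arc u w \<and> u \<in> set (vertices m) \<and> w \<in> set (vertices m))\<^sup>*\<^sup>*"

lemma reach_refl: "reach m arc u u"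
  by (simp add: reach_def)

lemma reach_step:
  "reach m arc u w \<Longrightarrow> arc w x \<Longrightarrow> w \<in> set (vertices m) \<Longrightarrow> x \<in> set (vertices m) \<Longrightarrow> reach m arc u x"
  unfolding reach_def by (rule rtranclp.rtrancl_into_rtrancl) auto

lemma reach_trans: "reach m arc u w \<Longrightarrow> reach m arc w x \<Longrightarrow> reach m arc u x"
  unfolding reach_def by (rule rtranclp_trans)

lemma reach_in_vertices: "reach m arc u w \<Longrightarrow> u \<in> set (vertices m) \<Longrightarrow> w \<in> set (vertices m)"
  unfolding reach_def by (induction rule: rtranclp_induct) auto

lemma reach_mono:
  assumes "reach m arc u w" and "\<And>u w. u \<in> set (vertices m) \<Longrightarrow> w \<in> set (vertices m) \<Longrightarrow> arc u w \<Longrightarrow> arc' u w"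
  shows "reach m arc' u w"
  using assms(1) unfolding reach_def by (rule rtranclp_mono[THEN predicate2D, rotated]) (use assms(2) in auto)

lemma reach_reverse:
  assumes "reach m arc u w" and "\<And>u w. arc u w \<Longrightarrow> arc' w u"
  shows "reach m arc' w u"
  using assms(1) unfolding reach_def
proof (induction rule: rtranclp_induct)
  case (step y z)
  then have "arc' z y \<and> z \<in> set (vertices m) \<and> y \<in> set (vertices m)" using assms(2) by blast
  then show ?case using step.IH by (rule converse_rtranclp_into_rtranclp)
qed simp

lemma reach_induct [consumes 1, case_names refl step]:
  assumes "reach m arc u w" and "P u"
    and "\<And>x y. reach m arc u x \<Longrightarrow> P x \<Longrightarrow> arc x y \<Longrightarrow> x \<in> set (vertices m) \<Longrightarrow> y \<in> set (vertices m) \<Longrightarrow> P y"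
  shows "P w"
  using assms(1) unfolding reach_def
  by (induction rule: rtranclp_induct) (use assms(2,3) in \<open>auto simp: reach_def\<close>)

definition reached :: "nat \<Rightarrow> (vertex \<Rightarrow> vertex \<Rightarrow> bool) \<Rightarrow> vertex set \<Rightarrow> vertex set" where
  "reached m arc S = {w. \<exists>u\<in>S. reach m arc u w}"

text \<open>A scan tests only the vertices \<open>opposite u c\<close>; for such arc relations it
  misses nothing.\<close>

definition bipartite :: "(vertex \<Rightarrow> vertex \<Rightarrow> bool) \<Rightarrow> bool" where
  "bipartite arc \<longleftrightarrow> (\<forall>u w. arc u w \<longrightarrow> (\<exists>c. w = opposite u c))"

lemma bipartite_arcs: "bipartite (rb K)" "bipartite (br K)" "bipartite (in_subgraph X Y F arc)"
proof -
  show "bipartite (rb K)" unfolding bipartite_def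
    by (intro allI impI) (case_tac "(K, u, w)" rule: rb.cases; auto)
  show "bipartite (br K)" unfolding bipartite_def
    by (intro allI impI) (case_tac "(K, u, w)" rule: br.cases; auto)
  show "bipartite (in_subgraph X Y F arc)" unfolding bipartite_def
    by (intro allI impI) (case_tac "(X, Y, F, arc, u, w)" rule: in_subgraph.cases; auto)
qed

abbreviation search_cells :: "nat \<Rightarrow> nat" where
  "search_cells m \<equiv> 2 * m * m + 10 * m + 10"

text \<open>Soundness holds even for a search stopped at a target; exactness of the reached set
  holds once the frontier is exhausted and nothing was visited in advance. The clause that the
  source of a trail pair is a start or is itself entered by an arc later excludes blue buyers inside
  an augmenting path.\<close>

lemma runs_search:
  assumes starts: "set starts \<subseteq> set (vertices m)" "length starts \<le> m"
  shows "runs (search ord m arc target visited starts) (2 * m * m + 10 * m + 10) (40 * (m + 1)^2)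
    (\<lambda>(R, trail, end).
      length trail \<le> 2 * m \<and>
      (\<forall>(w, u)\<in>set trail. arc u w \<and> (u \<in> set starts \<or> (\<exists>p. arc p u))) \<and>
      R \<subseteq> visited \<union> reached m arc (set starts) \<and>
      (bipartite arc \<and> visited = {} \<and> end = None \<longrightarrow> R = reached m arc (set starts)) \<and>
      (\<forall>w. end = Some w \<longrightarrow> w \<in> target))"
proof -
  define B where "B = (\<lambda>u. u \<in> set starts \<or> (\<exists>p. arc p u))"
  define sound where "sound = (\<lambda>w. w \<in> reached m arc (set starts))"
  define closed where "closed = (\<lambda>vis u D. \<forall>c\<in>D. c < m \<longrightarrow> arc u (opposite u c) \<longrightarrow> opposite u c \<in> (vis :: vertex set))"
  \<comment> \<open>A new vertex lengthens the trail by one and leaves the unvisited set, which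
    bounds the trail by \<open>2 * m\<close>. By the last conjunct a visited vertex outside the
    initial \<open>visited\<close> is fully scanned, or is on the frontier with \<open>D\<close> as
    its scanned part.\<close>
  define I where "I = (\<lambda>(fr :: (vertex \<times> nat set) list) vis trail.
    length trail + card (set (vertices m) - vis) \<le> 2 * m \<and>
    (\<forall>(u, D)\<in>set fr. B u \<and> sound u) \<and> (\<forall>(w, u)\<in>set trail. arc u w \<and> B u) \<and>
    set starts \<subseteq> vis \<and> (\<forall>w\<in>vis. w \<in> visited \<or> sound w) \<and>
    (\<forall>u\<in>vis. u \<in> visited \<or> closed vis u {..<m} \<or> (\<exists>D. (u, D) \<in> set fr \<and> closed vis u D)))"
  have mono: "closed vis u D \<Longrightarrow> vis \<subseteq> vis' \<Longrightarrow> closed vis' u D" for vis vis' u D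
    unfolding closed_def by blast
  have sound_V: "sound u \<Longrightarrow> u \<in> set (vertices m)" for u
    using starts(1) reach_in_vertices unfolding sound_def reached_def by blast
  have "search_invariant m arc I"
    unfolding search_invariant_def Let_def
  proof (intro allI impI conjI)
    fix u D rest vis trail
    assume *: "I ((u, D) # rest) vis trail"
    {
      assume "{..<m} \<subseteq> D"
      then have "closed vis u D \<Longrightarrow> closed vis u {..<m}" unfolding closed_def by blast
      with * show "I rest vis trail" unfolding I_def by (auto; blast)
    }
    fix c
    assume c: "c < m"
    let ?w = "opposite u c"
    show "if arc u ?w \<and> ?w \<notin> vis
      then \<forall>fr. set fr = insert (?w, {}) (insert (u, insert c D) (set rest)) \<longrightarrow>
        I fr (insert ?w vis) ((?w, u) # trail)
      else I ((u, insert c D) # rest) vis trail"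
    proof (cases "arc u ?w \<and> ?w \<notin> vis")
      case True
      have "card (set (vertices m) - insert ?w vis) < card (set (vertices m) - vis)"
        using True c by (intro card_vertices_visit) simp_all
      moreover have "sound u" using * unfolding I_def by simp
      then have "sound ?w"
        using True c sound_V[of u] reach_step[of m arc _ u ?w] unfolding sound_def reached_def by auto
      moreover have "\<forall>x\<in>insert ?w vis. x \<in> visited \<or> closed (insert ?w vis) x {..<m} \<or>
          (\<exists>D. (x, D) \<in> set fr \<and> closed (insert ?w vis) x D)"
        if fr: "set fr = insert (?w, {}) (insert (u, insert c D) (set rest))" for fr
      proof
        fix x assume "x \<in> insert ?w vis"
        then consider "x = ?w" | "x \<in> vis" by blast
        then show "x \<in> visited \<or> closed (insert ?w vis) x {..<m} \<or>
          (\<exists>D. (x, D) \<in> set fr \<and> closed (insert ?w vis) x D)"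
        proof cases
          case 1
          then show ?thesis using fr unfolding closed_def by auto
        next
          case 2
          then consider "x \<in> visited" | "closed vis x {..<m}" | "x = u" "closed vis u D"
            | D' where "(x, D') \<in> set rest" "closed vis x D'" using * unfolding I_def by auto
          then show ?thesis
          proof cases
            case 3
            then have "closed (insert ?w vis) u (insert c D)" unfolding closed_def by blast
            then show ?thesis using fr 3 by blast
          next
            case 4
            then show ?thesis using fr mono[OF 4(2), of "insert ?w vis"] by blast
          qed (use mono[of vis x] in blast)+
        qed
      qed
      moreover have "B ?w" using True unfolding B_def by blast
      ultimately have "I fr (insert ?w vis) ((?w, u) # trail)"
        if "set fr = insert (?w, {}) (insert (u, insert c D) (set rest))" for fr
        using * True that unfolding I_def by auto
      then show ?thesis using True by simp
    next
      case False
      then have "closed vis u D \<Longrightarrow> closed vis u (insert c D)" unfolding closed_def by blast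
      then have "I ((u, insert c D) # rest) vis trail" using * unfolding I_def by (auto; metis)
      then show ?thesis using False by (simp only: if_False)
    qed
  qed
  moreover have "I (map (\<lambda>u. (u, {})) starts) (visited \<union> set starts) []"
  proof -
    have "card (set (vertices m) - (visited \<union> set starts)) \<le> 2 * m"
      using card_mono[of "set (vertices m)"] card_vertices(1)[of m] by (meson Diff_subset List.finite_set le_trans)
    then show ?thesis unfolding I_def B_def sound_def reached_def closed_def by (auto intro: reach_refl)
  qed
  ultimately have *: "runs (search_loop ord m arc target (map (\<lambda>u. (u, {})) starts) (visited \<union> set starts) []) 0
      (search_time m (map (\<lambda>u. (u, {})) starts) (visited \<union> set starts))
      (\<lambda>(visited', trail', end). \<exists>fr'. I fr' visited' trail' \<and>
      (case end of None \<Rightarrow> fr' = [] | Some w \<Rightarrow> w \<in> target))"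
    by (rule runs_search_loop)
  \<comment> \<open>At most \<open>2 * m\<close> reserves and \<open>m\<close> frontier entries,
    each worth \<open>13 * m + 2\<close>.\<close>
  have "search_time m (map (\<lambda>u. (u, {})) starts) (visited \<union> set starts) \<le> 39 * m * m + 6 * m"
  proof -
    have "card (set (vertices m) - (visited \<union> set starts)) \<le> 2 * m"
      using card_mono[of "set (vertices m)"] card_vertices(1)[of m] by (meson Diff_subset List.finite_set le_trans)
    then have "(13 * m + 2) * card (set (vertices m) - (visited \<union> set starts)) \<le> (13 * m + 2) * (2 * m)"
      by (rule mult_le_mono2)
    moreover have "(\<Sum>(u, D)\<leftarrow>map (\<lambda>u. (u, {})) starts. 13 * card ({..<m} - D) + 2) = length starts * (13 * m + 2)"
      by (induction starts) auto
    moreover have "length starts * (13 * m + 2) \<le> m * (13 * m + 2)" using starts(2) by (rule mult_le_mono1)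
    ultimately show ?thesis unfolding search_time_def by (simp add: algebra_simps)
  qed
  then have "runs (do {
     tick (2 * m + length starts);
     search_loop ord m arc target (map (\<lambda>u. (u, {})) starts) (visited \<union> set starts) []
   }) 0 (40 * (m + 1)^2) (\<lambda>(visited', trail', end). \<exists>fr'. I fr' visited' trail' \<and>
      (case end of None \<Rightarrow> fr' = [] | Some w \<Rightarrow> w \<in> target))"
    using starts(2) by (intro runs_tick[OF *]) (simp add: power2_eq_square)
  from runs_with_cells[OF this, of "2 * m * m + 10 * m + 10"]
  have "runs (search ord m arc target visited starts) (2 * m * m + 10 * m + 10) (40 * (m + 1)^2)
      (\<lambda>(visited', trail', end). \<exists>fr'. I fr' visited' trail' \<and>
      (case end of None \<Rightarrow> fr' = [] | Some w \<Rightarrow> w \<in> target))" unfolding search_def by simp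
  then show ?thesis
  proof (rule runs_mono)
    fix x
    assume "case x of (visited', trail', end) \<Rightarrow> \<exists>fr'. I fr' visited' trail' \<and>
      (case end of None \<Rightarrow> fr' = [] | Some w \<Rightarrow> w \<in> target)"
    then obtain R trail "end" fr where x: "x = (R, trail, end)" and I: "I fr R trail"
      and e: "case end of None \<Rightarrow> fr = [] | Some w \<Rightarrow> w \<in> target" by auto
    \<comment> \<open>With an empty frontier all visited vertices are fully scanned, so
      \<open>R\<close> is closed under arcs and absorbs every path from a start.\<close>
    have "reached m arc (set starts) \<subseteq> R" if "bipartite arc" "visited = {}" "end = None"
    proof
      fix w assume "w \<in> reached m arc (set starts)"
      then obtain u where "u \<in> set starts" "reach m arc u w" unfolding reached_def by blast
      from this(2) show "w \<in> R"
      proof (induction rule: reach_induct)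
        case refl
        then show ?case using I \<open>u \<in> set starts\<close> unfolding I_def by auto
      next
        case (step x y)
        obtain c where c: "y = opposite x c" using \<open>bipartite arc\<close> step.hyps(2) unfolding bipartite_def by blast
        have "closed R x {..<m}" using I e that step.IH unfolding I_def by auto
        then show ?case using c step unfolding closed_def by auto
      qed
    qed
    moreover have "R \<subseteq> visited \<union> reached m arc (set starts)"
      using I unfolding I_def sound_def by blast
    ultimately show "case x of (R, trail, end) \<Rightarrow> length trail \<le> 2 * m \<and>
      (\<forall>(w, u)\<in>set trail. arc u w \<and> (u \<in> set starts \<or> (\<exists>p. arc p u))) \<and>
      R \<subseteq> visited \<union> reached m arc (set starts) \<and>
      (bipartite arc \<and> visited = {} \<and> end = None \<longrightarrow> R = reached m arc (set starts)) \<and>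
      (\<forall>w. end = Some w \<longrightarrow> w \<in> target)"
      using I e unfolding x I_def B_def by auto
  qed simp_all
qed

text \<open>The same facts in continuation form, with the three components of the result split and
  each fact as a separate premise.\<close>

lemma runs_bind_search:
  assumes "set starts \<subseteq> set (vertices m)" "length starts \<le> m"
    and "\<And>R trail end. length trail \<le> 2 * m \<Longrightarrow>
      \<forall>(w, u)\<in>set trail. arc u w \<and> (u \<in> set starts \<or> (\<exists>p. arc p u)) \<Longrightarrow>
      R \<subseteq> visited \<union> reached m arc (set starts) \<Longrightarrow>
      (bipartite arc \<Longrightarrow> visited = {} \<Longrightarrow> end = None \<Longrightarrow> R = reached m arc (set starts)) \<Longrightarrow>
      (\<And>w. end = Some w \<Longrightarrow> w \<in> target) \<Longrightarrow>
      runs (f R trail end) (search_cells m) T Q"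
    and "40 * (m + 1)^2 + T \<le> T'"
  shows "runs (bind_prog (search ord m arc target visited starts) (\<lambda>(R, trail, end). f R trail end))
    (search_cells m) T' Q"
proof (rule runs_bind[OF runs_search[OF assms(1,2)] _ assms(4)])
  fix x
  assume *: "case x of (R, trail, end) \<Rightarrow> length trail \<le> 2 * m \<and>
      (\<forall>(w, u)\<in>set trail. arc u w \<and> (u \<in> set starts \<or> (\<exists>p. arc p u))) \<and>
      R \<subseteq> visited \<union> reached m arc (set starts) \<and>
      (bipartite arc \<and> visited = {} \<and> end = None \<longrightarrow> R = reached m arc (set starts)) \<and>
      (\<forall>w. end = Some w \<longrightarrow> w \<in> target)"
  obtain R trail "end" where x: "x = (R, trail, end)" by (cases x)
  have "runs (f R trail end) (search_cells m) T Q"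
    by (rule assms(3)) (use *[unfolded x prod.case] in blast)+
  then show "runs (case x of (R, trail, end) \<Rightarrow> f R trail end) (search_cells m) T Q" by (simp add: x)
qed

section \<open>Switching a path and painting vertices\<close>

text \<open>A switched edge joins consecutive vertices of the path, so its buyer is the end
  \<open>w\<close> or the source of a trail pair. For coherence it matters which buyer a switched
  edge has. \<open>switch\<close> produces green only from green, so no edge turns green.\<close>

lemma runs_switch_path:
  "runs (switch_path trail w K) n (4 * length trail) (\<lambda>K'.
    good_color K' = good_color K \<and> buyer_color K' = buyer_color K \<and>
    (\<forall>j i. edge_color K' j i = edge_color K j i \<or>
      edge_color K' j i \<noteq> Some Green \<and> Buyer i \<in> insert w (snd ` set trail)))"
proof (induction trail arbitrary: w K)
  case (Cons e trail)
  let ?post = "\<lambda>w trail K K'. good_color K' = good_color K \<and> buyer_color K' = buyer_color K \<and>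
    (\<forall>j i. edge_color K' j i = edge_color K j i \<or>
      edge_color K' j i \<noteq> Some Green \<and> Buyer i \<in> insert w (snd ` set trail))"
  have switch: "switch c = Green \<longleftrightarrow> c = Green" for c
    by (cases c) simp_all
  have colors: "good_color (switch_edge u w K) = good_color K \<and> buyer_color (switch_edge u w K) = buyer_color K \<and>
    (\<forall>j i. edge_color (switch_edge u w K) j i = edge_color K j i \<or>
      edge_color (switch_edge u w K) j i \<noteq> Some Green \<and> (Buyer i = u \<or> Buyer i = w))" for u
    by (cases u; cases w) (auto simp: set_edge_def switch)
  show ?case
  proof (cases "fst e = w")
    case True
    have "runs (switch_path trail (snd e) (switch_edge (snd e) w K)) n (4 * length trail) (?post w (e # trail) K)"
      using Cons.IH[of "snd e" "switch_edge (snd e) w K"]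
    proof (rule runs_mono)
      show "?post w (e # trail) K K'" if *: "?post (snd e) trail (switch_edge (snd e) w K) K'" for K'
      proof -
        have "edge_color K' j i = edge_color K j i \<or>
            edge_color K' j i \<noteq> Some Green \<and> Buyer i \<in> insert w (snd ` set (e # trail))" for j i
          using *[THEN conjunct2, THEN conjunct2, rule_format, of j i]
            colors[of "snd e", THEN conjunct2, THEN conjunct2, rule_format, of j i] by auto
        then show ?thesis using * colors[of "snd e"] by simp
      qed
    qed simp_all
    then show ?thesis using True by (auto intro!: runs_tick)
  next
    case False
    have "runs (switch_path trail w K) n (4 * length trail) (?post w (e # trail) K)"
      using Cons.IH[of w K] by (rule runs_mono) auto
    then show ?thesis using False by (auto intro!: runs_tick)
  qed
qed (simp add: runs_ret)

lemma vertex_color_recolor [simp]: "vertex_color (recolor u c K) w = (if w = u then c else vertex_color K w)"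
  "edge_color (recolor u c K) = edge_color K"
  by (cases u; cases w; auto)+

lemma runs_paint:
  assumes "18 * m \<le> T"
  shows "runs (paint m Q c K) n T (\<lambda>K'. edge_color K' = edge_color K \<and>
    (\<forall>u. vertex_color K' u = (if u \<in> set (vertices m) \<and> Q u then c else vertex_color K u)))"
  unfolding paint_def
proof (rule runs_for_each[where I = "\<lambda>us K'. edge_color K' = edge_color K \<and>
    (\<forall>u. vertex_color K' u = (if u \<in> set us \<and> Q u then c else vertex_color K u))" and T = 8])
  show "length (vertices m) * (8 + 1) \<le> T" using assms by (simp add: card_vertices)
qed (auto intro!: runs_tick[where T = 0] runs_ret)

section \<open>Colorings\<close>

text \<open>Consequences: no rb-arc enters a blue buyer, no br-arc leaves one, and every edge at a
  blue buyer is blue.\<close>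

definition coherent :: "cgraph \<Rightarrow> bool" where
  "coherent K \<longleftrightarrow> (\<forall>j i. edge_color K j i \<noteq> Some Green \<and> (edge_color K j i = Some Red \<longrightarrow> buyer_color K i \<noteq> Blue))"

definition loses_blue :: "cgraph \<Rightarrow> cgraph \<Rightarrow> bool" where
  "loses_blue K K' \<longleftrightarrow> (\<forall>i. buyer_color K' i = Blue \<longrightarrow> buyer_color K i = Blue)"

definition progress :: "nat \<Rightarrow> cgraph \<Rightarrow> cgraph \<Rightarrow> bool" where
  "progress m K K' \<longleftrightarrow> (\<exists>a<m. buyer_color K a = Blue \<and> buyer_color K' a \<noteq> Blue)"

lemma loses_blue_refl [simp]: "loses_blue K K"
  by (simp add: loses_blue_def)

lemma loses_blue_trans: "loses_blue K K' \<Longrightarrow> loses_blue K' K'' \<Longrightarrow> loses_blue K K''"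
  by (simp add: loses_blue_def)

lemma progress_trans:
  "progress m K K' \<Longrightarrow> loses_blue K' K'' \<Longrightarrow> progress m K K''"
  "loses_blue K K' \<Longrightarrow> progress m K' K'' \<Longrightarrow> progress m K K''"
  unfolding progress_def loses_blue_def by blast+

text \<open>As no buyer becomes blue, an unchanged edge stays coherent and only changed edges need a
  check.\<close>

lemma coherent_transfer:
  assumes "coherent K" and "loses_blue K K'"
    and "\<And>j i. edge_color K' j i = edge_color K j i \<or> edge_color K' j i \<noteq> Some Green \<and>
      (edge_color K' j i = Some Red \<longrightarrow> buyer_color K' i \<noteq> Blue)"
  shows "coherent K'"
  using assms unfolding coherent_def loses_blue_def by metis

text \<open>\<open>K1\<close> has the path switched but its vertices not yet recolored and may be
  incoherent at the ends of the path. Coherence is therefore proved directly for the recolored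
  \<open>K2\<close>: every buyer on the path was not blue before or is not blue afterwards.\<close>

lemma coherent_switch:
  fixes K K1 K2 :: cgraph
  assumes "coherent K"
    and switched: "good_color K1 = good_color K \<and> buyer_color K1 = buyer_color K \<and>
      (\<forall>j i. edge_color K1 j i = edge_color K j i \<or>
        edge_color K1 j i \<noteq> Some Green \<and> Buyer i \<in> insert w (snd ` set trail))"
    and trail: "\<And>i u. (u, Buyer i) \<in> set trail \<Longrightarrow> buyer_color K i \<noteq> Blue \<or> buyer_color K2 i \<noteq> Blue"
    and stop: "\<And>i. w = Buyer i \<Longrightarrow> buyer_color K i \<noteq> Blue \<or> buyer_color K2 i \<noteq> Blue"
    and K2: "edge_color K2 = edge_color K1" "loses_blue K K2"
  shows "coherent K2"
  using assms(1) K2(2)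
proof (rule coherent_transfer)
  fix j i
  have "buyer_color K i \<noteq> Blue \<or> buyer_color K2 i \<noteq> Blue" if "Buyer i \<in> insert w (snd ` set trail)"
    using that trail stop by fastforce
  then show "edge_color K2 j i = edge_color K j i \<or> edge_color K2 j i \<noteq> Some Green \<and>
      (edge_color K2 j i = Some Red \<longrightarrow> buyer_color K2 i \<noteq> Blue)"
    using switched K2 unfolding loses_blue_def by metis
qed

lemma rb_br_reverse: "rb K u w \<longleftrightarrow> br K w u"
  by (cases u; cases w) auto

lemma br_from_buyer: "coherent K \<Longrightarrow> br K (Buyer i) w \<Longrightarrow> buyer_color K i \<noteq> Blue"
  by (cases w) (auto simp: coherent_def)

lemma rb_into_buyer: "coherent K \<Longrightarrow> rb K u (Buyer i) \<Longrightarrow> buyer_color K i \<noteq> Blue"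
  by (simp add: rb_br_reverse br_from_buyer)

lemma in_subgraph_arc: "in_subgraph X Y F arc u w \<Longrightarrow> arc u w"
  by (cases u; cases w) auto

lemma recolor_simps [simp]:
  "buyer_color (recolor (Good j) c K) = buyer_color K"
  "good_color (recolor (Good j) c K) = (good_color K)(j := c)"
  "buyer_color (recolor (Buyer i) c K) = (buyer_color K)(i := c)"
  "good_color (recolor (Buyer i) c K) = good_color K"
  by auto

section \<open>Hopcroft-Karp and the initial coloring\<close>

text \<open>No br-arc leaves a blue buyer, so the only blue buyer on the path can be its end, which
  is colored red.\<close>

lemma runs_layered_augment:
  assumes "coherent K" and "g < m"
  shows "runs (layered_augment m R depth D g (K, visited)) (search_cells m) (50 * (m + 1)^2)
    (\<lambda>(K', _). coherent K')"
proof -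
  have starts: "set [Good g] \<subseteq> set (vertices m)" "length [Good g] \<le> m" using assms(2) by auto
  have continue: "runs (case end of
       None \<Rightarrow> ret (K, visited')
     | Some w \<Rightarrow> do {
         K' \<leftarrow> switch_path trail w K;
         tick 2;
         ret (recolor w Red (recolor (Good g) Red K'), visited')
       }) (search_cells m) (8 * m + 2) (\<lambda>(K', _). coherent K')"
    if len: "length trail \<le> 2 * m" and trail: "\<forall>(w, u)\<in>set trail. br K u w" for visited' trail "end"
  proof (cases "end")
    case None
    then show ?thesis using assms(1) by (simp add: runs_ret)
  next
    case (Some w)
    have "runs (do {
         K' \<leftarrow> switch_path trail w K;
         tick 2;
         ret (recolor w Red (recolor (Good g) Red K'), visited')
       }) (search_cells m) (8 * m + 2) (\<lambda>(K', _). coherent K')"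
    proof (rule runs_bind[OF runs_switch_path])
      fix K1 :: cgraph
      assume K1: "good_color K1 = good_color K \<and> buyer_color K1 = buyer_color K \<and>
        (\<forall>j i. edge_color K1 j i = edge_color K j i \<or>
          edge_color K1 j i \<noteq> Some Green \<and> Buyer i \<in> insert w (snd ` set trail))"
      have "coherent (recolor w Red (recolor (Good g) Red K1))"
      proof (rule coherent_switch[OF assms(1) K1])
        show "buyer_color K i \<noteq> Blue \<or> buyer_color (recolor w Red (recolor (Good g) Red K1)) i \<noteq> Blue"
          if "(u, Buyer i) \<in> set trail" for i u
          using trail that br_from_buyer[OF assms(1), of i u] by auto
        show "loses_blue K (recolor w Red (recolor (Good g) Red K1))"
          using K1 by (cases w) (auto simp: loses_blue_def)
      qed auto
      then show "runs (do { tick 2; ret (recolor w Red (recolor (Good g) Red K1), visited') })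
          (search_cells m) 2 (\<lambda>(K', _). coherent K')"
        by (auto intro!: runs_tick[where T = 0] runs_ret)
    qed (use len in auto)
    then show ?thesis using Some by simp
  qed
  show ?thesis
    unfolding layered_augment_def prod.case
    by (rule runs_bind_search[OF starts], rule continue) (auto simp: power2_eq_square)
qed

text \<open>Each of the at most \<open>m\<close> augmentations is charged a full search of cost
  O(m^2), although the searches of a phase share \<open>visited\<close>; this gives O(m^3).\<close>

lemma runs_hk_phase:
  assumes "coherent K"
  shows "runs (hk_phase m K) (search_cells m) (150 * (m + 1)^3) (\<lambda>(_, K'). coherent K')"
proof -
  have augment: "runs (do {
       tick (2 * m + length trail);
       depth \<leftarrow> for_each (rev trail) (\<lambda>(w, u) d. do { tick 3; ret (d(w := Suc (d u))) }) (\<lambda>_. 0);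
       D \<leftarrow> for_each ends (\<lambda>i D. do { tick 2; ret (min D (depth (Buyer i))) }) (depth (Buyer (hd ends)));
       (K', _) \<leftarrow> for_each free (layered_augment m R depth D) (K, {});
       ret (True, K')
     }) (search_cells m) (4 * m + 8 * m + 3 * m + m * (50 * (m + 1)^2 + 1)) (\<lambda>(_, K'). coherent K')"
    if len: "length trail \<le> 2 * m" "length ends \<le> m" "length free \<le> m" and free: "\<forall>g\<in>set free. g < m"
    for trail :: search_trail and ends free R
  proof (rule runs_tick)
    let ?K = "\<lambda>(_, K'). coherent K'"
    show "runs (do {
       depth \<leftarrow> for_each (rev trail) (\<lambda>(w, u) d. do { tick 3; ret (d(w := Suc (d u))) }) (\<lambda>_. 0);
       D \<leftarrow> for_each ends (\<lambda>i D. do { tick 2; ret (min D (depth (Buyer i))) }) (depth (Buyer (hd ends)));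
       (K', _) \<leftarrow> for_each free (layered_augment m R depth D) (K, {});
       ret (True, K')
     }) (search_cells m) (8 * m + (3 * m + m * (50 * (m + 1)^2 + 1))) ?K"
    proof (rule runs_bind[OF runs_for_each_time[where T = 3] runs_bind[OF runs_for_each_time[where T = 2]
          runs_bind[OF runs_for_each[where I = "\<lambda>_ (K', _). coherent K'" and T = "50 * (m + 1)^2"]]]])
      show "length free * (50 * (m + 1)^2 + 1) \<le> m * (50 * (m + 1)^2 + 1)" using len(3) by (rule mult_le_mono1)
      show "runs (layered_augment m R depth D x b) (search_cells m) (50 * (m + 1)^2) (\<lambda>(K', _). coherent K')"
        if "set (ys @ [x]) \<subseteq> set free" "case b of (K', _) \<Rightarrow> coherent K'" for depth D ys x b
        using that free runs_layered_augment[of "fst b" x m R depth D "snd b"] by (cases b) auto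
      show "runs (case x of (K', _) \<Rightarrow> ret (True, K')) (search_cells m) 0 ?K"
        if "case x of (K', _) \<Rightarrow> coherent K'" for x :: "cgraph \<times> vertex set"
        using that by (cases x) (simp add: runs_ret)
    qed (use len assms in \<open>auto intro!: runs_tick[where T = 0] runs_ret\<close>)
  qed (use len in simp)
  have starts: "set (map Good (filter (\<lambda>j. good_color K j = Blue) [0..<m])) \<subseteq> set (vertices m)"
    "length (map Good (filter (\<lambda>j. good_color K j = Blue) [0..<m])) \<le> m"
    using length_filter_le[of _ "[0..<m]"] by auto
  show ?thesis
    unfolding hk_phase_def
  proof (rule runs_bind[OF runs_select[OF order_refl]], hypsubst)
    let ?free = "filter (\<lambda>j. good_color K j = Blue) [0..<m]"
    show "runs (do {
       (R, trail, _) \<leftarrow> search BFS m (br K) {} {} (map Good ?free);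
       ends \<leftarrow> select (\<lambda>i. buyer_color K i = Blue \<and> Buyer i \<in> R) [0..<m];
       if ends = [] then ret (False, K)
       else do {
         tick (2 * m + length trail);
         depth \<leftarrow> for_each (rev trail) (\<lambda>(w, u) d. do { tick 3; ret (d(w := Suc (d u))) }) (\<lambda>_. 0);
         D \<leftarrow> for_each ends (\<lambda>i D. do { tick 2; ret (min D (depth (Buyer i))) }) (depth (Buyer (hd ends)));
         (K', _) \<leftarrow> for_each ?free (layered_augment m R depth D) (K, {});
         ret (True, K')
       }
     }) (search_cells m) (40 * (m + 1)^2 + (8 * m + (4 * m + 8 * m + 3 * m + m * (50 * (m + 1)^2 + 1))))
       (\<lambda>(_, K'). coherent K')"
    proof (rule runs_bind_search[OF starts], rule runs_bind[OF runs_select])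
      fix R and trail :: search_trail and "end" ends
      assume trail: "length trail \<le> 2 * m" and ends: "ends = filter (\<lambda>i. buyer_color K i = Blue \<and> Buyer i \<in> R) [0..<m]"
      show "runs (if ends = [] then ret (False, K)
       else do {
         tick (2 * m + length trail);
         depth \<leftarrow> for_each (rev trail) (\<lambda>(w, u) d. do { tick 3; ret (d(w := Suc (d u))) }) (\<lambda>_. 0);
         D \<leftarrow> for_each ends (\<lambda>i D. do { tick 2; ret (min D (depth (Buyer i))) }) (depth (Buyer (hd ends)));
         (K', _) \<leftarrow> for_each ?free (layered_augment m R depth D) (K, {});
         ret (True, K')
       }) (search_cells m) (4 * m + 8 * m + 3 * m + m * (50 * (m + 1)^2 + 1)) (\<lambda>(_, K'). coherent K')"
      proof (cases "ends = []")
        case False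
        show ?thesis unfolding if_not_P[OF False]
          by (rule augment[OF trail]) (use ends length_filter_le[of _ "[0..<m]"] in auto)
      qed (simp add: runs_ret assms)
    qed auto
  qed (simp add: power2_eq_square power3_eq_cube algebra_simps)
qed

text \<open>The fuel \<open>Suc m\<close> limits the phases, and at O(m^3) each they fit into the
  total of O(m^4).\<close>

lemma runs_initial_coloring:
  "runs (initial_coloring m E) (search_cells m) (250 * (m + 1)^4) coherent"
proof -
  have phases: "runs (hk_phases k m K) (search_cells m) (k * (150 * (m + 1)^3)) coherent" if "coherent K" for k K
    using that
  proof (induction k arbitrary: K)
    case (Suc k)
    have "runs (do { (augmented, K') \<leftarrow> hk_phase m K; if augmented then hk_phases k m K' else ret K' })
        (search_cells m) (150 * (m + 1)^3 + k * (150 * (m + 1)^3)) coherent"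
    proof (rule runs_bind[OF runs_hk_phase[OF Suc.prems]])
      show "runs (case x of (augmented, K') \<Rightarrow> if augmented then hk_phases k m K' else ret K')
          (search_cells m) (k * (150 * (m + 1)^3)) coherent" if "case x of (_, K') \<Rightarrow> coherent K'" for x
        using that Suc.IH by (cases x) (auto intro!: runs_ret)
    qed simp
    then show ?case by simp
  qed (simp add: runs_ret)
  let ?K = "\<lparr>good_color = (\<lambda>_. Blue), buyer_color = (\<lambda>_. Blue),
    edge_color = (\<lambda>j i. if j < m \<and> i < m \<and> (j, i) \<in> E then Some Blue else None)\<rparr>"
  have "coherent ?K" by (auto simp: coherent_def)
  then have hk: "runs (hopcroft_karp m ?K) (search_cells m) (Suc m * (150 * (m + 1)^3)) coherent"
    unfolding hopcroft_karp_def by (rule phases)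
  have finish: "runs (do {
     Mb \<leftarrow> select (\<lambda>j. good_color K j = Blue) [0..<m];
     (R, _, _) \<leftarrow> search BFS m (br K) {} {} (map Good Mb);
     paint m (\<lambda>u. u \<in> R \<and> u \<notin> Good ` set Mb) Green K
   }) (search_cells m) (8 * m + (40 * (m + 1)^2 + 18 * m)) coherent" if "coherent K" for K
  proof (rule runs_bind[OF runs_select])
    fix Mb assume Mb: "Mb = filter (\<lambda>j. good_color K j = Blue) [0..<m]"
    then have starts: "set (map Good Mb) \<subseteq> set (vertices m)" "length (map Good Mb) \<le> m"
      using length_filter_le[of _ "[0..<m]"] by auto
    have paint: "runs (paint m Q Green K) (search_cells m) (18 * m) coherent" for Q
    proof (rule runs_mono[OF runs_paint[OF order_refl]])
      fix K'
      assume *: "edge_color K' = edge_color K \<and>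
        (\<forall>u. vertex_color K' u = (if u \<in> set (vertices m) \<and> Q u then Green else vertex_color K u))"
      have "buyer_color K' i = buyer_color K i \<or> buyer_color K' i = Green" for i
        using *[THEN conjunct2, rule_format, of "Buyer i"] by (auto split: if_splits)
      then have "loses_blue K K'" unfolding loses_blue_def by (metis color.distinct(6))
      then show "coherent K'" using * by (intro coherent_transfer[OF that]) auto
    qed (rule order_refl)+
    show "runs (do {
       (R, _, _) \<leftarrow> search BFS m (br K) {} {} (map Good Mb);
       paint m (\<lambda>u. u \<in> R \<and> u \<notin> Good ` set Mb) Green K
     }) (search_cells m) (40 * (m + 1)^2 + 18 * m) coherent"
      by (rule runs_bind_search[OF starts paint]) simp
  qed auto
  show ?thesis
    unfolding initial_coloring_def
    by (rule runs_tick[OF runs_bind[OF hk finish order_refl]])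
      (simp_all add: power2_eq_square power3_eq_cube power4_eq_xxxx algebra_simps)
qed

section \<open>Updating the coloring\<close>

text \<open>Closed form of the double loop: its tests read the input coloring and never the one
  under construction, so each pair is decided on its own.\<close>

definition updated_edge :: "nat \<Rightarrow> graph \<Rightarrow> nat set \<Rightarrow> cgraph \<Rightarrow> nat \<Rightarrow> nat \<Rightarrow> color option" where
  "updated_edge m E A K j i =
    (if j < m \<and> i < m \<and> good_color K j = Red \<and> buyer_color K i = Green then None
     else if j < m \<and> i < m \<and> good_color K j \<noteq> Red \<and> i \<in> A \<and> (j, i) \<in> E \<and> edge_color K j i = None then Some Blue
     else edge_color K j i)"

lemma runs_update_edges:
  "runs (update_edges m E A K) n (13 * m * m) (\<lambda>K'. good_color K' = good_color K \<and>
    buyer_color K' = buyer_color K \<and> edge_color K' = updated_edge m E A K)"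
proof -
  let ?I = "\<lambda>es K'. good_color K' = good_color K \<and> buyer_color K' = buyer_color K \<and>
    (\<forall>j i. edge_color K' j i = (if (j, i) \<in> set es then updated_edge m E A K j i else edge_color K j i))"
  have "runs (update_edges m E A K) n (13 * m * m) (?I (List.product [0..<m] [0..<m]))"
    unfolding update_edges_def
  proof (rule runs_for_each[where I = ?I and T = 12])
    fix es :: "(nat \<times> nat) list" and e :: "nat \<times> nat" and K' :: cgraph
    assume e: "set (es @ [e]) \<subseteq> set (List.product [0..<m] [0..<m])" and K': "?I es K'"
    obtain j i where ji: "e = (j, i)" "j < m" "i < m" using e by (cases e) auto
    let ?K = "if good_color K j = Red \<and> buyer_color K i = Green then set_edge j i None K'
            else if good_color K j \<noteq> Red \<and> i \<in> A \<and> (j, i) \<in> E \<and> edge_color K j i = None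
              then set_edge j i (Some Blue) K'
            else K'"
    have "?I (es @ [e]) ?K" using K' ji by (auto simp: set_edge_def updated_edge_def)
    then show "runs ((case e of (j, i) \<Rightarrow> \<lambda>K'. do {
       tick 12;
       ret (if good_color K j = Red \<and> buyer_color K i = Green then set_edge j i None K'
            else if good_color K j \<noteq> Red \<and> i \<in> A \<and> (j, i) \<in> E \<and> edge_color K j i = None
              then set_edge j i (Some Blue) K'
            else K')
     }) K') n 12 (?I (es @ [e]))"
      unfolding ji(1) prod.case by (intro runs_tick[where T = 0] runs_ret) auto
  qed (simp_all add: algebra_simps)
  then show ?thesis by (rule runs_mono) (auto simp: updated_edge_def fun_eq_iff)
qed

lemma loses_blue_paint:
  assumes "\<forall>u. vertex_color K' u = (if u \<in> set (vertices m) \<and> Q u then c else vertex_color K u)" and "c \<noteq> Blue"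
  shows "loses_blue K K'"
  unfolding loses_blue_def
proof (intro allI impI)
  fix i assume "buyer_color K' i = Blue"
  then show "buyer_color K i = Blue"
    using assms(1)[rule_format, of "Buyer i"] assms(2) by (auto split: if_splits)
qed

lemma coherent_paint:
  assumes "edge_color K' = edge_color K \<and>
      (\<forall>u. vertex_color K' u = (if u \<in> set (vertices m) \<and> Q u then c else vertex_color K u))"
    and "c \<noteq> Blue" and "coherent K"
  shows "coherent K'" "loses_blue K K'"
  using assms loses_blue_paint[of K' m Q c K] by (auto intro: coherent_transfer)

lemma runs_retract_green:
  "runs (retract_green m X F K) (search_cells m) (70 * (m + 1)^2) (\<lambda>K'. edge_color K' = edge_color K \<and>
    (\<forall>u. vertex_color K' u = (if u \<in> set (vertices m) \<and> vertex_color K u = Green \<and>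
      u \<notin> reached m (in_subgraph X (buyers m K {Green}) F (br K)) (Good ` goods m K {Blue})
      then Red else vertex_color K u)))"
  unfolding retract_green_def
proof (rule runs_bind[OF runs_select[OF order_refl]])
  fix Mb assume Mb: "Mb = filter (\<lambda>j. good_color K j = Blue) [0..<m]"
  then have starts: "set (map Good Mb) \<subseteq> set (vertices m)" "length (map Good Mb) \<le> m"
    and set_Mb: "set (map Good Mb) = Good ` goods m K {Blue}"
    using length_filter_le[of _ "[0..<m]"] by (auto simp: goods_def)
  show "runs (do {
     (R, _, _) \<leftarrow> search BFS m (in_subgraph X (buyers m K {Green}) F (br K)) {} {} (map Good Mb);
     paint m (\<lambda>u. vertex_color K u = Green \<and> u \<notin> R) Red K
   }) (search_cells m) (40 * (m + 1)^2 + 18 * m) (\<lambda>K'. edge_color K' = edge_color K \<and>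
    (\<forall>u. vertex_color K' u = (if u \<in> set (vertices m) \<and> vertex_color K u = Green \<and>
      u \<notin> reached m (in_subgraph X (buyers m K {Green}) F (br K)) (Good ` goods m K {Blue})
      then Red else vertex_color K u)))"
  proof (rule runs_bind_search[OF starts _ order_refl])
    let ?arc = "in_subgraph X (buyers m K {Green}) F (br K)"
    fix R and "end" :: "vertex option"
    assume R: "bipartite ?arc \<Longrightarrow> {} = {} \<Longrightarrow> end = None \<Longrightarrow> R = reached m ?arc (set (map Good Mb))"
      and "\<And>w. end = Some w \<Longrightarrow> w \<in> {}"
    \<comment> \<open>An empty target rules out an early stop, so the reached set is exact.\<close>
    then have "end = None" by (cases "end") auto
    with R have "R = reached m ?arc (Good ` goods m K {Blue})" using set_Mb by (simp add: bipartite_arcs)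
    then show "runs (paint m (\<lambda>u. vertex_color K u = Green \<and> u \<notin> R) Red K) (search_cells m) (18 * m)
      (\<lambda>K'. edge_color K' = edge_color K \<and>
        (\<forall>u. vertex_color K' u = (if u \<in> set (vertices m) \<and> vertex_color K u = Green \<and>
          u \<notin> reached m ?arc (Good ` goods m K {Blue}) then Red else vertex_color K u)))"
      by (simp only:) (rule runs_paint[OF order_refl])
  qed
qed (simp add: power2_eq_square)

lemma runs_retract_green_coherent:
  assumes "coherent K"
  shows "runs (retract_green m X F K) (search_cells m) (70 * (m + 1)^2) (\<lambda>K'. coherent K' \<and> loses_blue K K')"
  using runs_retract_green
proof (rule runs_mono)
  fix K'
  assume *: "edge_color K' = edge_color K \<and>
    (\<forall>u. vertex_color K' u = (if u \<in> set (vertices m) \<and> vertex_color K u = Green \<and>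
      u \<notin> reached m (in_subgraph X (buyers m K {Green}) F (br K)) (Good ` goods m K {Blue})
      then Red else vertex_color K u))"
  show "coherent K' \<and> loses_blue K K'"
    using coherent_paint[OF * _ assms] by simp
qed auto

section \<open>Processing a single blue buyer\<close>

text \<open>Failure leaves the coloring literally unchanged, so that the failure witnesses
  \<open>stuck\<close> of several buyers speak about one and the same coloring.\<close>

definition settles :: "(nat \<Rightarrow> cgraph \<Rightarrow> bool) \<Rightarrow> nat \<Rightarrow> cgraph \<Rightarrow> cgraph \<Rightarrow> bool" where
  "settles stuck a K K' \<longleftrightarrow> coherent K' \<and> loses_blue K K' \<and>
    (buyer_color K a = Blue \<longrightarrow> buyer_color K' a \<noteq> Blue \<or> K' = K \<and> stuck a K)"

lemma settles_recolored:
  "coherent K' \<Longrightarrow> loses_blue K K' \<Longrightarrow> buyer_color K' a \<noteq> Blue \<Longrightarrow> settles stuck a K K'"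
  by (simp add: settles_def)

text \<open>No rb-arc enters a blue buyer, so \<open>a\<close>, the start of the search, is the only
  possibly blue buyer on the switched path, and it turns green. The retraction afterwards only turns
  green into red.\<close>

lemma runs_augment:
  assumes "coherent K" and "length trail \<le> 2 * m"
    and trail: "\<forall>(w, u)\<in>set trail. u = Buyer a \<or> (\<exists>p. rb K p u)"
  shows "runs (do {
       K1 \<leftarrow> switch_path trail (Good x) K;
       tick 2;
       retract_green_gb m (recolor (Buyer a) Green (recolor (Good x) Green K1))
     }) (search_cells m) (80 * (m + 1)^2) (settles stuck a K)"
proof (rule runs_bind[OF runs_switch_path])
  fix K1 :: cgraph
  let ?K = "recolor (Buyer a) Green (recolor (Good x) Green K1)"
  assume K1: "good_color K1 = good_color K \<and> buyer_color K1 = buyer_color K \<and>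
      (\<forall>j i. edge_color K1 j i = edge_color K j i \<or>
        edge_color K1 j i \<noteq> Some Green \<and> Buyer i \<in> insert (Good x) (snd ` set trail))"
  have K: "loses_blue K ?K" "buyer_color ?K a \<noteq> Blue" using K1 by (auto simp: loses_blue_def)
  have "coherent ?K"
  proof (rule coherent_switch[OF assms(1) K1])
    show "buyer_color K i \<noteq> Blue \<or> buyer_color ?K i \<noteq> Blue" if "(u, Buyer i) \<in> set trail" for i u
      using trail that rb_into_buyer[OF assms(1), of _ i] by fastforce
  qed (use K in auto)
  have "runs (retract_green_gb m ?K) (search_cells m) (70 * (m + 1)^2) (settles stuck a K)"
    unfolding retract_green_gb_def using runs_retract_green_coherent[OF \<open>coherent ?K\<close>]
  proof (rule runs_mono)
    fix K' assume "coherent K' \<and> loses_blue ?K K'"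
    then show "settles stuck a K K'"
      using K loses_blue_trans[of K ?K K'] by (intro settles_recolored) (auto simp del: recolor.simps simp: loses_blue_def)
  qed auto
  then show "runs (do { tick 2; retract_green_gb m ?K }) (search_cells m) (2 + 70 * (m + 1)^2) (settles stuck a K)"
    by (rule runs_tick) simp
qed (use assms(2) in \<open>simp add: power2_eq_square\<close>)

text \<open>Failure witness for a new buyer. Being new, the buyer has a non-red neighbor, which must
  then be green.\<close>

definition no_blue_neighbor :: "nat \<Rightarrow> nat \<Rightarrow> cgraph \<Rightarrow> bool" where
  "no_blue_neighbor m a K \<longleftrightarrow> (\<forall>j<m. edge_color K j a \<noteq> None \<longrightarrow> good_color K j \<noteq> Blue)"

lemma match_green_simps:
  "buyer_color (match_green a x K) = (buyer_color K)(a := Green)"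
  "good_color (match_green a x K) = (good_color K)(x := Green)"
  "edge_color (match_green a x K) j i = (if j = x \<and> i = a then Some Red else edge_color K j i)"
  by (auto simp: match_green_def set_edge_def)

text \<open>The new red edge and the color green reach \<open>a\<close> together, so coherence
  survives; \<open>K'\<close> stands for any later repainting that does not bring blue back.\<close>

lemma settles_match_green:
  assumes "coherent K" and "coherent (match_green a x K) \<Longrightarrow> coherent K' \<and> loses_blue (match_green a x K) K'"
  shows "settles stuck a K K'"
proof -
  have K1: "loses_blue K (match_green a x K)" by (simp add: loses_blue_def match_green_simps)
  then have "coherent (match_green a x K)"
    by (rule coherent_transfer[OF assms(1)]) (auto simp: match_green_simps)
  with assms(2) K1 show ?thesis
    by (auto intro!: settles_recolored elim: loses_blue_trans simp: loses_blue_def match_green_simps)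
qed

lemma in_gb_subgraph_rb: "in_gb_subgraph m K (rb K) u w \<Longrightarrow> rb K u w"
  unfolding in_gb_subgraph_def by (rule in_subgraph_arc)

text \<open>With a blue neighbor \<open>a\<close> becomes green, and possibly red by the painting,
  but in any case not blue. The coloring stays untouched only if there is no blue neighbor and
  either no green one or a search without a hit.\<close>

lemma runs_process_new_buyer:
  assumes "coherent K" and "a < m"
  shows "runs (process_new_buyer m a K) (search_cells m) (200 * (m + 1)^2) (settles (no_blue_neighbor m) a K)"
proof -
  let ?post = "settles (no_blue_neighbor m) a K"
  let ?Nb = "filter (\<lambda>j. edge_color K j a \<noteq> None \<and> good_color K j = Blue) [0..<m]"
  let ?Ng = "filter (\<lambda>j. edge_color K j a \<noteq> None \<and> good_color K j = Green) [0..<m]"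
  have stuck: "?post K" if "?Nb = []"
    using that assms(1) by (auto simp: settles_def no_blue_neighbor_def filter_empty_conv Ball_def)
  have match: "runs (ret (match_green a x K)) (search_cells m) T ?post" for x T
    by (rule runs_ret, rule settles_match_green[OF assms(1), of a x]) simp
  have paint: "runs (paint m Q Red (match_green a x K)) (search_cells m) (18 * m) ?post" for Q x
    using runs_paint[OF order_refl]
  proof (rule runs_mono)
    show "?post K'" if "edge_color K' = edge_color (match_green a x K) \<and>
      (\<forall>u. vertex_color K' u = (if u \<in> set (vertices m) \<and> Q u then Red else vertex_color (match_green a x K) u))" for K'
      using coherent_paint[OF that] by (intro settles_match_green[OF assms(1), of a x]) simp
  qed auto
  have many: "runs (do { x \<leftarrow> pick (set ?Nb); tick 3; ret (match_green a x K) })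
      (search_cells m) 10 ?post" if "length ?Nb > 1"
  proof (intro runs_pick[where T = 3] runs_tick[where T = 0] match)
    show "set ?Nb \<noteq> {}" using that by (intro notI) (simp only: set_empty list.size)
  qed simp_all
  have one: "runs (do {
       let x = hd ?Nb;
       let K1 = match_green a x K;
       tick 3;
       if ?Ng \<noteq> [] then do {
         (R, _, _) \<leftarrow> search DFS m (in_gb_subgraph m K1 (rb K1)) {} {} [Good x];
         X \<leftarrow> select (\<lambda>j. Good j \<in> R \<and> good_color K j = Blue) [0..<m];
         if X = [x] then paint m (\<lambda>u. u \<in> R) Red K1
         else do {
           (R', _, _) \<leftarrow> search DFS m (in_gb_subgraph m K1 (br K1)) {} {} [Buyer a];
           X' \<leftarrow> select (\<lambda>j. Good j \<in> R' \<and> good_color K j = Blue) [0..<m];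
           if X' = [x] then paint m (\<lambda>u. u \<in> R') Red K1 else ret K1
         }
       }
       else ret K1
     }) (search_cells m) (3 + (40 * (m + 1)^2 + (8 * m + (40 * (m + 1)^2 + (8 * m + 18 * m))))) ?post"
    if "length ?Nb = 1"
    unfolding Let_def
  proof (rule runs_tick[OF _ order_refl])
    let ?x = "hd ?Nb"
    let ?K1 = "match_green a ?x K"
    have "?x \<in> set ?Nb" using that by (intro hd_in_set) auto
    then have x: "set [Good ?x] \<subseteq> set (vertices m)" "length [Good ?x] \<le> m" by auto
    have a: "set [Buyer a] \<subseteq> set (vertices m)" "length [Buyer a] \<le> m" using assms(2) by auto
    have second: "runs (do {
           (R', _, _) \<leftarrow> search DFS m (in_gb_subgraph m ?K1 (br ?K1)) {} {} [Buyer a];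
           X' \<leftarrow> select (\<lambda>j. Good j \<in> R' \<and> good_color K j = Blue) [0..<m];
           if X' = [?x] then paint m (\<lambda>u. u \<in> R') Red ?K1 else ret ?K1
         }) (search_cells m) (40 * (m + 1)^2 + (8 * m + 18 * m)) ?post"
    proof (rule runs_bind_search[OF a _ order_refl], rule runs_bind[OF runs_select])
      show "runs (if X' = [?x] then paint m (\<lambda>u. u \<in> R') Red ?K1 else ret ?K1) (search_cells m) (18 * m) ?post" for X' R'
        by (cases "X' = [?x]") (simp_all add: paint match)
    qed auto
    have "runs (do {
         (R, _, _) \<leftarrow> search DFS m (in_gb_subgraph m ?K1 (rb ?K1)) {} {} [Good ?x];
         X \<leftarrow> select (\<lambda>j. Good j \<in> R \<and> good_color K j = Blue) [0..<m];
         if X = [?x] then paint m (\<lambda>u. u \<in> R) Red ?K1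
         else do {
           (R', _, _) \<leftarrow> search DFS m (in_gb_subgraph m ?K1 (br ?K1)) {} {} [Buyer a];
           X' \<leftarrow> select (\<lambda>j. Good j \<in> R' \<and> good_color K j = Blue) [0..<m];
           if X' = [?x] then paint m (\<lambda>u. u \<in> R') Red ?K1 else ret ?K1
         }
       }) (search_cells m) (40 * (m + 1)^2 + (8 * m + (40 * (m + 1)^2 + (8 * m + 18 * m)))) ?post"
    proof (rule runs_bind_search[OF x _ order_refl], rule runs_bind[OF runs_select])
      show "runs (if X = [?x] then paint m (\<lambda>u. u \<in> R) Red ?K1
         else do {
           (R', _, _) \<leftarrow> search DFS m (in_gb_subgraph m ?K1 (br ?K1)) {} {} [Buyer a];
           X' \<leftarrow> select (\<lambda>j. Good j \<in> R' \<and> good_color K j = Blue) [0..<m];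
           if X' = [?x] then paint m (\<lambda>u. u \<in> R') Red ?K1 else ret ?K1
         }) (search_cells m) (40 * (m + 1)^2 + (8 * m + 18 * m)) ?post" for X R
      proof (cases "X = [?x]")
        case True
        show ?thesis unfolding if_P[OF True] by (rule runs_mono[OF paint]) simp_all
      next
        case False
        show ?thesis unfolding if_not_P[OF False] by (rule second)
      qed
    qed auto
    then show "runs (if ?Ng \<noteq> [] then do {
         (R, _, _) \<leftarrow> search DFS m (in_gb_subgraph m ?K1 (rb ?K1)) {} {} [Good ?x];
         X \<leftarrow> select (\<lambda>j. Good j \<in> R \<and> good_color K j = Blue) [0..<m];
         if X = [?x] then paint m (\<lambda>u. u \<in> R) Red ?K1
         else do {
           (R', _, _) \<leftarrow> search DFS m (in_gb_subgraph m ?K1 (br ?K1)) {} {} [Buyer a];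
           X' \<leftarrow> select (\<lambda>j. Good j \<in> R' \<and> good_color K j = Blue) [0..<m];
           if X' = [?x] then paint m (\<lambda>u. u \<in> R') Red ?K1 else ret ?K1
         }
       } else ret ?K1) (search_cells m)
       (40 * (m + 1)^2 + (8 * m + (40 * (m + 1)^2 + (8 * m + 18 * m)))) ?post"
      by (cases "?Ng \<noteq> []") (simp_all only: if_True if_False not_False_eq_True not_True_eq_False match)
  qed
  have none: "runs (do {
       (_, trail, end) \<leftarrow> search DFS m (in_gb_subgraph m K (rb K)) (Good ` goods m K {Blue}) {} [Buyer a];
       case end of
         None \<Rightarrow> ret K
       | Some x \<Rightarrow> do {
           K1 \<leftarrow> switch_path trail x K;
           tick 2;
           retract_green_gb m (recolor (Buyer a) Green (recolor x Green K1))
         }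
     }) (search_cells m) (40 * (m + 1)^2 + 80 * (m + 1)^2) ?post" if "?Nb = []"
  proof (rule runs_bind_search[OF _ _ _ order_refl])
    fix trail :: search_trail and "end" :: "vertex option"
    assume len: "length trail \<le> 2 * m"
      and trail: "\<forall>(w, u)\<in>set trail. in_gb_subgraph m K (rb K) u w \<and>
        (u \<in> set [Buyer a] \<or> (\<exists>p. in_gb_subgraph m K (rb K) p u))"
      and target: "\<And>w. end = Some w \<Longrightarrow> w \<in> Good ` goods m K {Blue}"
    have trail': "\<forall>(w, u)\<in>set trail. u = Buyer a \<or> (\<exists>p. rb K p u)"
      using trail in_gb_subgraph_rb by fastforce
    show "runs (case end of
         None \<Rightarrow> ret K
       | Some x \<Rightarrow> do {
           K1 \<leftarrow> switch_path trail x K;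
           tick 2;
           retract_green_gb m (recolor (Buyer a) Green (recolor x Green K1))
         }) (search_cells m) (80 * (m + 1)^2) ?post"
    proof (cases "end")
      case None
      then show ?thesis using stuck[OF that] by (simp add: runs_ret)
    next
      case (Some w)
      then obtain x where "w = Good x" using target by blast
      then show ?thesis using runs_augment[OF assms(1) len trail', of x] Some by simp
    qed
  qed (use assms(2) in auto)
  have base: "40 * (m + 1)\<^sup>2 + (40 * (m + 1)\<^sup>2) = 80 * (m + 1)^2" "1 \<le> (m + 1)^2" "m \<le> (m + 1)^2" "length [0..<m] = m"
    by (simp_all add: power2_eq_square)
  show ?thesis
    unfolding process_new_buyer_def
  proof (rule runs_bind[OF runs_select[OF order_refl]], hypsubst,
      rule runs_bind[OF runs_select[OF order_refl]], hypsubst, rule runs_tick)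
    show "runs (if length ?Nb > 1 then do {
       x \<leftarrow> pick (set ?Nb);
       tick 3;
       ret (match_green a x K)
     }
     else if length ?Nb = 1 then do {
       let x = hd ?Nb;
       let K1 = match_green a x K;
       tick 3;
       if ?Ng \<noteq> [] then do {
         (R, _, _) \<leftarrow> search DFS m (in_gb_subgraph m K1 (rb K1)) {} {} [Good x];
         X \<leftarrow> select (\<lambda>j. Good j \<in> R \<and> good_color K j = Blue) [0..<m];
         if X = [x] then paint m (\<lambda>u. u \<in> R) Red K1
         else do {
           (R', _, _) \<leftarrow> search DFS m (in_gb_subgraph m K1 (br K1)) {} {} [Buyer a];
           X' \<leftarrow> select (\<lambda>j. Good j \<in> R' \<and> good_color K j = Blue) [0..<m];
           if X' = [x] then paint m (\<lambda>u. u \<in> R') Red K1 else ret K1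
         }
       }
       else ret K1
     }
     else if ?Ng \<noteq> [] then do {
       (_, trail, end) \<leftarrow> search DFS m (in_gb_subgraph m K (rb K)) (Good ` goods m K {Blue}) {} [Buyer a];
       case end of
         None \<Rightarrow> ret K
       | Some x \<Rightarrow> do {
           K1 \<leftarrow> switch_path trail x K;
           tick 2;
           retract_green_gb m (recolor (Buyer a) Green (recolor x Green K1))
         }
     }
     else ret K) (search_cells m) (130 * (m + 1)^2) ?post"
      (is "runs (if ?c1 then ?p1 else if ?c2 then ?p2 else if ?c3 then ?p3 else ?p4) _ _ _")
    proof -
      consider "?c1" | "\<not> ?c1" "?c2" | "\<not> ?c1" "\<not> ?c2" "?c3" | "\<not> ?c1" "\<not> ?c2" "\<not> ?c3" by blast
      then show ?thesis
      proof cases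
        case 1
        show ?thesis unfolding if_P[OF 1] by (rule runs_mono[OF many[OF 1]]) (use base in auto)
      next
        case 2
        show ?thesis unfolding if_not_P[OF 2(1)] if_P[OF 2(2)]
          by (rule runs_mono[OF one[OF 2(2)]], rule order_refl, use base in linarith)
      next
        case 3
        then have "?Nb = []" by (cases "?Nb") auto
        show ?thesis unfolding if_not_P[OF 3(1)] if_not_P[OF 3(2)] if_P[OF 3(3)]
          by (rule runs_mono[OF none[OF \<open>?Nb = []\<close>]]) (use base in auto)
      next
        case 4
        then have "?Nb = []" by (cases "?Nb") auto
        show ?thesis unfolding if_not_P[OF 4(1)] if_not_P[OF 4(2)] if_not_P[OF 4(3)]
          by (rule runs_ret, rule stuck, fact)
      qed
    qed
    show "length ?Nb + 4 + 130 * (m + 1)^2 \<le> 140 * (m + 1)^2"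
      using base length_filter_le[of "\<lambda>j. edge_color K j a \<noteq> None \<and> good_color K j = Blue" "[0..<m]"] by linarith
    show "8 * length [0..<m] + 140 * (m + 1)^2 \<le> 150 * (m + 1)^2" using base by simp
    show "8 * length [0..<m] + 150 * (m + 1)^2 \<le> 200 * (m + 1)^2" using base by simp
  qed
qed

text \<open>Failure witness for a reached buyer, stated in the whole graph because this search is
  not confined to a subgraph.\<close>

definition reaches_no_blue :: "nat \<Rightarrow> nat \<Rightarrow> cgraph \<Rightarrow> bool" where
  "reaches_no_blue m a K \<longleftrightarrow> (\<forall>z<m. good_color K z = Blue \<longrightarrow> \<not> reach m (rb K) (Buyer a) (Good z))"

lemma runs_process_reached_buyer:
  assumes "coherent K" and "a < m"
  shows "runs (process_reached_buyer m a K) (search_cells m) (200 * (m + 1)^2) (settles (reaches_no_blue m) a K)"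
  unfolding process_reached_buyer_def
proof (rule runs_bind_search)
  let ?post = "settles (reaches_no_blue m) a K"
  fix R and trail :: search_trail and "end" :: "vertex option"
  assume len: "length trail \<le> 2 * m"
    and trail: "\<forall>(w, u)\<in>set trail. rb K u w \<and> (u \<in> set [Buyer a] \<or> (\<exists>p. rb K p u))"
    and R: "bipartite (rb K) \<Longrightarrow> {} = {} \<Longrightarrow> end = None \<Longrightarrow> R = reached m (rb K) (set [Buyer a])"
    and target: "\<And>w. end = Some w \<Longrightarrow> w \<in> {}"
  have "end = None" using target by (cases "end") auto
  then have R: "R = {w. reach m (rb K) (Buyer a) w}" using R by (simp add: bipartite_arcs reached_def)
  have trail': "\<forall>(w, u)\<in>set trail. u = Buyer a \<or> (\<exists>p. rb K p u)"
    using trail by fastforce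
  show "runs (do {
     X \<leftarrow> select (\<lambda>j. Good j \<in> R \<and> good_color K j = Blue) [0..<m];
     if X = [] then ret K
     else do {
       x \<leftarrow> pick (set X);
       K1 \<leftarrow> switch_path trail (Good x) K;
       tick 2;
       retract_green_gb m (recolor (Buyer a) Green (recolor (Good x) Green K1))
     }
   }) (search_cells m) (90 * (m + 1)^2) ?post"
  proof (rule runs_bind[OF runs_select[OF order_refl]])
    fix X assume X: "X = filter (\<lambda>j. Good j \<in> R \<and> good_color K j = Blue) [0..<m]"
    show "runs (if X = [] then ret K
     else do {
       x \<leftarrow> pick (set X);
       K1 \<leftarrow> switch_path trail (Good x) K;
       tick 2;
       retract_green_gb m (recolor (Buyer a) Green (recolor (Good x) Green K1))
     }) (search_cells m) (1 + 80 * (m + 1)^2) ?post"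
    proof (cases "X = []")
      case True
      then have "reaches_no_blue m a K" using X R by (auto simp: reaches_no_blue_def filter_empty_conv Ball_def)
      then have "?post K" using assms(1) by (simp add: settles_def)
      then show ?thesis using True by (simp add: runs_ret)
    next
      case False
      show ?thesis unfolding if_not_P[OF False]
        by (rule runs_pick[OF _ runs_augment[OF assms(1) len trail']]) (use False in auto)
    qed
  qed (simp add: power2_eq_square)
qed (use assms(2) in \<open>simp_all add: power2_eq_square\<close>)

text \<open>Blue is never regained, so a single success is still visible at the end. Without a
  success the coloring is constant throughout the loop, and all failure witnesses hold for the
  initial \<open>K\<close>.\<close>

lemma runs_pick_each_settles:
  assumes "coherent K" and "X \<subseteq> {..<m}" and "\<And>a. a \<in> X \<Longrightarrow> buyer_color K a = Blue"
    and process: "\<And>a K. coherent K \<Longrightarrow> a < m \<Longrightarrow> runs (f a K) n T (settles stuck a K)"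
  shows "runs (pick_each X f K) n (card X * (T + 1)) (\<lambda>K'. coherent K' \<and> loses_blue K K' \<and>
    (progress m K K' \<or> K' = K \<and> (\<forall>a\<in>X. stuck a K)))"
proof -
  let ?I = "\<lambda>Y K'. coherent K' \<and> loses_blue K K' \<and> (progress m K K' \<or> K' = K \<and> (\<forall>a\<in>X - Y. stuck a K))"
  have "runs (pick_each X f K) n (card X * (T + 1)) (?I {})"
  proof (rule runs_pick_each[where I = ?I and T = T])
    show "finite X" using assms(2) finite_subset by blast
    fix Y a K'
    assume Y: "Y \<subseteq> X" "a \<in> Y" and K': "?I Y K'"
    then have a: "a < m" "buyer_color K a = Blue" using assms(2,3) by auto
    show "runs (f a K') n T (?I (Y - {a}))"
    proof (rule runs_mono[OF process])
      fix K'' assume K'': "settles stuck a K' K''"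
      have K'': "coherent K''" "loses_blue K' K''"
        "buyer_color K' a = Blue \<Longrightarrow> buyer_color K'' a \<noteq> Blue \<or> K'' = K' \<and> stuck a K'"
        using K'' by (auto simp: settles_def)
      have "progress m K K'' \<or> K'' = K \<and> (\<forall>b\<in>X - (Y - {a}). stuck b K)"
      proof (cases "progress m K K'")
        case False
        then have "K' = K" "\<forall>b\<in>X - Y. stuck b K" using K' by auto
        then show ?thesis using K''(3) a unfolding progress_def by auto
      qed (use K''(2) progress_trans(1) in blast)
      then show "?I (Y - {a}) K''" using K' K'' loses_blue_trans by blast
    qed (use K' a(1) in auto)
  qed (use assms(1) in auto)
  then show ?thesis by simp
qed

section \<open>Anchored colorings\<close>

text \<open>The paths are confined to non-red goods and green buyers. The edge update removes edges
  at red goods only and adds edges only where there were none, so it breaks no such path.\<close>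

definition anchored :: "nat \<Rightarrow> cgraph \<Rightarrow> bool" where
  "anchored m K \<longleftrightarrow> (\<forall>j<m. good_color K j = Green \<longrightarrow>
     Good j \<in> reached m (in_gb_subgraph m K (br K)) (Good ` goods m K {Blue}))"

lemma in_gb_subgraph_br:
  "in_gb_subgraph m K (br K) (Good j) (Buyer i) \<longleftrightarrow> j < m \<and> i < m \<and> good_color K j \<noteq> Red \<and>
     buyer_color K i = Green \<and> edge_color K j i = Some Blue"
  "in_gb_subgraph m K (br K) (Buyer i) (Good j) \<longleftrightarrow> j < m \<and> i < m \<and> good_color K j \<noteq> Red \<and>
     buyer_color K i \<noteq> Red \<and> edge_color K j i = Some Red"
  "\<not> in_gb_subgraph m K (br K) (Good j) (Good j')"
  "\<not> in_gb_subgraph m K (br K) (Buyer i) (Buyer i')"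
proof -
  have c: "c \<in> {Green, Blue} \<longleftrightarrow> c \<noteq> Red" for c by (cases c) auto
  show "in_gb_subgraph m K (br K) (Good j) (Buyer i) \<longleftrightarrow> j < m \<and> i < m \<and> good_color K j \<noteq> Red \<and>
     buyer_color K i = Green \<and> edge_color K j i = Some Blue"
   "in_gb_subgraph m K (br K) (Buyer i) (Good j) \<longleftrightarrow> j < m \<and> i < m \<and> good_color K j \<noteq> Red \<and>
     buyer_color K i \<noteq> Red \<and> edge_color K j i = Some Red"
    unfolding in_gb_subgraph_def goods_def buyers_def edges_def c by auto
qed (auto simp: in_gb_subgraph_def)

lemma in_gb_subgraph_mono:
  assumes "in_gb_subgraph m K (br K) u w"
    and "\<And>j. j < m \<Longrightarrow> good_color K j \<noteq> Red \<Longrightarrow> good_color K' j \<noteq> Red"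
    and "\<And>i. i < m \<Longrightarrow> buyer_color K i = Green \<Longrightarrow> buyer_color K' i = Green"
    and "\<And>i. i < m \<Longrightarrow> buyer_color K i \<noteq> Red \<Longrightarrow> buyer_color K' i \<noteq> Red"
    and "\<And>j i. j < m \<Longrightarrow> i < m \<Longrightarrow> good_color K j \<noteq> Red \<Longrightarrow> edge_color K j i \<noteq> None \<Longrightarrow>
      edge_color K' j i = edge_color K j i"
  shows "in_gb_subgraph m K' (br K') u w"
  using assms by (cases u; cases w) (auto simp: in_gb_subgraph_br)

lemma reached_mono:
  assumes "w \<in> reached m arc S" and "\<And>u w. arc u w \<Longrightarrow> arc' u w" and "S \<subseteq> S'"
  shows "w \<in> reached m arc' S'"
  using assms reach_mono[of m arc _ w arc'] unfolding reached_def by blast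

lemma reached_start: "u \<in> S \<Longrightarrow> u \<in> reached m arc S"
  unfolding reached_def using reach_refl by blast

lemma reached_step:
  "u \<in> reached m arc S \<Longrightarrow> arc u w \<Longrightarrow> u \<in> set (vertices m) \<Longrightarrow> w \<in> set (vertices m) \<Longrightarrow> w \<in> reached m arc S"
  unfolding reached_def using reach_step by blast

lemma anchored_update_edges:
  assumes "anchored m K"
    and "good_color K' = good_color K" "buyer_color K' = buyer_color K" "edge_color K' = updated_edge m E A K"
  shows "anchored m K'"
  unfolding anchored_def
proof (intro allI impI)
  fix j assume "j < m" "good_color K' j = Green"
  then have "Good j \<in> reached m (in_gb_subgraph m K (br K)) (Good ` goods m K {Blue})"
    using assms(1,2) by (simp add: anchored_def)
  then show "Good j \<in> reached m (in_gb_subgraph m K' (br K')) (Good ` goods m K' {Blue})"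
    by (rule reached_mono, elim in_gb_subgraph_mono) (use assms(2-4) in \<open>auto simp: updated_edge_def goods_def\<close>)
qed

text \<open>A new green good is br-reached from an old one by a path whose buyers have all become
  green and whose goods are green or blue; it continues the path from a blue good to the old
  one.\<close>

lemma anchored_extend_green:
  assumes "anchored m K"
    and K': "edge_color K' = edge_color K \<and> (\<forall>u. vertex_color K' u = (if u \<in> set (vertices m) \<and>
      (u \<in> reached m (br K) (Good ` goods m K {Green}) \<and> u \<notin> Good ` goods m K {Blue}) then Green else vertex_color K u))"
  shows "anchored m K'"
  unfolding anchored_def
proof (intro allI impI)
  let ?R = "reached m (br K) (Good ` goods m K {Green})"
  let ?B = "reached m (in_gb_subgraph m K' (br K')) (Good ` goods m K' {Blue})"
  have good: "good_color K' j = (if j < m \<and> Good j \<in> ?R \<and> good_color K j \<noteq> Blue then Green else good_color K j)" for j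
    using K'[THEN conjunct2, rule_format, of "Good j"] by (auto simp: goods_def)
  have buyer: "buyer_color K' i = (if i < m \<and> Buyer i \<in> ?R then Green else buyer_color K i)" for i
    using K'[THEN conjunct2, rule_format, of "Buyer i"] by auto
  have old: "Good j \<in> ?B" if "j < m" "good_color K j = Green" for j
  proof -
    have "Good j \<in> reached m (in_gb_subgraph m K (br K)) (Good ` goods m K {Blue})"
      using assms(1) that by (simp add: anchored_def)
    then show ?thesis
      by (rule reached_mono, elim in_gb_subgraph_mono) (auto simp: good buyer K' goods_def)
  qed
  fix j assume j: "j < m" "good_color K' j = Green"
  show "Good j \<in> ?B"
  proof (cases "good_color K j = Green")
    case False
    then have "Good j \<in> ?R" using j good[of j] by (auto split: if_splits)
    then obtain g where g: "g < m" "good_color K g = Green" "reach m (br K) (Good g) (Good j)"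
      unfolding reached_def goods_def by auto
    \<comment> \<open>Membership in \<open>?R\<close> is carried along since it is what makes the
      vertices of the path green.\<close>
    from g(3) have "Good j \<in> ?B \<and> Good j \<in> ?R"
    proof (induction rule: reach_induct)
      case refl
      then show ?case using old[OF g(1,2)] g(1,2) by (auto intro!: reached_start simp: goods_def)
    next
      case (step x y)
      have y: "y \<in> ?R" using reached_step[of x m "br K"] step by blast
      have "in_gb_subgraph m K' (br K') x y"
        using step.hyps step.IH y by (cases x; cases y) (auto simp: in_gb_subgraph_br good buyer K')
      then show ?case using y step reached_step[of x m _ _ y] by blast
    qed
    then show ?thesis ..
  qed (use old j in simp)
qed

text \<open>The search admits all goods but only green buyers. It enters a good from a green buyer,
  and by \<open>cut\<close> no such buyer is adjacent to a red good. So it stays among non-red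
  goods, and the vertices it meets keep their colors.\<close>

lemma anchored_retract_green:
  assumes cut: "\<And>j i. j < m \<Longrightarrow> i < m \<Longrightarrow> good_color K j = Red \<Longrightarrow> buyer_color K i = Green \<Longrightarrow> edge_color K j i = None"
    and K': "edge_color K' = edge_color K \<and> (\<forall>u. vertex_color K' u = (if u \<in> set (vertices m) \<and>
      vertex_color K u = Green \<and>
      u \<notin> reached m (in_subgraph {..<m} (buyers m K {Green}) (edges m K) (br K)) (Good ` goods m K {Blue})
      then Red else vertex_color K u))"
  shows "anchored m K'"
  unfolding anchored_def
proof (intro allI impI)
  let ?arc = "in_subgraph {..<m} (buyers m K {Green}) (edges m K) (br K)"
  let ?R = "reached m ?arc (Good ` goods m K {Blue})"
  let ?B = "reached m (in_gb_subgraph m K' (br K')) (Good ` goods m K' {Blue})"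
  have good: "good_color K' j = (if j < m \<and> good_color K j = Green \<and> Good j \<notin> ?R then Red else good_color K j)" for j
    using K'[THEN conjunct2, rule_format, of "Good j"] by auto
  have buyer: "buyer_color K' i = (if i < m \<and> buyer_color K i = Green \<and> Buyer i \<notin> ?R then Red else buyer_color K i)" for i
    using K'[THEN conjunct2, rule_format, of "Buyer i"] by auto
  fix j assume j: "j < m" "good_color K' j = Green"
  then have "Good j \<in> ?R" using good[of j] by (auto split: if_splits)
  then obtain z where z: "z < m" "good_color K z = Blue" "reach m ?arc (Good z) (Good j)"
    unfolding reached_def goods_def by auto
  from z(3) have "Good j \<in> ?B \<and> Good j \<in> ?R \<and> vertex_color K (Good j) \<noteq> Red"
  proof (induction rule: reach_induct)
    case refl
    then show ?case using z(1,2) by (auto intro!: reached_start simp: goods_def good)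
  next
    case (step x y)
    have y: "y \<in> ?R" using reached_step[of x m ?arc] step by blast
    show ?case
    proof (cases x)
      case (Good k)
      then obtain i where i: "y = Buyer i" using step.hyps by (cases y) auto
      then have "buyer_color K i = Green" using step.hyps Good by (auto simp: buyers_def)
      moreover have "in_gb_subgraph m K' (br K') x y"
        using step.hyps step.IH y calculation by (auto simp: Good i in_gb_subgraph_br good buyer K')
      ultimately show ?thesis using y step i reached_step[of x m _ _ y] by auto
    next
      case (Buyer i)
      then obtain k where k: "y = Good k" using step.hyps by (cases y) auto
      have i: "i < m" "edge_color K k i = Some Red" "k < m" using step.hyps Buyer k by auto
      \<comment> \<open>The starts are goods, and every buyer that the search enters is
        green.\<close>
      have "buyer_color K i = Green"
      proof -
        have "x \<in> ?R" using step.IH by blast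
        then obtain z where "z \<in> Good ` goods m K {Blue}" "reach m ?arc z x" unfolding reached_def by blast
        from this(2,1) have "\<forall>i. x = Buyer i \<longrightarrow> buyer_color K i = Green"
        proof (induction rule: reach_induct)
          case (step x y)
          then show ?case by (cases x; cases y) (auto simp: buyers_def)
        qed auto
        then show ?thesis using Buyer by simp
      qed
      then have "good_color K k \<noteq> Red" using cut[of k i] i by auto
      moreover have "in_gb_subgraph m K' (br K') x y"
        using step.IH y i calculation \<open>buyer_color K i = Green\<close> by (auto simp: Buyer k in_gb_subgraph_br good buyer K')
      ultimately show ?thesis using y step k reached_step[of x m _ _ y] by auto
    qed
  qed
  then show "Good j \<in> ?B" by blast
qed

text \<open>The path that anchors the green good lies in the subgraph; viewed in the whole graph it
  can be joined to the path from that good to \<open>a\<close>.\<close>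

lemma anchored_reaches_blue:
  assumes "anchored m K" and "Buyer a \<in> reached m (br K) (Good ` goods m K {Green})"
  shows "\<not> reaches_no_blue m a K"
proof -
  from assms(2) obtain g where g: "g < m" "good_color K g = Green" "reach m (br K) (Good g) (Buyer a)"
    unfolding reached_def goods_def by auto
  then obtain z where z: "z < m" "good_color K z = Blue"
    "reach m (in_gb_subgraph m K (br K)) (Good z) (Good g)"
    using assms(1) unfolding anchored_def reached_def goods_def by blast
  have "reach m (br K) (Good z) (Good g)"
    using z(3) by (rule reach_mono) (auto simp: in_gb_subgraph_def dest: in_subgraph_arc)
  then have "reach m (br K) (Good z) (Buyer a)" using g(3) reach_trans by blast
  then have "reach m (rb K) (Buyer a) (Good z)" by (rule reach_reverse) (simp add: rb_br_reverse)
  then show ?thesis using z unfolding reaches_no_blue_def by blast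
qed

section \<open>Accounting for one update of the coloring\<close>

text \<open>Three ways to pay for a round: a blue buyer lost, anchoring gained, or a cheap round in
  which no good turns red. Only the result tells which one applies, so the time is an
  argument.\<close>

definition coloring_round :: "nat \<Rightarrow> cgraph \<Rightarrow> cgraph \<Rightarrow> nat \<Rightarrow> bool" where
  "coloring_round m K K' t \<longleftrightarrow> coherent K' \<and> loses_blue K K' \<and> t \<le> 800 * (m + 1)^3 \<and>
     (progress m K K' \<or> \<not> anchored m K \<and> anchored m K' \<or>
      t \<le> 100 * (m + 1)^2 \<and> (anchored m K \<longrightarrow> anchored m K') \<and>
      (\<forall>j. good_color K j \<noteq> Red \<longrightarrow> good_color K' j \<noteq> Red))"

text \<open>Without progress both loops hand on \<open>K1\<close> unchanged, and \<open>?Bb\<close>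
  decides. If it is empty, the first loop was empty too and the rest is one painting. If not, all
  searches of the second loop failed, which an anchored input excludes, and the retraction anchors
  the output.\<close>

lemma spec_update_coloring:
  assumes "coherent K0" and A: "\<And>a. a \<in> A \<Longrightarrow> a < m \<and> (\<exists>j<m. good_color K0 j \<noteq> Red \<and> (j, a) \<in> E)"
  shows "spec (update_coloring m E A K0) (search_cells m) (coloring_round m K0)"
  unfolding update_coloring_def
proof (rule spec_bind_runs[OF runs_update_edges])
  let ?b = "200 * (m + 1)^2 + 1"
  have bounds: "1 \<le> (m + 1)^2" "m \<le> (m + 1)^2" "m * m \<le> (m + 1)^2" "m * ?b \<le> 250 * (m + 1)^3"
    "(m + 1)^2 \<le> (m + 1)^3"
    by (simp_all add: power2_eq_square power3_eq_cube algebra_simps)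
  fix K1 :: cgraph
  assume K1: "good_color K1 = good_color K0 \<and> buyer_color K1 = buyer_color K0 \<and>
    edge_color K1 = updated_edge m E A K0"
  have c1: "coherent K1"
    using assms(1) K1 unfolding coherent_def updated_edge_def by auto
  have "loses_blue K0 K1" using K1 by (simp add: loses_blue_def)
  have prog1: "progress m K0 K \<longleftrightarrow> progress m K1 K" for K using K1 by (simp add: progress_def)
  have anch1: "anchored m K0 \<Longrightarrow> anchored m K1" using anchored_update_edges K1 by blast
  let ?New = "filter (\<lambda>i. i \<in> A \<and> buyer_color K1 i = Blue) [0..<m]"
  have new_card: "card (set ?New) \<le> m" and new: "set ?New \<subseteq> {..<m}"
    using card_mono[of "{..<m}" "set ?New"] by auto
  \<comment> \<open>The cost of the loop over the new buyers stays a separate quantity because it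
    vanishes in cheap rounds.\<close>
  define T where "T = card (set ?New) * ?b"
  have T: "T \<le> 250 * (m + 1)^3"
    using mult_le_mono1[OF new_card, of ?b] bounds(4) unfolding T_def by linarith
  show "spec (do {
     New \<leftarrow> select (\<lambda>i. i \<in> A \<and> buyer_color K1 i = Blue) [0..<m];
     K2 \<leftarrow> pick_each (set New) (process_new_buyer m) K1;
     Mg \<leftarrow> select (\<lambda>j. good_color K2 j = Green) [0..<m];
     (R, _, _) \<leftarrow> search BFS m (br K2) {} {} (map Good Mg);
     Bb \<leftarrow> select (\<lambda>i. Buyer i \<in> R \<and> buyer_color K2 i = Blue) [0..<m];
     if Bb = [] then paint m (\<lambda>u. u \<in> R \<and> u \<notin> Good ` goods m K2 {Blue}) Green K2
     else do {
       K3 \<leftarrow> pick_each (set Bb) (process_reached_buyer m) K2;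
       retract_green m {..<m} (edges m K3) K3
     }
   }) (search_cells m) (\<lambda>K' t. \<forall>t'\<le>13 * m * m. coloring_round m K0 K' (t' + t))"
  proof (rule spec_bind_runs[OF runs_select[OF order_refl]], hypsubst, rule spec_bind_runs)
    show "runs (pick_each (set ?New) (process_new_buyer m) K1) (search_cells m) T
       (\<lambda>K2. coherent K2 \<and> loses_blue K1 K2 \<and>
        (progress m K1 K2 \<or> K2 = K1 \<and> (\<forall>a\<in>set ?New. no_blue_neighbor m a K1)))"
      unfolding T_def by (rule runs_pick_each_settles[OF c1 new _ runs_process_new_buyer]) auto
    fix K2 :: cgraph
    assume K2: "coherent K2 \<and> loses_blue K1 K2 \<and>
        (progress m K1 K2 \<or> K2 = K1 \<and> (\<forall>a\<in>set ?New. no_blue_neighbor m a K1))"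
    let ?Mg = "filter (\<lambda>j. good_color K2 j = Green) [0..<m]"
    have starts: "set (map Good ?Mg) \<subseteq> set (vertices m)" "length (map Good ?Mg) \<le> m"
      and set_Mg: "set (map Good ?Mg) = Good ` goods m K2 {Green}"
      using length_filter_le[of _ "[0..<m]"] by (auto simp: goods_def)
    let ?R = "reached m (br K2) (Good ` goods m K2 {Green})"
    let ?Bb = "filter (\<lambda>i. Buyer i \<in> ?R \<and> buyer_color K2 i = Blue) [0..<m]"
    have lb2: "loses_blue K0 K2" using K1 K2 by (simp add: loses_blue_def)
    \<comment> \<open>An unserved new buyer \<open>a\<close> has no blue neighbor, so its non-red
      neighbor is green. The edge between them is blue since \<open>a\<close> is, hence the BFS from
      the green goods reaches \<open>a\<close>, contrary to \<open>?Bb = []\<close>.\<close>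
    have light: "T = 0" if "?Bb = []" "\<not> progress m K0 K2"
    proof -
      have K21: "K2 = K1" "\<forall>a\<in>set ?New. no_blue_neighbor m a K1" using K2 that(2) prog1 by auto
      have "a \<notin> set ?New" for a
      proof
        assume a: "a \<in> set ?New"
        then obtain j where j: "j < m" "good_color K1 j \<noteq> Red" "(j, a) \<in> E" and "a < m" "a \<in> A"
          "buyer_color K1 a = Blue" using A K1 by auto
        then have edge: "edge_color K1 j a \<noteq> None" using K1 by (auto simp: updated_edge_def)
        then have "good_color K1 j = Green"
          using K21(2) a j by (cases "good_color K1 j") (auto simp: no_blue_neighbor_def)
        moreover have "edge_color K1 j a = Some Blue"
          using edge c1 \<open>buyer_color K1 a = Blue\<close> unfolding coherent_def by (metis color.exhaust not_None_eq)
        ultimately have "Buyer a \<in> ?R"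
          using j \<open>a < m\<close> K21(1) by (intro reached_step[OF reached_start[of "Good j"]]) (auto simp: goods_def)
        then show False using that(1) \<open>a < m\<close> \<open>buyer_color K1 a = Blue\<close> K21(1) by (auto simp: filter_empty_conv)
      qed
      then have "set ?New = {}" by (metis equals0I)
      then show ?thesis unfolding T_def by simp
    qed
    have grow: "runs (paint m (\<lambda>u. u \<in> ?R \<and> u \<notin> Good ` goods m K2 {Blue}) Green K2) (search_cells m) (18 * m)
      (\<lambda>K'. coherent K' \<and> loses_blue K0 K' \<and> (progress m K0 K' \<or>
        T = 0 \<and> (anchored m K0 \<longrightarrow> anchored m K') \<and> (\<forall>j. good_color K0 j \<noteq> Red \<longrightarrow> good_color K' j \<noteq> Red)))"
      if "?Bb = []"
      using runs_paint[OF order_refl]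
    proof (rule runs_mono)
      fix K'
      assume K': "edge_color K' = edge_color K2 \<and> (\<forall>u. vertex_color K' u =
        (if u \<in> set (vertices m) \<and> (u \<in> ?R \<and> u \<notin> Good ` goods m K2 {Blue}) then Green else vertex_color K2 u))"
      have c: "coherent K'" "loses_blue K2 K'" using coherent_paint[OF K'] K2 by auto
      have "progress m K0 K'" if "progress m K0 K2" using progress_trans(1)[OF that c(2)] .
      moreover have "T = 0 \<and> (anchored m K0 \<longrightarrow> anchored m K') \<and>
        (\<forall>j. good_color K0 j \<noteq> Red \<longrightarrow> good_color K' j \<noteq> Red)" if no: "\<not> progress m K0 K2"
      proof -
        have "K2 = K1" using K2 no prog1 by auto
        have "good_color K' j \<noteq> Red" if "good_color K0 j \<noteq> Red" for j
          using K'[THEN conjunct2, rule_format, of "Good j"] that \<open>K2 = K1\<close> K1 by auto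
        moreover have "anchored m K'" if "anchored m K0"
          using anchored_extend_green[OF _ K'] anch1[OF that] \<open>K2 = K1\<close> by simp
        ultimately show ?thesis using light[OF \<open>?Bb = []\<close> no] by blast
      qed
      ultimately show "coherent K' \<and> loses_blue K0 K' \<and> (progress m K0 K' \<or>
        T = 0 \<and> (anchored m K0 \<longrightarrow> anchored m K') \<and> (\<forall>j. good_color K0 j \<noteq> Red \<longrightarrow> good_color K' j \<noteq> Red))"
        using c loses_blue_trans[OF lb2 c(2)] by blast
    qed auto
    have bb_card: "card (set ?Bb) \<le> m" and bb: "set ?Bb \<subseteq> {..<m}"
      using card_mono[of "{..<m}" "set ?Bb"] by auto
    have retract: "runs (do {
       K3 \<leftarrow> pick_each (set ?Bb) (process_reached_buyer m) K2;
       retract_green m {..<m} (edges m K3) K3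
     }) (search_cells m) (card (set ?Bb) * ?b + 70 * (m + 1)^2)
      (\<lambda>K'. coherent K' \<and> loses_blue K0 K' \<and> (progress m K0 K' \<or> \<not> anchored m K0 \<and> anchored m K'))"
      if "?Bb \<noteq> []"
    proof (rule runs_bind[OF runs_pick_each_settles[OF _ bb _ runs_process_reached_buyer] _ order_refl])
      fix K3 :: cgraph
      assume K3: "coherent K3 \<and> loses_blue K2 K3 \<and>
        (progress m K2 K3 \<or> K3 = K2 \<and> (\<forall>a\<in>set ?Bb. reaches_no_blue m a K2))"
      have "runs (retract_green m {..<m} (edges m K3) K3) (search_cells m) (70 * (m + 1)^2)
        (\<lambda>K'. (coherent K' \<and> loses_blue K3 K') \<and> edge_color K' = edge_color K3 \<and>
         (\<forall>u. vertex_color K' u = (if u \<in> set (vertices m) \<and> vertex_color K3 u = Green \<and>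
           u \<notin> reached m (in_subgraph {..<m} (buyers m K3 {Green}) (edges m K3) (br K3)) (Good ` goods m K3 {Blue})
           then Red else vertex_color K3 u)))"
        using K3 by (intro runs_conj[OF runs_retract_green_coherent runs_retract_green]) auto
      then show "runs (retract_green m {..<m} (edges m K3) K3) (search_cells m) (70 * (m + 1)^2)
        (\<lambda>K'. coherent K' \<and> loses_blue K0 K' \<and> (progress m K0 K' \<or> \<not> anchored m K0 \<and> anchored m K'))"
      proof (rule runs_mono)
        fix K'
        assume K': "(coherent K' \<and> loses_blue K3 K') \<and> edge_color K' = edge_color K3 \<and>
         (\<forall>u. vertex_color K' u = (if u \<in> set (vertices m) \<and> vertex_color K3 u = Green \<and>
           u \<notin> reached m (in_subgraph {..<m} (buyers m K3 {Green}) (edges m K3) (br K3)) (Good ` goods m K3 {Blue})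
           then Red else vertex_color K3 u))"
        have lb: "loses_blue K0 K3" "loses_blue K2 K'" "loses_blue K0 K'"
          using lb2 K3 K' loses_blue_trans by blast+
        consider "progress m K0 K2" | "progress m K2 K3"
          | "K2 = K1" "K3 = K2" "\<forall>a\<in>set ?Bb. reaches_no_blue m a K2" "\<not> progress m K0 K2"
          using K2 K3 prog1 by blast
        then have "progress m K0 K' \<or> \<not> anchored m K0 \<and> anchored m K'"
        proof cases
          case 1
          then show ?thesis using progress_trans(1) lb(2) by blast
        next
          case 2
          then have "progress m K0 K3" using progress_trans(2) lb2 by blast
          then show ?thesis using progress_trans(1) K' by blast
        next
          case 3
          obtain a where a: "a \<in> set ?Bb" using \<open>?Bb \<noteq> []\<close> by (metis last_in_set)
          have "\<not> anchored m K0"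
            using anchored_reaches_blue[of m K2 a] 3(1,3) a anch1 by auto
          moreover have "anchored m K'"
          proof (rule anchored_retract_green[OF _ K'[THEN conjunct2]])
            \<comment> \<open>Here \<open>K3 = K1\<close>: the edge update has just cut these edges,
              and no vertex has changed color since.\<close>
            show "edge_color K3 j i = None"
              if "j < m" "i < m" "good_color K3 j = Red" "buyer_color K3 i = Green" for j i
              using that 3(1,2) K1 by (simp add: updated_edge_def)
          qed
          ultimately show ?thesis by blast
        qed
        then show "coherent K' \<and> loses_blue K0 K' \<and> (progress m K0 K' \<or> \<not> anchored m K0 \<and> anchored m K')"
          using K' lb(3) by blast
      qed auto
    qed (use K2 in auto)
    have bb_time: "card (set ?Bb) * ?b \<le> 250 * (m + 1)^3"
      using mult_le_mono1[OF bb_card, of ?b] bounds(4) by linarith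
    have finish: "runs (if ?Bb = [] then paint m (\<lambda>u. u \<in> ?R \<and> u \<notin> Good ` goods m K2 {Blue}) Green K2
     else do {
       K3 \<leftarrow> pick_each (set ?Bb) (process_reached_buyer m) K2;
       retract_green m {..<m} (edges m K3) K3
     }) (search_cells m) (if ?Bb = [] then 18 * m else 320 * (m + 1)^3)
     (\<lambda>K'. coherent K' \<and> loses_blue K0 K' \<and> (progress m K0 K' \<or> \<not> anchored m K0 \<and> anchored m K' \<or>
       ?Bb = [] \<and> T = 0 \<and> (anchored m K0 \<longrightarrow> anchored m K') \<and>
       (\<forall>j. good_color K0 j \<noteq> Red \<longrightarrow> good_color K' j \<noteq> Red)))"
    proof (cases "?Bb = []")
      case True
      show ?thesis unfolding if_P[OF True]
        by (rule runs_mono[OF grow[OF True]]) (use True in auto)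
    next
      case False
      show ?thesis unfolding if_not_P[OF False]
        by (rule runs_mono[OF retract[OF False]], rule order_refl, use bb_time bounds in linarith, blast)
    qed
    have search: "runs (do {
     (R, _, _) \<leftarrow> search BFS m (br K2) {} {} (map Good ?Mg);
     Bb \<leftarrow> select (\<lambda>i. Buyer i \<in> R \<and> buyer_color K2 i = Blue) [0..<m];
     if Bb = [] then paint m (\<lambda>u. u \<in> R \<and> u \<notin> Good ` goods m K2 {Blue}) Green K2
     else do {
       K3 \<leftarrow> pick_each (set Bb) (process_reached_buyer m) K2;
       retract_green m {..<m} (edges m K3) K3
     }
   }) (search_cells m) (40 * (m + 1)^2 + (8 * m + (if ?Bb = [] then 18 * m else 320 * (m + 1)^3)))
     (\<lambda>K'. coherent K' \<and> loses_blue K0 K' \<and> (progress m K0 K' \<or> \<not> anchored m K0 \<and> anchored m K' \<or>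
       ?Bb = [] \<and> T = 0 \<and> (anchored m K0 \<longrightarrow> anchored m K') \<and>
       (\<forall>j. good_color K0 j \<noteq> Red \<longrightarrow> good_color K' j \<noteq> Red)))"
    proof (rule runs_bind_search[OF starts _ order_refl])
      fix R and "end" :: "vertex option"
      assume R: "bipartite (br K2) \<Longrightarrow> {} = {} \<Longrightarrow> end = None \<Longrightarrow> R = reached m (br K2) (set (map Good ?Mg))"
        and "\<And>w. end = Some w \<Longrightarrow> w \<in> {}"
      then have "end = None" by (cases "end") auto
      with R have R: "R = ?R" using set_Mg by (simp add: bipartite_arcs)
      show "runs (do {
     Bb \<leftarrow> select (\<lambda>i. Buyer i \<in> R \<and> buyer_color K2 i = Blue) [0..<m];
     if Bb = [] then paint m (\<lambda>u. u \<in> R \<and> u \<notin> Good ` goods m K2 {Blue}) Green K2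
     else do {
       K3 \<leftarrow> pick_each (set Bb) (process_reached_buyer m) K2;
       retract_green m {..<m} (edges m K3) K3
     }
   }) (search_cells m) (8 * m + (if ?Bb = [] then 18 * m else 320 * (m + 1)^3))
     (\<lambda>K'. coherent K' \<and> loses_blue K0 K' \<and> (progress m K0 K' \<or> \<not> anchored m K0 \<and> anchored m K' \<or>
       ?Bb = [] \<and> T = 0 \<and> (anchored m K0 \<longrightarrow> anchored m K') \<and>
       (\<forall>j. good_color K0 j \<noteq> Red \<longrightarrow> good_color K' j \<noteq> Red)))"
        unfolding R by (rule runs_bind[OF runs_select[OF order_refl]], hypsubst, rule finish) simp
    qed
    show "spec (do {
     Mg \<leftarrow> select (\<lambda>j. good_color K2 j = Green) [0..<m];
     (R, _, _) \<leftarrow> search BFS m (br K2) {} {} (map Good Mg);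
     Bb \<leftarrow> select (\<lambda>i. Buyer i \<in> R \<and> buyer_color K2 i = Blue) [0..<m];
     if Bb = [] then paint m (\<lambda>u. u \<in> R \<and> u \<notin> Good ` goods m K2 {Blue}) Green K2
     else do {
       K3 \<leftarrow> pick_each (set Bb) (process_reached_buyer m) K2;
       retract_green m {..<m} (edges m K3) K3
     }
   }) (search_cells m) (\<lambda>K' t. \<forall>t'\<le>T. \<forall>t''\<le>8 * length [0..<m]. \<forall>t'''\<le>13 * m * m.
       coloring_round m K0 K' (t''' + (t'' + (t' + t))))"
    proof (rule spec_bind_runs[OF runs_select[OF order_refl]], hypsubst, rule spec_mono[OF search[unfolded runs_def]])
      fix K' t
      assume *: "(coherent K' \<and> loses_blue K0 K' \<and> (progress m K0 K' \<or> \<not> anchored m K0 \<and> anchored m K' \<or>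
       ?Bb = [] \<and> T = 0 \<and> (anchored m K0 \<longrightarrow> anchored m K') \<and>
       (\<forall>j. good_color K0 j \<noteq> Red \<longrightarrow> good_color K' j \<noteq> Red))) \<and>
       t \<le> 40 * (m + 1)^2 + (8 * m + (if ?Bb = [] then 18 * m else 320 * (m + 1)^3))"
      show "\<forall>s\<le>8 * length [0..<m]. \<forall>t'\<le>T. \<forall>t''\<le>8 * length [0..<m]. \<forall>t'''\<le>13 * m * m.
        coloring_round m K0 K' (t''' + (t'' + (t' + (s + t))))"
      proof (intro allI impI)
        fix s t' t'' t'''
        assume times: "s \<le> 8 * length [0..<m]" "t' \<le> T" "t'' \<le> 8 * length [0..<m]" "t''' \<le> 13 * m * m"
        let ?t = "t''' + (t'' + (t' + (s + t)))"
        have len: "length [0..<m] = m" by simp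
        have mm: "13 * m * m \<le> 13 * (m + 1)^2" using bounds(3) by (simp add: mult.assoc)
        \<comment> \<open>The two loops account for at most 250 units of \<open>(m + 1)^3\<close>
          each; searches, selections and paintings are of lower order.\<close>
        have heavy: "?t \<le> 800 * (m + 1)^3"
          using * times T bounds mm unfolding len by (auto split: if_splits)
        have "?t \<le> 100 * (m + 1)^2" if "?Bb = []" "T = 0"
        proof -
          have "t \<le> 40 * (m + 1)^2 + (8 * m + 18 * m)" using *[THEN conjunct2] unfolding if_P[OF that(1)] .
          then show ?thesis using times bounds mm that(2) unfolding len by linarith
        qed
        then show "coloring_round m K0 K' ?t" using * heavy unfolding coloring_round_def by blast
      qed
    qed simp
  qed
qed

section \<open>Rounds of the auction\<close>

lemma in_preference_graph:
  "(j, i) \<in> preference_graph m v P \<longleftrightarrow>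
     i < m \<and> j < m \<and> 0 \<le> v i j - P j \<and> (\<forall>k<m. v i k - P k \<le> v i j - P j)"
proof -
  have "v i j - P j = best_utility m v P i \<longleftrightarrow> 0 \<le> v i j - P j \<and> (\<forall>k<m. v i k - P k \<le> v i j - P j)"
    if "j < m"
  proof -
    have "best_utility m v P i = v i j - P j \<longleftrightarrow>
        v i j - P j \<in> insert 0 ((\<lambda>j. v i j - P j) ` {..<m}) \<and>
        (\<forall>x\<in>insert 0 ((\<lambda>j. v i j - P j) ` {..<m}). x \<le> v i j - P j)"
      unfolding best_utility_def by (rule Max_eq_iff) auto
    then show ?thesis using that by auto
  qed
  then show ?thesis unfolding preference_graph_def preferred_def by auto
qed

lemma neighbors_mono: "S \<subseteq> S' \<Longrightarrow> neighbors E S \<subseteq> neighbors E S'"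
  unfolding neighbors_def by blast

lemma neighbors_preference_graph: "neighbors (preference_graph m v P) S \<subseteq> {..<m}"
  by (auto simp: neighbors_def in_preference_graph)

text \<open>For a buyer outside N(S) every good of \<open>S\<close> is strictly worse than the best
  alternative, so the cut is positive. Former neighbors stay because all goods of \<open>S\<close>
  become cheaper by the same amount. The buyer attaining the minimum becomes indifferent and
  joins.\<close>

lemma neighbors_grow:
  assumes S: "S \<subseteq> {..<m}" "S \<noteq> {}"
    and outside: "{..<m} - neighbors (preference_graph m v P) S \<noteq> {}"
  defines "P' \<equiv> \<lambda>j. if j \<in> S then P j - price_cut m v P (preference_graph m v P) S else P j"
  shows "neighbors (preference_graph m v P) S \<subset> neighbors (preference_graph m v P') S"
proof -
  let ?E = "preference_graph m v P"
  define b where "b = (\<lambda>i. Max (insert 0 ((\<lambda>k. v i k - P k) ` ({..<m} - S))))"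
  define C where "C = {b i - (v i l - P l) | i l. i \<in> {..<m} - neighbors ?E S \<and> l \<in> S}"
  define d where "d = price_cut m v P ?E S"
  have d: "d = Min C" unfolding d_def price_cut_def C_def b_def ..
  have fin: "finite S" using S(1) finite_subset by blast
  have "C = (\<lambda>(i, l). b i - (v i l - P l)) ` (({..<m} - neighbors ?E S) \<times> S)" unfolding C_def by auto
  then have C: "finite C" "C \<noteq> {}" using fin S(2) outside by auto
  have b: "0 \<le> b i" "k < m \<Longrightarrow> k \<notin> S \<Longrightarrow> v i k - P k \<le> b i" for i k
    unfolding b_def by (auto intro!: Max_ge)
  have below: "v i l - P l < b i" if "i \<in> {..<m} - neighbors ?E S" "l \<in> S" for i l
  proof (rule ccontr)
    assume "\<not> v i l - P l < b i"
    \<comment> \<open>The given \<open>l\<close> need not be preferred itself; a best good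
      \<open>l'\<close> of \<open>S\<close> is, and it makes the buyer a neighbor.\<close>
    let ?f = "\<lambda>k. v i k - P k"
    have "Max (?f ` S) \<in> ?f ` S" using fin S(2) by (intro Max_in) auto
    then obtain l' where l'_max: "l' \<in> S" "Max (?f ` S) = ?f l'" by auto
    have l': "?f k \<le> ?f l'" if "k \<in> S" for k
      using l'_max Max_ge[of "?f ` S" "?f k"] fin that by simp
    have "b i \<le> ?f l'" using l'[OF that(2)] \<open>\<not> v i l - P l < b i\<close> by linarith
    moreover have "?f k \<le> ?f l'" if "k < m" for k
      using l'[of k] b(2)[OF that, of i] \<open>b i \<le> ?f l'\<close> by (cases "k \<in> S") auto
    ultimately have "(l', i) \<in> ?E"
      using l'_max(1) b(1)[of i] that(1) S(1) unfolding in_preference_graph by auto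
    then show False using that(1) l'_max(1) unfolding neighbors_def by blast
  qed
  from Min_in[OF C] obtain i0 l0 where i0: "i0 \<in> {..<m} - neighbors ?E S" "l0 \<in> S" "d = b i0 - (v i0 l0 - P l0)"
    unfolding d C_def by blast
  then have "0 < d" using below[OF i0(1,2)] by linarith
  have d_le: "d \<le> b i - (v i l - P l)" if "i \<in> {..<m} - neighbors ?E S" "l \<in> S" for i l
    unfolding d using C that by (intro Min_le) (auto simp: C_def)
  have P': "P' j = (if j \<in> S then P j - d else P j)" for j unfolding P'_def d_def ..
  have "i \<in> neighbors (preference_graph m v P') S" if "i \<in> neighbors ?E S" for i
  proof -
    from that obtain l where l: "l \<in> S" "(l, i) \<in> ?E" unfolding neighbors_def by blast
    have "v i k - P' k \<le> v i l - P' l" if "k < m" for k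
      using l that \<open>0 < d\<close> unfolding in_preference_graph P' by (auto dest!: spec[of _ k])
    then have "(l, i) \<in> preference_graph m v P'"
      using l \<open>0 < d\<close> unfolding in_preference_graph[of l i m v P'] by (auto simp: in_preference_graph P')
    then show ?thesis using l(1) unfolding neighbors_def by blast
  qed
  moreover have "(l0, i0) \<in> preference_graph m v P'"
  proof -
    have "v i0 l0 - P' l0 = b i0" using i0 unfolding P' by simp
    moreover have "v i0 k - P' k \<le> b i0" if "k < m" for k
      using b(2)[OF that, of i0] d_le[OF i0(1), of k] unfolding P' by auto
    ultimately show ?thesis using i0(1,2) S(1) b(1) unfolding in_preference_graph by auto
  qed
  ultimately show ?thesis using i0(1,2) unfolding neighbors_def by blast
qed

section \<open>Costs of the market computations\<close>

lemma runs_initial_prices: "runs (initial_prices m v) n (m * (3 * m + 2)) (\<lambda>_. True)"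
  unfolding initial_prices_def
proof (rule runs_for_each_time[where T = "3 * m + 1"])
  fix j P
  show "runs (do {
       p \<leftarrow> for_each [0..<m] (\<lambda>i p. do { tick 2; ret (max p (v i j)) }) (v 0 j);
       tick 1;
       ret (P(j := p))
     }) n (3 * m + 1) (\<lambda>_. True)"
    by (rule runs_bind[OF runs_for_each_time[where T = 2 and T' = "3 * m"]])
      (auto intro!: runs_tick[where T = 0] runs_ret)
qed simp

lemma runs_construct_graph:
  "runs (construct_graph m v P) n (m * (8 * m + 1)) (\<lambda>E. E = preference_graph m v P)"
proof -
  have "runs (construct_graph m v P) n (m * (8 * m + 1)) (\<lambda>_. True)"
    unfolding construct_graph_def
  proof (rule runs_for_each_time[where T = "8 * m"])
    fix i E
    show "runs (do {
         u \<leftarrow> for_each [0..<m] (\<lambda>j u. do { tick 3; ret (max u (v i j - P j)) }) 0;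
         for_each [0..<m] (\<lambda>j E. do {
           tick 3;
           ret (if v i j - P j = u then insert (j, i) E else E)
         }) E
       }) n (8 * m) (\<lambda>_. True)"
      by (rule runs_bind[OF runs_for_each_time[where T = 3 and T' = "4 * m"]
            runs_for_each_time[where T = 3 and T' = "4 * m"]])
        (auto intro!: runs_tick[where T = 0] runs_ret)
  qed simp
  from runs_conj_result[OF this construct_graph_result] show ?thesis by simp
qed

lemma runs_find_neighbors:
  assumes "E \<subseteq> {..<m} \<times> {..<m}"
  shows "runs (find_neighbors m E S) n (m * (5 * m + 3)) (\<lambda>N. N = neighbors E S)"
proof -
  have "runs (find_neighbors m E S) n (m * (5 * m + 3)) (\<lambda>_. True)"
    unfolding find_neighbors_def
  proof (rule runs_for_each_time[where T = "5 * m + 2"])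
    fix i N
    show "runs (do {
         b \<leftarrow> for_each [0..<m] (\<lambda>j b. do { tick 4; ret (b \<or> (j \<in> S \<and> (j, i) \<in> E)) }) False;
         tick 2;
         ret (if b then insert i N else N)
       }) n (5 * m + 2) (\<lambda>_. True)"
      by (rule runs_bind[OF runs_for_each_time[where T = 4 and T' = "5 * m"]])
        (auto intro!: runs_tick[where T = 0] runs_ret)
  qed (simp add: algebra_simps)
  from runs_conj_result[OF this find_neighbors_result] assms show ?thesis by (auto elim: runs_mono)
qed

lemma runs_reduce_prices:
  assumes "S \<subseteq> {..<m}" "S \<noteq> {}" "{..<m} - neighbors E S \<noteq> {}"
  shows "runs (reduce_prices m v P (neighbors E S) S) n (m * (12 * m + 2) + 5 * m)
    (\<lambda>P'. P' = (\<lambda>j. if j \<in> S then P j - price_cut m v P E S else P j))"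
proof -
  have "runs (find_price_cut m v P N S) n (m * (12 * m + 2)) (\<lambda>_. True)" for N
    unfolding find_price_cut_def
  proof (rule runs_for_each_time[where T = "12 * m + 1"])
    fix i d
    have "runs (do {
         b \<leftarrow> for_each [0..<m] (\<lambda>k b. do {
           tick 4;
           ret (if k \<in> S then b else max b (v i k - P k))
         }) 0;
         for_each [0..<m] (\<lambda>l d. do {
           tick 6;
           ret (if l \<in> S
                then (case d of None \<Rightarrow> Some (b - (v i l - P l))
                      | Some e \<Rightarrow> Some (min e (b - (v i l - P l))))
                else d)
         }) d
       }) n (12 * m) (\<lambda>_. True)"
      by (rule runs_bind[OF runs_for_each_time[where T = 4 and T' = "5 * m"]
            runs_for_each_time[where T = 6 and T' = "7 * m"]])
        (auto intro!: runs_tick[where T = 0] runs_ret)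
    then show "runs (do {
       tick 1;
       if i \<in> N then ret d
       else do {
         b \<leftarrow> for_each [0..<m] (\<lambda>k b. do {
           tick 4;
           ret (if k \<in> S then b else max b (v i k - P k))
         }) 0;
         for_each [0..<m] (\<lambda>l d. do {
           tick 6;
           ret (if l \<in> S
                then (case d of None \<Rightarrow> Some (b - (v i l - P l))
                      | Some e \<Rightarrow> Some (min e (b - (v i l - P l))))
                else d)
         }) d
       }
     }) n (12 * m + 1) (\<lambda>_. True)"
      by (auto intro!: runs_tick[where T = "12 * m"] runs_ret)
  qed simp
  then have "runs (reduce_prices m v P (neighbors E S) S) n (m * (12 * m + 2) + 5 * m) (\<lambda>_. True)"
    unfolding reduce_prices_def
  proof (rule runs_bind)
    show "runs (case d of
       None \<Rightarrow> ret P
     | Some e \<Rightarrow> for_each [0..<m] (\<lambda>j P'. do {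
         tick 4;
         ret (if j \<in> S then P'(j := P j - e) else P')
       }) P) n (5 * m) (\<lambda>_. True)" for d
      by (cases d) (auto intro!: runs_ret runs_tick[where T = 0] runs_for_each_time[where T = 4])
  qed simp
  from runs_conj_result[OF this reduce_prices_result] assms show ?thesis by (auto elim: runs_mono)
qed

section \<open>One round of the auction\<close>

definition found_goods :: "nat \<Rightarrow> cgraph \<Rightarrow> nat set" where
  "found_goods m K = goods m K {Green, Blue}"

lemma found_goods_iff: "j \<in> found_goods m K \<longleftrightarrow> j < m \<and> good_color K j \<noteq> Red"
  unfolding found_goods_def goods_def by (cases "good_color K j") auto

text \<open>Growth compares the neighbors of the same old set in the old and the new graph; it
  carries over to the new set when no good turns red.\<close>

fun auction_step :: "nat \<Rightarrow> valuation \<Rightarrow> graph \<Rightarrow> cgraph \<Rightarrow> config \<Rightarrow> nat \<Rightarrow> bool" where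
  "auction_step m v E K (Returned _) t \<longleftrightarrow> t \<le> 150 * (m + 1)^2"
| "auction_step m v E K (Running P' E' K') t \<longleftrightarrow> E' = preference_graph m v P' \<and>
     neighbors E (found_goods m K) \<subset> neighbors E' (found_goods m K) \<and>
     (\<exists>t'. coloring_round m K K' t' \<and> t \<le> t' + 150 * (m + 1)^2)"

text \<open>The loop test supplies what a positive cut requires: \<open>?S\<close> is non-empty, and
  having fewer neighbors than its at most \<open>m\<close> goods it leaves some buyer
  outside.\<close>

lemma spec_auction_round:
  assumes E: "E = preference_graph m v P" and "coherent K"
  shows "spec (auction_round m v P E K) (search_cells m + main_cells m) (auction_step m v E K)"
  unfolding auction_round_def Let_def
proof (rule spec_with_cells, rule spec_bind_runs[OF runs_select[OF order_refl]])
  have sub: "preference_graph m v Q \<subseteq> {..<m} \<times> {..<m}" for Q by (auto simp: in_preference_graph)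
  let ?S = "found_goods m K"
  let ?N = "neighbors E ?S"
  fix Sl assume Sl: "Sl = filter (\<lambda>j. good_color K j \<in> {Green, Blue}) [0..<m]"
  have set_Sl: "set Sl = ?S" unfolding Sl found_goods_def goods_def by auto
  have card_S: "length Sl = card ?S" using set_Sl Sl distinct_card[of Sl] by simp
  have S_sub: "?S \<subseteq> {..<m}" by (auto simp: found_goods_iff)
  let ?loop = "\<lambda>N Nl. if length Sl > length Nl then do {
       P' \<leftarrow> reduce_prices m v P N ?S;
       E' \<leftarrow> construct_graph m v P';
       N' \<leftarrow> find_neighbors m E' ?S;
       A \<leftarrow> select (\<lambda>i. i \<in> N' \<and> i \<notin> N) [0..<m];
       K' \<leftarrow> procedure_U m E' (set A) (Some K);
       ret (Running P' E' K')
     }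
     else ret (Returned P)"
  show "spec (do {
     N \<leftarrow> find_neighbors m E (set Sl);
     Nl \<leftarrow> select (\<lambda>i. i \<in> N) [0..<m];
     tick 1;
     if length Sl > length Nl then do {
       P' \<leftarrow> reduce_prices m v P N (set Sl);
       E' \<leftarrow> construct_graph m v P';
       N' \<leftarrow> find_neighbors m E' (set Sl);
       A \<leftarrow> select (\<lambda>i. i \<in> N' \<and> i \<notin> N) [0..<m];
       K' \<leftarrow> procedure_U m E' (set A) (Some K);
       ret (Running P' E' K')
     }
     else ret (Returned P)
   }) (search_cells m) (\<lambda>c t. \<forall>t'\<le>8 * length [0..<m]. auction_step m v E K c (t' + t))"
    unfolding set_Sl
  proof (rule spec_bind_runs[OF runs_find_neighbors], simp add: E sub, hypsubst,
      rule spec_bind_runs[OF runs_select[OF order_refl]], rule spec_tick)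
    fix Nl assume Nl: "Nl = filter (\<lambda>i. i \<in> ?N) [0..<m]"
    have N_sub: "?N \<subseteq> {..<m}" unfolding E by (rule neighbors_preference_graph)
    then have "set Nl = ?N" unfolding Nl by auto
    then have card_N: "length Nl = card ?N" using Nl distinct_card[of Nl] by simp
    let ?goal = "\<lambda>c t. \<forall>t1\<le>8 * length [0..<m]. \<forall>t2\<le>m * (5 * m + 3). \<forall>t3\<le>8 * length [0..<m].
      auction_step m v E K c (t3 + (t2 + (t1 + (1 + t))))"
    have len: "length [0..<m] = m" by simp
    have bounds: "1 \<le> (m + 1)^2" "m \<le> (m + 1)^2" "m * (5 * m + 3) \<le> 8 * (m + 1)^2"
      "m * (12 * m + 2) + 5 * m \<le> 20 * (m + 1)^2" "m * (8 * m + 1) \<le> 10 * (m + 1)^2"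
      by (simp_all add: power2_eq_square algebra_simps)
    show "spec (?loop ?N Nl) (search_cells m) ?goal"
    proof (cases "length Sl > length Nl")
      case False
      have "?goal (Returned P) 0" using bounds unfolding len auction_step.simps by (intro allI impI) linarith
      then show ?thesis unfolding if_not_P[OF False] by (simp add: spec_def)
    next
      case True
      have "?S \<noteq> {}" using True card_S by auto
      have "{..<m} - ?N \<noteq> {}"
      proof
        assume "{..<m} - ?N = {}"
        then have "m \<le> card ?N" using card_mono[of ?N "{..<m}"] finite_subset[OF N_sub] by auto
        then show False using True card_N card_S card_mono[OF _ S_sub] by simp
      qed
      let ?P = "\<lambda>j. if j \<in> ?S then P j - price_cut m v P E ?S else P j"
      let ?E = "preference_graph m v ?P"
      let ?A = "filter (\<lambda>i. i \<in> neighbors ?E ?S \<and> i \<notin> ?N) [0..<m]"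
      have grow: "?N \<subset> neighbors ?E ?S"
        using neighbors_grow[OF S_sub \<open>?S \<noteq> {}\<close>, of v P] \<open>{..<m} - ?N \<noteq> {}\<close> unfolding E .
      have update: "spec (procedure_U m ?E (set ?A) (Some K)) (search_cells m) (coloring_round m K)"
        unfolding procedure_U_def option.case
        by (rule spec_update_coloring[OF assms(2)]) (auto simp: neighbors_def found_goods_iff)
      show ?thesis
        unfolding if_P[OF True]
      proof (rule spec_bind_runs[OF runs_reduce_prices[OF S_sub \<open>?S \<noteq> {}\<close> \<open>{..<m} - ?N \<noteq> {}\<close>]], hypsubst,
          rule spec_bind_runs[OF runs_construct_graph], hypsubst,
          rule spec_bind_runs[OF runs_find_neighbors[OF sub]], hypsubst,
          rule spec_bind_runs[OF runs_select[OF order_refl]], hypsubst,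
          rule spec_bind[OF spec_mono[OF update order_refl]], rule spec_ret, intro allI impI)
        fix K' t t1 t2 t3 t4 t5 t6 t7
        assume K': "coloring_round m K K' t"
          and "t1 \<le> 8 * length [0..<m]" "t2 \<le> m * (5 * m + 3)" "t3 \<le> m * (8 * m + 1)"
            "t4 \<le> m * (12 * m + 2) + 5 * m" "t5 \<le> 8 * length [0..<m]" "t6 \<le> m * (5 * m + 3)"
            "t7 \<le> 8 * length [0..<m]"
        then have "t7 + (t6 + (t5 + (1 + (t4 + (t3 + (t2 + (t1 + (t + 0)))))))) \<le> t + 150 * (m + 1)^2"
          using bounds unfolding len by linarith
        then show "auction_step m v E K (Running ?P ?E K') (t7 + (t6 + (t5 + (1 + (t4 + (t3 + (t2 + (t1 + (t + 0)))))))))"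
          using grow K' unfolding auction_step.simps by blast
      qed
    qed
  qed
qed

section \<open>Potential, total time and termination\<close>

text \<open>The loss of a blue buyer may cost the anchoring; with weight 2 the level still falls by
  at least one.\<close>

definition level :: "nat \<Rightarrow> cgraph \<Rightarrow> nat" where
  "level m K = 2 * card (buyers m K {Blue}) + (if anchored m K then 0 else 1)"

text \<open>The lexicographic order of level and missing neighbors as one number. A drop of the
  level pays up to 800 units of \<open>(m + 1)^3\<close> for the coloring, up to 300 for refilling
  the second summand, and the rest of the round. A round at constant level costs at most 250 units
  of \<open>(m + 1)^2\<close> and releases at least 300.\<close>

definition potential :: "nat \<Rightarrow> graph \<Rightarrow> cgraph \<Rightarrow> nat" where
  "potential m E K =
     level m K * (1300 * (m + 1)^3) + (m - card (neighbors E (found_goods m K))) * (300 * (m + 1)^2)"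

lemma potential_decreases:
  assumes step: "auction_step m v (preference_graph m v P) K (Running P' E' K') t"
  shows "t + potential m E' K' < potential m (preference_graph m v P) K"
proof -
  let ?E = "preference_graph m v P"
  let ?S = "found_goods m K"
  let ?L = "300 * (m + 1)^2" and ?H = "1300 * (m + 1)^3"
  obtain t' where E': "E' = preference_graph m v P'" and grow: "neighbors ?E ?S \<subset> neighbors E' ?S"
    and round: "coloring_round m K K' t'" and t: "t \<le> t' + 150 * (m + 1)^2"
    using step by auto
  have bounds: "1 \<le> (m + 1)^2" "(m + 1)^2 \<le> (m + 1)^3" "m * ?L + 300 * (m + 1)^2 = 300 * (m + 1)^3"
    by (simp_all add: power2_eq_square power3_eq_cube algebra_simps)
  have fewer: "buyers m K' {Blue} \<subseteq> buyers m K {Blue}"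
    using round unfolding coloring_round_def loses_blue_def buyers_def by auto
  have fin: "finite (buyers m K {Blue})" unfolding buyers_def by simp
  consider "level m K' + 1 \<le> level m K"
    | "level m K' \<le> level m K" "t' \<le> 100 * (m + 1)^2" "\<forall>j. good_color K j \<noteq> Red \<longrightarrow> good_color K' j \<noteq> Red"
  proof -
    have le: "card (buyers m K' {Blue}) \<le> card (buyers m K {Blue})" using card_mono[OF fin fewer] .
    consider "progress m K K'" | "\<not> anchored m K" "anchored m K'"
      | "t' \<le> 100 * (m + 1)^2" "anchored m K \<longrightarrow> anchored m K'" "\<forall>j. good_color K j \<noteq> Red \<longrightarrow> good_color K' j \<noteq> Red"
      using round unfolding coloring_round_def by blast
    then show thesis
    proof cases
      case 1
      then have "buyers m K' {Blue} \<subset> buyers m K {Blue}"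
        using fewer unfolding progress_def buyers_def by auto
      then have "card (buyers m K' {Blue}) < card (buyers m K {Blue})" using fin psubset_card_mono by blast
      then show thesis using that(1) unfolding level_def by simp
    next
      case 2
      then show thesis using that(1) le unfolding level_def by simp
    next
      case 3
      then show thesis using that(2) le unfolding level_def by simp
    qed
  qed
  then show ?thesis
  proof cases
    case 1
    have "t' \<le> 800 * (m + 1)^3" using round unfolding coloring_round_def by blast
    moreover have "(m - card (neighbors E' (found_goods m K'))) * ?L \<le> m * ?L" by (rule mult_le_mono1) simp
    moreover have "level m K' * ?H + ?H \<le> level m K * ?H" using mult_le_mono1[OF 1, of ?H] by simp
    ultimately show ?thesis using t bounds unfolding potential_def by linarith
  next
    case 2
    \<comment> \<open>No good has turned red, so the growth for the old set bounds the neighbors of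
      the new one from below.\<close>
    have "?S \<subseteq> found_goods m K'" using 2(3) by (auto simp: found_goods_iff)
    then have "neighbors ?E ?S \<subset> neighbors E' (found_goods m K')"
      using grow neighbors_mono by blast
    moreover have nb: "neighbors E' (found_goods m K') \<subseteq> {..<m}" unfolding E' by (rule neighbors_preference_graph)
    ultimately have "card (neighbors ?E ?S) < card (neighbors E' (found_goods m K'))"
      by (intro psubset_card_mono finite_subset[OF nb]) auto
    moreover have "card (neighbors E' (found_goods m K')) \<le> m" using card_mono[OF _ nb] by simp
    ultimately have "(m - card (neighbors E' (found_goods m K'))) + 1 \<le> m - card (neighbors ?E ?S)" by linarith
    from mult_le_mono1[OF this, of ?L]
    have "(m - card (neighbors E' (found_goods m K'))) * ?L + ?L \<le> (m - card (neighbors ?E ?S)) * ?L" by simp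
    moreover have "level m K' * ?H \<le> level m K * ?H" using 2(1) by (rule mult_le_mono1)
    ultimately show ?thesis using t 2(2) bounds(1) unfolding potential_def by linarith
  qed
qed

text \<open>Time spent plus potential never exceeds the initial budget. The final test has no
  potential to draw on; its \<open>150 * (m + 1)^2\<close> fits into the difference between 3300 and
  3500.\<close>

fun reachable_config :: "nat \<Rightarrow> valuation \<Rightarrow> config \<Rightarrow> nat \<Rightarrow> bool" where
  "reachable_config m v (Running P E K) t \<longleftrightarrow> E = preference_graph m v P \<and> coherent K \<and>
     t + potential m E K \<le> 3300 * (m + 1)^4"
| "reachable_config m v (Returned P) t \<longleftrightarrow> t \<le> 3500 * (m + 1)^4"

lemma spec_auction_start: "spec (auction_start m v) (search_cells m + main_cells m) (reachable_config m v)"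
  unfolding auction_start_def
proof (rule spec_with_cells, rule spec_bind_runs[OF runs_initial_prices],
    rule spec_bind_runs[OF runs_construct_graph], hypsubst)
  fix P
  let ?E = "preference_graph m v P"
  let ?post = "\<lambda>y t. \<forall>t1\<le>m * (8 * m + 1). \<forall>t2\<le>m * (3 * m + 2). reachable_config m v y (t2 + (t1 + t))"
  have "runs (procedure_U m ?E {} None) (search_cells m) (250 * (m + 1)^4) coherent"
    unfolding procedure_U_def by (simp only: option.case) (rule runs_initial_coloring)
  then show "spec (do { K \<leftarrow> procedure_U m ?E {} None; ret (Running P ?E K) }) (search_cells m) ?post"
  proof (rule spec_bind_runs, intro spec_ret allI impI)
    fix K t1 t2 t3 assume K: "coherent K"
      and t: "t1 \<le> 250 * (m + 1)^4" "t2 \<le> m * (8 * m + 1)" "t3 \<le> m * (3 * m + 2)"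
    have "card (buyers m K {Blue}) \<le> m" using card_mono[of "{..<m}" "buyers m K {Blue}"] by (auto simp: buyers_def)
    then have "level m K \<le> 2 * m + 1" unfolding level_def by simp
    then have "level m K * (1300 * (m + 1)^3) \<le> (2 * m + 1) * (1300 * (m + 1)^3)" by (rule mult_le_mono1)
    moreover have "(m - card (neighbors ?E (found_goods m K))) * (300 * (m + 1)^2) \<le> m * (300 * (m + 1)^2)"
      by (rule mult_le_mono1) simp
    \<comment> \<open>Of the 3300 units of \<open>(m + 1)^4\<close>, 2600 cover the level, 300 the
      missing neighbors and 250 the initial coloring; the rest covers prices and graph.\<close>
    moreover have "(2 * m + 1) * (1300 * (m + 1)^3) + m * (300 * (m + 1)^2) +
        m * (8 * m + 1) + m * (3 * m + 2) + 250 * (m + 1)^4 \<le> 3300 * (m + 1)^4"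
      by (simp add: power2_eq_square power3_eq_cube power4_eq_xxxx algebra_simps)
    ultimately show "reachable_config m v (Running P ?E K) (t3 + (t2 + (t1 + 0)))"
      using t K unfolding potential_def reachable_config.simps by (intro conjI refl) (assumption, linarith)
  qed
qed

lemma reachable_config_step:
  assumes "reachable_config m v (Running P E K) t" and "auction_step m v E K c t'"
  shows "reachable_config m v c (t + t')"
proof (cases c)
  case (Running P' E' K')
  have "E = preference_graph m v P" using assms(1) by simp
  then have "t' + potential m E' K' < potential m E K"
    using potential_decreases assms(2) unfolding Running by blast
  moreover have "coherent K'" "E' = preference_graph m v P'"
    using assms(2) unfolding Running by (auto simp: coloring_round_def)
  moreover have "t + potential m E K \<le> 3300 * (m + 1)^4" using assms(1) unfolding reachable_config.simps by blast
  ultimately show ?thesis unfolding Running reachable_config.simps by simp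
next
  case (Returned P')
  have "(m + 1)^2 \<le> (m + 1)^4" by (rule power_increasing) auto
  then show ?thesis using assms unfolding Returned by simp
qed

lemma auction_reachable:
  assumes "auction m v c t s"
  shows "reachable_config m v c t \<and> s \<le> search_cells m + main_cells m"
  using assms
proof induction
  case (start c t s)
  then show ?case using spec_auction_start[of m v] unfolding spec_def by blast
next
  case (round P E K t s c t' s')
  then have "reachable_config m v (Running P E K) t" by blast
  moreover from this have "spec (auction_round m v P E K) (search_cells m + main_cells m) (auction_step m v E K)"
    by (intro spec_auction_round) auto
  ultimately show ?case using round reachable_config_step unfolding spec_def by (metis max.bounded_iff)
qed

lemma auction_always_returns: "always_returns m v"
  unfolding always_returns_def
proof (intro conjI)
  show "outcomes (auction_start m v) \<noteq> {}" using spec_auction_start[of m v] unfolding spec_def by blast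
  have round: "spec (auction_round m v P E K) (search_cells m + main_cells m) (auction_step m v E K)"
    if "auction m v (Running P E K) t s" for P E K t s
    using auction_reachable[OF that] by (intro spec_auction_round) auto
  show "\<forall>P E K t s. auction m v (Running P E K) t s \<longrightarrow> (\<exists>c. next_config m v (Running P E K) c)"
  proof (intro allI impI)
    fix P E K t s assume "auction m v (Running P E K) t s"
    from round[OF this] show "\<exists>c. next_config m v (Running P E K) c"
      unfolding spec_def next_config_def by fast
  qed
  show "\<not> (\<exists>f t s. auction m v (f 0) t s \<and> (\<forall>n. next_config m v (f n) (f (Suc n))))"
  proof
    assume "\<exists>f t s. auction m v (f 0) t s \<and> (\<forall>n. next_config m v (f n) (f (Suc n)))"
    then obtain f t0 s0 where f: "auction m v (f 0) t0 s0" "\<And>n. next_config m v (f n) (f (Suc n))" by blast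
    have reach: "\<exists>t s. auction m v (f n) t s" for n
    proof (induction n)
      case (Suc n)
      then show ?case using f(2)[of n] auction.round unfolding next_config_def by metis
    qed (use f(1) in blast)
    \<comment> \<open>The value 0 is only a default: in an endless run every configuration has a
      successor and is therefore \<open>Running\<close>.\<close>
    define g where "g = (\<lambda>n. case f n of Running P E K \<Rightarrow> potential m E K | Returned _ \<Rightarrow> 0)"
    have "g (Suc n) < g n" for n
    proof -
      obtain P E K t s where n: "f n = Running P E K" "(f (Suc n), t, s) \<in> outcomes (auction_round m v P E K)"
        using f(2)[of n] unfolding next_config_def by blast
      obtain P' E' K' where n': "f (Suc n) = Running P' E' K'"
        using f(2)[of "Suc n"] unfolding next_config_def by blast
      obtain t1 s1 where a: "auction m v (Running P E K) t1 s1" using reach[of n] n(1) by auto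
      then have E: "E = preference_graph m v P" using auction_reachable by fastforce
      have "auction_step m v E K (Running P' E' K') t" using round[OF a] n(2)[unfolded n'] unfolding spec_def by blast
      from potential_decreases[OF this[unfolded E]] show ?thesis by (simp add: g_def n n' E)
    qed
    note descends = this
    have "g n + n \<le> g 0" for n
    proof (induction n)
      case (Suc n)
      then show ?case using descends[of n] by linarith
    qed simp
    from this[of "Suc (g 0)"] show False by simp
  qed
qed

theorem theorem3:
  shows "\<exists>T Z :: nat \<Rightarrow> real.
    T \<in> O(\<lambda>m. real m ^ 4) \<and>
    (\<exists>k. Z \<in> O(\<lambda>m. real m ^ k)) \<and>
    (\<forall>m (v :: valuation).
       (\<forall>i<m. \<forall>j<m. v i j \<ge> 0) \<longrightarrow>
       always_returns m v \<and>
       (\<forall>c t s. auction m v c t s \<longrightarrow> real t \<le> T m \<and> real s \<le> Z m))"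
proof (intro exI conjI allI impI)
  let ?T = "\<lambda>m. real (3500 * (m + 1)^4)"
  let ?Z = "\<lambda>m. real (search_cells m + main_cells m)"
  show "?T \<in> O(\<lambda>m. real m ^ 4)"
  proof (rule bigoI[of _ "3500 * 16"], rule eventually_mono[OF eventually_ge_at_top[of 1]])
    fix m :: nat assume "1 \<le> m"
    \<comment> \<open>From \<open>m + 1 \<le> 2 * m\<close> comes the factor 16.\<close>
    then have "real (m + 1) ^ 4 \<le> (2 * real m) ^ 4" by (intro power_mono) auto
    then show "norm (?T m) \<le> 3500 * 16 * norm (real m ^ 4)" by (simp add: power_mult_distrib)
  qed
  \<comment> \<open>Memory is quadratic: the cells sum up to 5 m^2 + 30 m + 30, at most 65 m^2 for
    positive m.\<close>
  show "?Z \<in> O(\<lambda>m. real m ^ 2)"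
  proof (rule bigoI[of _ 65], rule eventually_mono[OF eventually_ge_at_top[of 1]])
    fix m :: nat assume "1 \<le> m"
    then have "m \<le> m * m" "1 \<le> m * m" by simp_all
    then have "search_cells m + main_cells m \<le> 65 * (m * m)" unfolding main_cells_def mult.assoc by linarith
    then have "?Z m \<le> real (65 * (m * m))" by (rule of_nat_mono)
    then show "norm (?Z m) \<le> 65 * norm (real m ^ 2)" by (simp add: power2_eq_square)
  qed
  fix m v
  show "always_returns m v" by (rule auction_always_returns)
  fix c t s assume "auction m v c t s"
  then have r: "reachable_config m v c t" "s \<le> search_cells m + main_cells m"
    using auction_reachable by blast+
  then show "real s \<le> ?Z m" by (simp only: of_nat_le_iff)
  have "t \<le> 3500 * (m + 1)^4" using r(1) by (cases c) auto
  then show "real t \<le> ?T m" by (simp only: of_nat_le_iff)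
qed

end
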